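(* Let $J:\widetilde{\text{Möb}}^2\times\mathbb{D}^2\to \mathrm{GL}(r,\mathbb{C})$ be the cocycle corresponding to an irreducible hermitian holomorphic vector bundle over $\mathbb{D}^2$ which is homogeneous with respect to $\text{Möb}^2$. Assume that the associated representation of $\mathfrak b\oplus\mathfrak b$ is multiplicity-free. Then $J$ takes the form $$J(\tilde g,\boldsymbol z)=\exp\Big(\sum_{i=1}^2\frac{g_i''(z_i)}{2g_i'(z_i)}\,\rho(y_i)\Big)\exp\Big(\sum_{i=1}^2\big(-\log g_i'(z_i)\big)\rho(h_i)\Big),$$ where $\rho:\mathfrak b\oplus\mathfrak b\to\mathfrak{gl}(r,\mathbb{C})$ is a multiplicity-free indecomposable representation for which there are non-negative integers $s$, $m_0,\dots,m_s$, $j_0,\dots,j_s$ such that: $\lambda_1$ and $\lambda_2$ are the largest eigenvalues of $\rho(h_1)$ and $\rho(h_2)$ respectively; $\lambda_1,\lambda_1-1,\dots,\lambda_1-s$ are the eigenvalues of $\rho(h_1)$, with multiplicities $m_0+1,m_1+1,\dots,m_s+1$ respectively; for $i\le i'$ one has $j_i\ge j_{i'}$ and $j_i+m_i\ge j_{i'}+m_{i'}$; and, for $\theta$ in the set $\{(i,j_i),(i,j_i+1),\dots,(i,j_i+m_i):0\le i\le s\}$, $V_\theta$ is the joint eigenspace of $(\rho(h_1),\rho(h_2))$ associated to the joint eigenvalue $(\lambda_1-\theta_1,\lambda_2-\theta_2)$, and $\rho(y_i)V_\theta=V_{\theta+\varepsilon_i}$, $i=1,2$ (with $V_\theta=\{0\}$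 for $\theta$ outside this set).
   Context: $\mathbb D$ is the open unit disc, $\text{Möb}$ its group of biholomorphic automorphisms, $\widetilde{\text{Möb}}$ the universal covering group of $\text{Möb}$; $\text{Möb}^2$ acts on $\mathbb D^2$ coordinatewise. For $\tilde g\in\widetilde{\text{Möb}}^2$ its image in $\text{Möb}^2$ is $g=(g_1,g_2)$. The functions $\log g_i'(z_i)$ are the real analytic branches on $\widetilde{\text{Möb}}\times\mathbb D$ (holomorphic in $z_i$) vanishing at the identity. A hermitian holomorphic vector bundle $E\to\mathbb D^2$ is homogeneous with respect to $\text{Möb}^2$ if the action of $\text{Möb}^2$ on $\mathbb{D}^2$ lifts to isometric bundle automorphisms of $E$; then $\widetilde{\text{Möb}}^2$ acts on $E$ by isometric holomorphic bundle maps. $E$ is irreducible if it is not an orthogonal direct sum of two proper holomorphic subbundles. The cocycle corresponding to $E$ is $J(\tilde g,\boldsymbol z)=\phi_{\boldsymbol z}\circ\tilde g_{\boldsymbol z}^{-1}\circ\phi_{g(\boldsymbol z)}^{-1}$, where $\phi$ is a global holomorphic trivialization of $E$, $\phi_{\boldsymbol z}:E_{\boldsymbol z}\to\mathbb C^r$ and $\tilde g_{\boldsymbol z}:E_{\boldsymbol z}\to E_{g(\boldsymbol z)}$ is the action. It is determined up to equivalence: another trivialization replaces $J$ by $A(\boldsymbol z)J(\tilde g,\boldsymbol z)A(g(\boldsymbol z))^{-1}$ with $A:\mathbb D^2\to\mathrm{GL}(r,\mathbb C)$ holomorphic; "takes the form" is understood for a suitable trivialization. $\mathfrak b\subset\mathfrak{sl}(2,\mathbb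 C)$ is the Lie algebra of lower triangular matrices, spanned by $h=\frac12\begin{pmatrix}1&0\\0&-1\end{pmatrix}$ and $y=\begin{pmatrix}0&0\\1&0\end{pmatrix}$, so $[h,y]=-y$. In $\mathfrak b\oplus\mathfrak b$ put $h_1=(h,0),h_2=(0,h),y_1=(y,0),y_2=(0,y)$. Associated representation: let $\tilde G$ be the universal covering group of $\mathrm{SU}(1,1)^2$ and $\tilde{\mathbb K}$ the stabilizer of $0\in\mathbb D^2$. $\tilde{\mathbb K}$ acts on the fibre $E_0\cong\mathbb C^r$; the induced representation of the complexified Lie algebra $\mathfrak k^{\mathbb C}=\mathrm{span}(h_1,h_2)$ extends to a representation $\rho$ of $\mathfrak b\oplus\mathfrak b$ describing the holomorphic structure: sections of $E$ correspond to $F:\tilde G\to\mathbb C^r$ with $F(\tilde g\tilde k)=\rho(\tilde k)^{-1}F(\tilde g)$, and the section is holomorphic iff $XF=-\rho(X)F$ for all $X\in\mathfrak b\oplus\mathfrak b$, acting as left invariant complex vector fields. All representations $\rho$ considered have $\rho(h_1),\rho(h_2)$ diagonalizable. $\rho$ is multiplicity-free if every joint eigenspace of $(\rho(h_1),\rho(h_2))$ is one dimensional. $\rho$ is indecomposable if $\mathbb C^r$ is not the direct sum of two nonzero $\rho$-invariant subspaces. $\varepsilon_1=(1,0)$, $\varepsilon_2=(0,1)$. *)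

theory Defs
  imports "HOL-Complex_Analysis.Complex_Analysis" "HOL-Algebra.Group"
begin

no_notation fps_nth (infixl "$" 75)

section \<open>The Moebius group of the disc and its universal covering group\<close>

abbreviation disc :: "complex set" where
  "disc \<equiv> ball 0 1"

abbreviation bidisc :: "(complex \<times> complex) set" where
  "bidisc \<equiv> disc \<times> disc"

text \<open>Biholomorphic automorphisms of the disc. Only the values on the disc matter.\<close>

definition Moeb :: "(complex \<Rightarrow> complex) set" where
  "Moeb = {g. g holomorphic_on disc \<and> g ` disc \<subseteq> disc \<and>
     (\<exists>h. h holomorphic_on disc \<and> h ` disc \<subseteq> disc \<and> (\<forall>z\<in>disc. h (g z) = z \<and> g (h z) = z))}"

text \<open>
  The Moebius transformations \<open>Moebius_function t a z = exp (\<i> t) (z - a) / (1 - cnj a z)\<close>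
  with \<open>(cis t, a)\<close> in the product of the circle and the disc are the elements of \<open>Moeb\<close>. The
  universal covering group is obtained by letting \<open>t\<close> range over the line: its underlying
  simply connected manifold is \<open>UNIV \<times> disc\<close>, and the product below is the lift of the
  composition of Moebius transformations. The lemmas of this section show that it is a group and
  that \<open>mob_of\<close> is a homomorphism onto \<open>Moeb\<close> which forgets \<open>t\<close> modulo \<open>2 * pi\<close>.\<close>

definition mob_cover :: "(real \<times> complex) monoid" where
  "mob_cover = \<lparr>carrier = UNIV \<times> disc,
     mult = (\<lambda>(t, a) (s, b).
       (t + s + 2 * Im (Ln (1 + cnj b * a * cis (- s))),
        (b + a * cis (- s)) / (1 + cnj b * a * cis (- s)))),
     one = (0, 0)\<rparr>"

definition mob_of :: "real \<times> complex \<Rightarrow> complex \<Rightarrow> complex" where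
  "mob_of x = Moebius_function (fst x) (snd x)"

text \<open>
  The branch of \<open>log g'\<close> on the covering group times the disc which is continuous and vanishes
  at the identity; see the lemmas \<open>exp_log_mob_deriv\<close>, \<open>log_mob_deriv_one\<close>,
  \<open>continuous_on_log_mob_deriv\<close>.\<close>

definition log_mob_deriv :: "real \<times> complex \<Rightarrow> complex \<Rightarrow> complex" where
  "log_mob_deriv x z =
     \<i> * of_real (fst x) + of_real (ln (1 - (cmod (snd x))\<^sup>2)) - 2 * Ln (1 - cnj (snd x) * z)"

lemma carrier_mob_cover [simp]: "x \<in> carrier mob_cover \<longleftrightarrow> cmod (snd x) < 1"
  by (cases x) (simp add: mob_cover_def)

lemma one_mob_cover [simp]: "\<one>\<^bsub>mob_cover\<^esub> = (0, 0)"
  by (simp add: mob_cover_def)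

lemma mult_mob_cover:
  "(t, a) \<otimes>\<^bsub>mob_cover\<^esub> (s, b) =
     (t + s + 2 * Im (Ln (1 + cnj b * a * cis (- s))),
      (b + a * cis (- s)) / (1 + cnj b * a * cis (- s)))"
  by (simp add: mob_cover_def)

lemma Re_one_plus_pos:
  assumes "cmod a < 1" "cmod b \<le> 1"
  shows "0 < Re (1 + a * b)" "0 < Re (1 - a * b)"
proof -
  have "cmod (a * b) < 1"
    using assms by (metis mult_le_cancel_left1 norm_ge_zero norm_mult order.strict_trans2 order_le_less_trans mult.commute mult_left_le)
  then show "0 < Re (1 + a * b)" "0 < Re (1 - a * b)"
    using abs_Re_le_cmod [of "a * b"] by (auto simp: abs_le_iff)
qed

lemma mob_of_in_disc: "cmod (snd x) < 1 \<Longrightarrow> cmod z < 1 \<Longrightarrow> cmod (mob_of x z) < 1"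
  by (simp add: mob_of_def Moebius_function_norm_lt_1)

lemma has_field_derivative_mob_of:
  assumes "cmod (snd x) < 1" "cmod z < 1"
  shows "(mob_of x has_field_derivative
     cis (fst x) * of_real (1 - (cmod (snd x))\<^sup>2) / (1 - cnj (snd x) * z)\<^sup>2) (at z)"
proof -
  have nz: "1 - cnj (snd x) * z \<noteq> 0"
    using Re_one_plus_pos(2)[of "cnj (snd x)" z] assms by (auto simp del: minus_complex.sel)
  have "((\<lambda>z. exp (\<i> * of_real (fst x)) * (z - snd x) / (1 - cnj (snd x) * z)) has_field_derivative
      (exp (\<i> * of_real (fst x)) * (1 - cnj (snd x) * z) - exp (\<i> * of_real (fst x)) * (z - snd x) * (- cnj (snd x)))
        / ((1 - cnj (snd x) * z) * (1 - cnj (snd x) * z))) (at z)"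
    using nz by (auto intro!: derivative_eq_intros)
  moreover have "exp (\<i> * of_real (fst x)) * (1 - cnj (snd x) * z) - exp (\<i> * of_real (fst x)) * (z - snd x) * (- cnj (snd x))
      = cis (fst x) * of_real (1 - (cmod (snd x))\<^sup>2)"
    by (simp add: cis_conv_exp complex_norm_square algebra_simps del: of_real_power)
  ultimately show ?thesis
    by (simp add: mob_of_def Moebius_function_def power2_eq_square)
qed

lemma exp_log_mob_deriv:
  assumes "x \<in> carrier mob_cover" "z \<in> disc"
  shows "exp (log_mob_deriv x z) = deriv (mob_of x) z"
proof -
  have xz: "cmod (snd x) < 1" "cmod z < 1" using assms by auto
  have nz: "1 - cnj (snd x) * z \<noteq> 0"
    using Re_one_plus_pos(2)[of "cnj (snd x)" z] xz by (auto simp del: minus_complex.sel)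
  have pos: "1 - (cmod (snd x))\<^sup>2 > 0"
    using xz by (simp add: power_less_one_iff abs_square_less_1)
  have "exp (log_mob_deriv x z)
      = exp (\<i> * of_real (fst x)) * exp (of_real (ln (1 - (cmod (snd x))\<^sup>2))) / exp (2 * Ln (1 - cnj (snd x) * z))"
    by (simp add: log_mob_deriv_def exp_add exp_diff)
  also have "exp (complex_of_real (ln (1 - (cmod (snd x))\<^sup>2))) = of_real (1 - (cmod (snd x))\<^sup>2)"
    using pos by (simp only: exp_of_real exp_ln)
  also have "exp (2 * Ln (1 - cnj (snd x) * z)) = (1 - cnj (snd x) * z)\<^sup>2"
    using nz by (simp add: exp_double)
  finally show ?thesis
    using DERIV_imp_deriv[OF has_field_derivative_mob_of[OF xz]] by (simp add: cis_conv_exp)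
qed

lemma log_mob_deriv_one: "log_mob_deriv \<one>\<^bsub>mob_cover\<^esub> z = 0"
  by (simp add: log_mob_deriv_def)

lemma continuous_on_log_mob_deriv:
  "continuous_on (carrier mob_cover \<times> disc) (\<lambda>(x, z). log_mob_deriv x z)"
proof -
  have "1 - cnj (snd (fst p)) * snd p \<notin> \<real>\<^sub>\<le>\<^sub>0" if "p \<in> carrier mob_cover \<times> disc" for p
    using that Re_one_plus_pos(2)[of "cnj (snd (fst p))" "snd p"]
    by (auto simp: complex_nonpos_Reals_iff)
  moreover have "1 - (cmod (snd (fst p)))\<^sup>2 \<noteq> 0" if "p \<in> carrier mob_cover \<times> disc" for p
  proof -
    have "(cmod (snd (fst p)))\<^sup>2 < 1" using that by (auto simp: abs_square_less_1)
    then show ?thesis by simp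
  qed
  ultimately show ?thesis
    unfolding log_mob_deriv_def case_prod_beta
    by (intro continuous_intros) auto
qed

lemma mult_mob_cover_aux:
  fixes a b z :: complex and s :: real
  assumes "cmod a < 1" "cmod b < 1" "cmod z < 1"
  defines "w \<equiv> 1 + cnj b * a * cis (- s)"
  defines "c \<equiv> (b + a * cis (- s)) / w"
  shows "w \<noteq> 0" "0 < Re w"
    and "(1 - cnj a * mob_of (s, b) z) * (1 - cnj b * z) = cnj w * (1 - cnj c * z)"
    and "(mob_of (s, b) z - a) * (1 - cnj b * z) = cis s * w * (z - c)"
    and "1 - (cmod c)\<^sup>2 = (1 - (cmod a)\<^sup>2) * (1 - (cmod b)\<^sup>2) / (cmod w)\<^sup>2"
    and "cmod c < 1"
proof -
  have "cmod (a * cis (- s)) \<le> 1" using assms by (simp add: norm_mult)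
  from Re_one_plus_pos(1)[OF _ this, of "cnj b"] assms
  show rw: "0 < Re w" by (simp add: w_def mult.assoc)
  then show w: "w \<noteq> 0" by auto
  from Re_one_plus_pos(2)[of "cnj b" z] assms
  have rz: "0 < Re (1 - cnj b * z)" by simp
  then have nz: "1 - cnj b * z \<noteq> 0" by (metis less_irrefl zero_complex.sel(1))
  have cs: "cis s * cis (- s) = 1" by (simp add: cis_mult)
  have M: "mob_of (s, b) z * (1 - cnj b * z) = cis s * (z - b)"
    using nz by (simp add: mob_of_def Moebius_function_def cis_conv_exp)
  have cw: "c * w = b + a * cis (- s)" using w by (simp add: c_def)
  have ccw: "cnj c * cnj w = cnj b + cnj a * cis s"
    using arg_cong[OF cw, of cnj] by (simp add: cis_cnj)
  have cnjw: "cnj w = 1 + b * cnj a * cis s" by (simp add: w_def cis_cnj)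
  have "(1 - cnj a * mob_of (s, b) z) * (1 - cnj b * z)
      = (1 - cnj b * z) - cnj a * (mob_of (s, b) z * (1 - cnj b * z))"
    by (simp add: algebra_simps)
  also have "\<dots> = cnj w - (cnj c * cnj w) * z"
    unfolding M ccw unfolding cnjw by (simp add: algebra_simps)
  finally show "(1 - cnj a * mob_of (s, b) z) * (1 - cnj b * z) = cnj w * (1 - cnj c * z)"
    by (simp add: algebra_simps)
  have "(mob_of (s, b) z - a) * (1 - cnj b * z)
      = mob_of (s, b) z * (1 - cnj b * z) - a * (1 - cnj b * z)"
    by (simp add: algebra_simps)
  also have "\<dots> = cis s * z + a * cnj b * z - (cis s * b + a)"
    unfolding M by (simp add: algebra_simps)
  also have "cis s * z + a * cnj b * z = cis s * w * z"
    using cs by (simp add: w_def algebra_simps)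
  also have "cis s * b + a = cis s * (c * w)"
    unfolding cw using cs by (simp add: algebra_simps)
  finally show "(mob_of (s, b) z - a) * (1 - cnj b * z) = cis s * w * (z - c)"
    by (simp add: algebra_simps)
  have "complex_of_real ((cmod w)\<^sup>2 - (cmod (c * w))\<^sup>2) = w * cnj w - (c * w) * cnj (c * w)"
    by (simp only: of_real_diff complex_norm_square)
  also have "\<dots> = w * cnj w - (b + a * cis (- s)) * (cnj b + cnj a * cis s)"
    unfolding cw by (simp add: cis_cnj)
  also have "\<dots> = 1 + (a * cnj a) * (b * cnj b) * (cis s * cis (- s)) - b * cnj b - a * cnj a * (cis s * cis (- s))"
    unfolding cnjw unfolding w_def by (simp only: algebra_simps mult_1_left mult_1_right)
  also have "\<dots> = (1 - a * cnj a) * (1 - b * cnj b)"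
    unfolding cs by (simp add: algebra_simps)
  also have "\<dots> = of_real ((1 - (cmod a)\<^sup>2) * (1 - (cmod b)\<^sup>2))"
    by (simp only: of_real_mult of_real_diff complex_norm_square of_real_1)
  finally have "(cmod w)\<^sup>2 - (cmod c)\<^sup>2 * (cmod w)\<^sup>2 = (1 - (cmod a)\<^sup>2) * (1 - (cmod b)\<^sup>2)"
    by (simp only: of_real_eq_iff norm_mult power_mult_distrib)
  then show eq: "1 - (cmod c)\<^sup>2 = (1 - (cmod a)\<^sup>2) * (1 - (cmod b)\<^sup>2) / (cmod w)\<^sup>2"
    using w by (simp add: field_simps)
  have "(1 - (cmod a)\<^sup>2) * (1 - (cmod b)\<^sup>2) / (cmod w)\<^sup>2 > 0"
    using assms w by (simp add: abs_square_less_1)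
  then have "(cmod c)\<^sup>2 < 1" using eq by linarith
  then show "cmod c < 1" by (simp add: abs_square_less_1)
qed

lemma mult_mob_cover_closed:
  "x \<in> carrier mob_cover \<Longrightarrow> y \<in> carrier mob_cover \<Longrightarrow> x \<otimes>\<^bsub>mob_cover\<^esub> y \<in> carrier mob_cover"
  using mult_mob_cover_aux(6)[of "snd x" "snd y" 0 "fst y"]
  by (cases x; cases y) (simp add: mult_mob_cover)

lemma Ln_mult_right_half:
  assumes "0 < Re u" "0 < Re v" "0 < Re u'" "0 < Re v'" "u * v = u' * v'"
  shows "Ln u + Ln v = Ln u' + Ln v'"
proof -
  have nz: "u \<noteq> 0" "v \<noteq> 0" "u' \<noteq> 0" "v' \<noteq> 0" using assms by auto
  have *: "Ln (a * b) = Ln a + Ln b" if "0 < Re a" "0 < Re b" for a b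
    using Re_Ln_pos_lt_imp[OF that(1)] Re_Ln_pos_lt_imp[OF that(2)] that
    by (subst Ln_times_simple) auto
  show ?thesis using * assms by metis
qed

lemma log_mob_deriv_mult:
  assumes "x \<in> carrier mob_cover" "y \<in> carrier mob_cover" "z \<in> disc"
  shows "log_mob_deriv (x \<otimes>\<^bsub>mob_cover\<^esub> y) z = log_mob_deriv x (mob_of y z) + log_mob_deriv y z"
proof -
  obtain t a s b where xy: "x = (t, a)" "y = (s, b)" by (cases x; cases y)
  have n: "cmod a < 1" "cmod b < 1" "cmod z < 1" using assms xy by auto
  define w where "w = 1 + cnj b * a * cis (- s)"
  define c where "c = (b + a * cis (- s)) / w"
  note aux = mult_mob_cover_aux[OF n, of s, folded w_def, folded c_def]
  have m: "cmod (mob_of (s, b) z) < 1" using n mob_of_in_disc[of "(s, b)" z] by simp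
  have L: "Ln (1 - cnj a * mob_of (s, b) z) + Ln (1 - cnj b * z) = Ln (cnj w) + Ln (1 - cnj c * z)"
    using aux m n Re_one_plus_pos(2)[of "cnj b" z] Re_one_plus_pos(2)[of "cnj a" "mob_of (s, b) z"] Re_one_plus_pos(2)[of "cnj c" z]
    by (intro Ln_mult_right_half) auto
  have p: "1 - (cmod a)\<^sup>2 > 0" "1 - (cmod b)\<^sup>2 > 0"
    using n by (auto simp: abs_square_less_1)
  have ln: "ln (1 - (cmod c)\<^sup>2) = ln (1 - (cmod a)\<^sup>2) + ln (1 - (cmod b)\<^sup>2) - 2 * ln (cmod w)"
    unfolding aux(5) using p aux(1) by (simp add: ln_div ln_mult ln_realpow)
  have cw: "Ln (cnj w) = cnj (Ln w)"
    using aux(2) by (intro cnj_Ln[symmetric]) (auto simp: complex_nonpos_Reals_iff)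
  have "Ln w = of_real (ln (cmod w)) + \<i> * of_real (Im (Ln w))"
    using aux(1) by (simp add: complex_eq_iff)
  then have I: "Ln (cnj w) = of_real (ln (cmod w)) - \<i> * of_real (Im (Ln w))"
    unfolding cw by (simp add: complex_eq_iff)
  have "log_mob_deriv (x \<otimes>\<^bsub>mob_cover\<^esub> y) z
      = \<i> * of_real (t + s + 2 * Im (Ln w)) + of_real (ln (1 - (cmod c)\<^sup>2)) - 2 * Ln (1 - cnj c * z)"
    by (simp add: xy mult_mob_cover log_mob_deriv_def w_def c_def)
  also have "\<dots> = \<i> * of_real (t + s + 2 * Im (Ln w))
      + of_real (ln (1 - (cmod a)\<^sup>2) + ln (1 - (cmod b)\<^sup>2) - 2 * ln (cmod w))
      - 2 * (Ln (1 - cnj a * mob_of (s, b) z) + Ln (1 - cnj b * z) - Ln (cnj w))"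
    unfolding ln using L by (simp add: algebra_simps)
  also have "\<dots> = log_mob_deriv x (mob_of y z) + log_mob_deriv y z"
    unfolding I by (simp add: xy log_mob_deriv_def algebra_simps)
  finally show ?thesis .
qed

lemma mob_of_mult:
  assumes "x \<in> carrier mob_cover" "y \<in> carrier mob_cover" "z \<in> disc"
  shows "mob_of (x \<otimes>\<^bsub>mob_cover\<^esub> y) z = mob_of x (mob_of y z)"
proof -
  obtain t a s b where xy: "x = (t, a)" "y = (s, b)" by (cases x; cases y)
  have n: "cmod a < 1" "cmod b < 1" "cmod z < 1" using assms xy by auto
  define w where "w = 1 + cnj b * a * cis (- s)"
  define c where "c = (b + a * cis (- s)) / w"
  note aux = mult_mob_cover_aux[OF n, of s, folded w_def, folded c_def]
  have cnjw: "cnj w \<noteq> 0" using aux(1) by simp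
  have cz: "1 - cnj c * z \<noteq> 0"
    using Re_one_plus_pos(2)[of "cnj c" z] aux(6) n by (auto simp del: minus_complex.sel)
  have bz: "1 - cnj b * z \<noteq> 0"
    using Re_one_plus_pos(2)[of "cnj b" z] n by (auto simp del: minus_complex.sel)
  have "cis (2 * Im (Ln w)) * cnj w = w"
  proof -
    have "cis (2 * Im (Ln w)) = exp (Ln w - cnj (Ln w))"
      by (simp add: cis_conv_exp complex_diff_cnj mult.commute)
    also have "\<dots> = w / cnj w"
      using aux(1) by (simp add: exp_diff exp_cnj[symmetric])
    finally show ?thesis using cnjw by simp
  qed
  then have rot: "cis (2 * Im (Ln w)) = w / cnj w" using cnjw by (simp add: field_simps)
  have "mob_of (x \<otimes>\<^bsub>mob_cover\<^esub> y) z = cis (t + s + 2 * Im (Ln w)) * (z - c) / (1 - cnj c * z)"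
    by (simp add: xy mult_mob_cover mob_of_def Moebius_function_def cis_conv_exp w_def c_def)
  also have "cis (t + s + 2 * Im (Ln w)) = cis t * cis s * (w / cnj w)"
    unfolding rot[symmetric] by (simp add: cis_mult)
  also have "cis t * cis s * (w / cnj w) * (z - c) / (1 - cnj c * z)
      = cis t * (cis s * w * (z - c)) / (cnj w * (1 - cnj c * z))"
    by simp
  also have "\<dots> = cis t * ((mob_of (s, b) z - a) * (1 - cnj b * z))
      / ((1 - cnj a * mob_of (s, b) z) * (1 - cnj b * z))"
    unfolding aux(3) aux(4) ..
  also have "\<dots> = cis t * (mob_of (s, b) z - a) / (1 - cnj a * mob_of (s, b) z)"
    using bz by simp
  also have "\<dots> = mob_of x (mob_of y z)"
    by (simp add: xy mob_of_def Moebius_function_def cis_conv_exp)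
  finally show ?thesis .
qed

lemma mob_of_eq_imp_snd_eq:
  assumes "cmod (snd x) < 1" "cmod (snd y) < 1" "\<And>z. z \<in> disc \<Longrightarrow> mob_of x z = mob_of y z"
  shows "snd x = snd y"
proof -
  have "mob_of y (snd x) = 0"
    using assms(3)[of "snd x"] assms(1) by (simp add: mob_of_def Moebius_function_eq_zero)
  moreover have "1 - cnj (snd y) * snd x \<noteq> 0"
    using Re_one_plus_pos(2)[of "cnj (snd y)" "snd x"] assms by (auto simp del: minus_complex.sel)
  ultimately show ?thesis by (simp add: mob_of_def Moebius_function_def)
qed

lemma mob_cover_eqI:
  assumes "x \<in> carrier mob_cover" "y \<in> carrier mob_cover"
    and "\<And>z. z \<in> disc \<Longrightarrow> mob_of x z = mob_of y z"
    and "\<And>z. z \<in> disc \<Longrightarrow> log_mob_deriv x z = log_mob_deriv y z"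
  shows "x = y"
proof -
  have e: "snd x = snd y" using assms by (intro mob_of_eq_imp_snd_eq) auto
  moreover have "log_mob_deriv x 0 = log_mob_deriv y 0" using assms(4) by simp
  ultimately have "fst x = fst y" by (simp add: log_mob_deriv_def)
  with e show ?thesis by (simp add: prod_eq_iff)
qed

lemma group_mob_cover: "group mob_cover"
proof (rule groupI)
  fix x y z
  assume c: "x \<in> carrier mob_cover" "y \<in> carrier mob_cover" "z \<in> carrier mob_cover"
  show "x \<otimes>\<^bsub>mob_cover\<^esub> y \<in> carrier mob_cover" using c mult_mob_cover_closed by blast
  have m: "mob_of z u \<in> disc" if "u \<in> disc" for u
    using that c mob_of_in_disc by auto
  show "x \<otimes>\<^bsub>mob_cover\<^esub> y \<otimes>\<^bsub>mob_cover\<^esub> z = x \<otimes>\<^bsub>mob_cover\<^esub> (y \<otimes>\<^bsub>mob_cover\<^esub> z)"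
    by (rule mob_cover_eqI)
       (use c m in \<open>auto simp: mult_mob_cover_closed mob_of_mult log_mob_deriv_mult
          simp del: carrier_mob_cover mem_ball_0\<close>)
next
  show "\<one>\<^bsub>mob_cover\<^esub> \<in> carrier mob_cover" by simp
next
  fix x assume c: "x \<in> carrier mob_cover"
  show "\<one>\<^bsub>mob_cover\<^esub> \<otimes>\<^bsub>mob_cover\<^esub> x = x"
    by (cases x) (simp add: mult_mob_cover)
  obtain t a where x: "x = (t, a)" by (cases x)
  have a: "cmod a < 1" using c x by simp
  have cs: "cis t * cis (- t) = 1" by (simp add: cis_mult)
  have "1 + cnj a * (- (cis t * a)) * cis (- t) = 1 - (a * cnj a) * (cis t * cis (- t))"
    by (simp add: algebra_simps)
  then have e: "1 + cnj a * (- (cis t * a)) * cis (- t) = of_real (1 - (cmod a)\<^sup>2)"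
    by (simp only: cs of_real_diff of_real_1 complex_norm_square mult_1_right)
  have "a + (- (cis t * a)) * cis (- t) = a - a * (cis t * cis (- t))"
    by (simp add: algebra_simps)
  then have e': "a + (- (cis t * a)) * cis (- t) = 0"
    by (simp only: cs mult_1_right diff_self)
  have p: "1 - (cmod a)\<^sup>2 > 0" using a by (simp add: abs_square_less_1)
  have "(- t, - (cis t * a)) \<otimes>\<^bsub>mob_cover\<^esub> (t, a) = (0, 0)"
    unfolding mult_mob_cover e e' using p by (simp add: Ln_of_real del: of_real_diff)
  moreover have "(- t, - (cis t * a)) \<in> carrier mob_cover" using a by (simp add: norm_mult)
  ultimately show "\<exists>y\<in>carrier mob_cover. y \<otimes>\<^bsub>mob_cover\<^esub> x = \<one>\<^bsub>mob_cover\<^esub>"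
    unfolding x one_mob_cover by blast
qed

lemma mob_of_eq_iff:
  assumes "x \<in> carrier mob_cover" "y \<in> carrier mob_cover"
  shows "(\<forall>z\<in>disc. mob_of x z = mob_of y z) \<longleftrightarrow> cis (fst x) = cis (fst y) \<and> snd x = snd y"
proof
  assume L: "\<forall>z\<in>disc. mob_of x z = mob_of y z"
  have e: "snd x = snd y" using assms L by (intro mob_of_eq_imp_snd_eq) auto
  obtain z :: complex where z: "z \<in> disc" "z \<noteq> snd y"
  proof (cases "snd y = 0")
    case True
    then show ?thesis using that[of "1/2"] by simp
  next
    case False
    then show ?thesis using that[of 0] by simp
  qed
  have "1 - cnj (snd y) * z \<noteq> 0"
    using Re_one_plus_pos(2)[of "cnj (snd y)" z] assms z by (auto simp del: minus_complex.sel)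
  then show "cis (fst x) = cis (fst y) \<and> snd x = snd y"
    using L e z by (auto simp: mob_of_def Moebius_function_def cis_conv_exp)
qed (auto simp: mob_of_def Moebius_function_def cis_conv_exp)

lemma mob_of_in_Moeb:
  assumes "x \<in> carrier mob_cover"
  shows "mob_of x \<in> Moeb"
proof -
  interpret group mob_cover by (rule group_mob_cover)
  define y where "y = inv\<^bsub>mob_cover\<^esub> x"
  have y: "y \<in> carrier mob_cover" unfolding y_def using assms by (rule inv_closed)
  have "mob_of y (mob_of x z) = z \<and> mob_of x (mob_of y z) = z" if "z \<in> disc" for z
  proof -
    have "mob_of (0, 0) z = z" by (simp add: mob_of_def Moebius_function_def)
    then show ?thesis
      using mob_of_mult[OF assms y that] mob_of_mult[OF y assms that] assms l_inv r_inv
      by (simp add: y_def del: carrier_mob_cover)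
  qed
  moreover have "mob_of u holomorphic_on disc" "mob_of u ` disc \<subseteq> disc" if "u \<in> carrier mob_cover" for u
    using that mob_of_in_disc[of u] Moebius_function_holomorphic[of "snd u" "fst u"] by (auto simp: mob_of_def)
  ultimately show ?thesis unfolding Moeb_def using assms y by blast
qed

lemma Moeb_imp_mob_of:
  assumes "g \<in> Moeb"
  obtains x where "x \<in> carrier mob_cover" "\<forall>z\<in>disc. g z = mob_of x z"
proof -
  obtain h where g: "g holomorphic_on disc" "g ` disc \<subseteq> disc"
    and h: "h holomorphic_on disc" "h ` disc \<subseteq> disc"
    and gh: "\<And>z. z \<in> disc \<Longrightarrow> h (g z) = z \<and> g (h z) = z"
    using assms unfolding Moeb_def by blast
  define b where "b = g 0"
  have b: "cmod b < 1" using g(2) unfolding b_def by force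
  define p where "p = (0::real, b)"
  have p: "p \<in> carrier mob_cover" using b by (simp add: p_def)
  obtain q where q: "mob_of p holomorphic_on disc" "mob_of p ` disc \<subseteq> disc"
    "q holomorphic_on disc" "q ` disc \<subseteq> disc" "\<And>z. z \<in> disc \<Longrightarrow> q (mob_of p z) = z \<and> mob_of p (q z) = z"
    using mob_of_in_Moeb[OF p] unfolding Moeb_def by blast
  define f where "f = mob_of p \<circ> g"
  define k where "k = h \<circ> q"
  have f: "f holomorphic_on disc" "f ` disc \<subseteq> disc"
    unfolding f_def using holomorphic_on_compose_gen[OF g(1) q(1) g(2)] g(2) q(2) by fastforce+
  have k: "k holomorphic_on disc" "k ` disc \<subseteq> disc"
    unfolding k_def using holomorphic_on_compose_gen[OF q(3) h(1) q(4)] h(2) q(4) by fastforce+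
  have kf: "k (f z) = z" if "z \<in> disc" for z
    using that q gh g by (auto simp: k_def f_def image_subset_iff)
  have f0: "f 0 = 0" by (simp add: f_def b_def p_def mob_of_def Moebius_function_eq_zero)
  have k0: "k 0 = 0" using kf[of 0] f0 by simp
  have "cmod (f (1/2)) = cmod (1/2)"
  proof (rule antisym)
    show "cmod (f (1/2)) \<le> cmod (1/2)"
      by (rule Schwarz_Lemma(1)) (use f f0 in \<open>auto simp: image_subset_iff\<close>)
    have "cmod (k (f (1/2))) \<le> cmod (f (1/2))"
      by (rule Schwarz_Lemma(1)) (use k k0 f in \<open>auto simp: image_subset_iff\<close>)
    then show "cmod (1/2) \<le> cmod (f (1/2))" using kf[of "1/2"] by simp
  qed
  then have "(\<exists>z. cmod z < 1 \<and> z \<noteq> 0 \<and> cmod (f z) = cmod z) \<or> cmod (deriv f 0) = 1"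
    by (intro disjI1 exI[of _ "1/2"]) simp
  then obtain \<alpha> where \<alpha>: "\<And>z. cmod z < 1 \<Longrightarrow> f z = \<alpha> * z" "cmod \<alpha> = 1"
    using Schwarz_Lemma(3)[OF f(1) f0, of 0] f by (auto simp: image_subset_iff)
  define r where "r = (Arg \<alpha>, 0::complex)"
  have r: "r \<in> carrier mob_cover" by (simp add: r_def)
  have "\<alpha> \<noteq> 0" using \<alpha>(2) by auto
  then have "cis (Arg \<alpha>) = \<alpha>" using \<alpha>(2) by (simp add: cis_Arg sgn_div_norm)
  then have fr: "f z = mob_of r z" if "z \<in> disc" for z
    using \<alpha>(1) that by (simp add: r_def mob_of_def Moebius_function_def cis_conv_exp)
  interpret group mob_cover by (rule group_mob_cover)
  define x where "x = inv\<^bsub>mob_cover\<^esub> p \<otimes>\<^bsub>mob_cover\<^esub> r"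
  have ip: "inv\<^bsub>mob_cover\<^esub> p \<in> carrier mob_cover" using p by (rule inv_closed)
  have x: "x \<in> carrier mob_cover" unfolding x_def using ip r by (rule m_closed)
  have "g z = mob_of x z" if z: "z \<in> disc" for z
  proof -
    have gz: "g z \<in> disc" using g(2) z by blast
    have "mob_of x z = mob_of (inv\<^bsub>mob_cover\<^esub> p) (f z)"
      unfolding x_def mob_of_mult[OF ip r z] fr[OF z] ..
    also have "\<dots> = mob_of (inv\<^bsub>mob_cover\<^esub> p \<otimes>\<^bsub>mob_cover\<^esub> p) (g z)"
      unfolding mob_of_mult[OF ip p gz] f_def by simp
    also have "\<dots> = g z"
      using l_inv[OF p] by (simp add: mob_of_def Moebius_function_def)
    finally show ?thesis ..
  qed
  then show ?thesis using that x by blast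
qed

lemma simply_connected_mob_cover: "simply_connected (carrier mob_cover)"
proof -
  have "carrier mob_cover = UNIV \<times> disc" by (simp add: mob_cover_def)
  moreover have "convex ((UNIV :: real set) \<times> disc)" by (intro convex_Times) auto
  ultimately show ?thesis by (simp add: convex_imp_simply_connected)
qed

type_synonym mob2 = "(real \<times> complex) \<times> (real \<times> complex)"

abbreviation mob2_cover :: "mob2 monoid" where
  "mob2_cover \<equiv> mob_cover \<times>\<times> mob_cover"

definition mob2_of :: "mob2 \<Rightarrow> complex \<times> complex \<Rightarrow> complex \<times> complex" where
  "mob2_of x = map_prod (mob_of (fst x)) (mob_of (snd x))"


section \<open>Holomorphic and smooth functions\<close>

definition holomorphic2_on :: "(complex \<times> complex \<Rightarrow> complex) \<Rightarrow> (complex \<times> complex) set \<Rightarrow> bool" where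
  "holomorphic2_on f U \<longleftrightarrow>
     (\<forall>z\<in>U. \<exists>a b. (f has_derivative (\<lambda>v. a * fst v + b * snd v)) (at z))"

definition vec_holomorphic2_on :: "(complex \<times> complex \<Rightarrow> complex ^ 'n) \<Rightarrow> (complex \<times> complex) set \<Rightarrow> bool" where
  "vec_holomorphic2_on f U \<longleftrightarrow> (\<forall>i. holomorphic2_on (\<lambda>z. f z $ i) U)"

primrec C_k_on :: "nat \<Rightarrow> 'a::euclidean_space set \<Rightarrow> ('a \<Rightarrow> 'b::real_normed_vector) \<Rightarrow> bool" where
  "C_k_on 0 U f \<longleftrightarrow> continuous_on U f"
| "C_k_on (Suc k) U f \<longleftrightarrow>
     f differentiable_on U \<and> (\<forall>b\<in>Basis. C_k_on k U (\<lambda>x. frechet_derivative f (at x) b))"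

definition smooth_fun_on :: "'a::euclidean_space set \<Rightarrow> ('a \<Rightarrow> 'b::real_normed_vector) \<Rightarrow> bool" where
  "smooth_fun_on U f \<longleftrightarrow> (\<forall>k. C_k_on k U f)"


section \<open>Hermitian holomorphic vector bundles over the bidisc\<close>

text \<open>
  A bundle of rank \<open>CARD('n)\<close> is given by its total space, its projection, the
  fibrewise operations, the hermitian form (linear in the first argument), and an atlas of local
  holomorphic trivializations, a trivialization over \<open>U\<close> being a map from the part of the total
  space over \<open>U\<close> to \<open>complex ^ 'n\<close> that is a linear isomorphism on each fibre.\<close>

record ('e, 'n::finite) hbundle =
  total :: "'e set"
  bproj :: "'e \<Rightarrow> complex \<times> complex"
  badd :: "'e \<Rightarrow> 'e \<Rightarrow> 'e"
  bscale :: "complex \<Rightarrow> 'e \<Rightarrow> 'e"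
  bherm :: "'e \<Rightarrow> 'e \<Rightarrow> complex"
  batlas :: "((complex \<times> complex) set \<times> ('e \<Rightarrow> complex ^ 'n)) set"

definition fibre :: "('e, 'n::finite) hbundle \<Rightarrow> complex \<times> complex \<Rightarrow> 'e set" where
  "fibre E z = {e \<in> total E. bproj E e = z}"

text \<open>For a trivialization \<open>\<phi>\<close>, \<open>from_triv E \<phi> z\<close> is the inverse of the restriction of \<open>\<phi>\<close> to the fibre over \<open>z\<close>.\<close>

definition from_triv :: "('e, 'n::finite) hbundle \<Rightarrow> ('e \<Rightarrow> complex ^ 'n) \<Rightarrow> complex \<times> complex \<Rightarrow> complex ^ 'n \<Rightarrow> 'e" where
  "from_triv E \<phi> z = inv_into (fibre E z) \<phi>"

definition linear_triv :: "('e, 'n::finite) hbundle \<Rightarrow> (complex \<times> complex) set \<Rightarrow> ('e \<Rightarrow> complex ^ 'n) \<Rightarrow> bool" where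
  "linear_triv E U \<phi> \<longleftrightarrow> open U \<and> U \<subseteq> bidisc \<and>
     (\<forall>z\<in>U. bij_betw \<phi> (fibre E z) UNIV \<and>
        (\<forall>u\<in>fibre E z. \<forall>v\<in>fibre E z. \<phi> (badd E u v) = \<phi> u + \<phi> v) \<and>
        (\<forall>c. \<forall>u\<in>fibre E z. \<phi> (bscale E c u) = c *s \<phi> u))"

definition holomorphic_transition :: "('e, 'n::finite) hbundle \<Rightarrow> (complex \<times> complex) set \<Rightarrow> ('e \<Rightarrow> complex ^ 'n)
    \<Rightarrow> (complex \<times> complex) set \<Rightarrow> ('e \<Rightarrow> complex ^ 'n) \<Rightarrow> bool" where
  "holomorphic_transition E U \<phi> V \<psi> \<longleftrightarrow>
     (\<forall>v. vec_holomorphic2_on (\<lambda>z. \<psi> (from_triv E \<phi> z v)) (U \<inter> V))"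

definition holomorphic_bundle :: "('e, 'n::finite) hbundle \<Rightarrow> bool" where
  "holomorphic_bundle E \<longleftrightarrow>
     bproj E ` total E \<subseteq> bidisc \<and>
     (\<forall>z\<in>bidisc. (\<forall>u\<in>fibre E z. \<forall>v\<in>fibre E z. badd E u v \<in> fibre E z) \<and>
                  (\<forall>c. \<forall>u\<in>fibre E z. bscale E c u \<in> fibre E z)) \<and>
     (\<forall>(U, \<phi>)\<in>batlas E. linear_triv E U \<phi>) \<and>
     (\<Union>(U, \<phi>)\<in>batlas E. U) = bidisc \<and>
     (\<forall>(U, \<phi>)\<in>batlas E. \<forall>(V, \<psi>)\<in>batlas E. holomorphic_transition E U \<phi> V \<psi>)"

definition hermitian_holomorphic_bundle :: "('e, 'n::finite) hbundle \<Rightarrow> bool" where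
  "hermitian_holomorphic_bundle E \<longleftrightarrow> holomorphic_bundle E \<and>
     (\<forall>z\<in>bidisc. \<forall>u\<in>fibre E z. \<forall>v\<in>fibre E z.
        (\<forall>w\<in>fibre E z. bherm E (badd E u v) w = bherm E u w + bherm E v w) \<and>
        (\<forall>c. bherm E (bscale E c u) v = c * bherm E u v) \<and>
        bherm E v u = cnj (bherm E u v) \<and>
        (u \<noteq> bscale E 0 u \<longrightarrow> 0 < Re (bherm E u u))) \<and>
     (\<forall>(U, \<phi>)\<in>batlas E. \<forall>v w.
        smooth_fun_on U (\<lambda>z. bherm E (from_triv E \<phi> z v) (from_triv E \<phi> z w)))"

definition holomorphic_triv :: "('e, 'n::finite) hbundle \<Rightarrow> (complex \<times> complex) set \<Rightarrow> ('e \<Rightarrow> complex ^ 'n) \<Rightarrow> bool" where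
  "holomorphic_triv E U \<phi> \<longleftrightarrow> linear_triv E U \<phi> \<and>
     (\<forall>(V, \<psi>)\<in>batlas E. holomorphic_transition E U \<phi> V \<psi> \<and> holomorphic_transition E V \<psi> U \<phi>)"

abbreviation global_holomorphic_triv :: "('e, 'n::finite) hbundle \<Rightarrow> ('e \<Rightarrow> complex ^ 'n) \<Rightarrow> bool" where
  "global_holomorphic_triv E \<phi> \<equiv> holomorphic_triv E bidisc \<phi>"

definition bundle_section :: "('e, 'n::finite) hbundle \<Rightarrow> (complex \<times> complex \<Rightarrow> 'e) \<Rightarrow> bool" where
  "bundle_section E \<sigma> \<longleftrightarrow> (\<forall>z\<in>bidisc. \<sigma> z \<in> fibre E z)"

definition holomorphic_section :: "('e, 'n::finite) hbundle \<Rightarrow> (complex \<times> complex \<Rightarrow> 'e) \<Rightarrow> bool" where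
  "holomorphic_section E \<sigma> \<longleftrightarrow> bundle_section E \<sigma> \<and>
     (\<forall>(U, \<phi>)\<in>batlas E. vec_holomorphic2_on (\<lambda>z. \<phi> (\<sigma> z)) U)"

text \<open>
  A holomorphic subbundle is given by its fibres; locally some holomorphic trivialization of \<open>E\<close>
  maps them onto a fixed coordinate subspace.\<close>

definition holomorphic_subbundle :: "('e, 'n::finite) hbundle \<Rightarrow> (complex \<times> complex \<Rightarrow> 'e set) \<Rightarrow> bool" where
  "holomorphic_subbundle E W \<longleftrightarrow>
     (\<forall>z0\<in>bidisc. \<exists>U \<phi> I. z0 \<in> U \<and> holomorphic_triv E U \<phi> \<and>
        (\<forall>z\<in>U. W z = {e \<in> fibre E z. \<forall>i. i \<notin> I \<longrightarrow> \<phi> e $ i = 0}))"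

definition proper_subbundle :: "('e, 'n::finite) hbundle \<Rightarrow> (complex \<times> complex \<Rightarrow> 'e set) \<Rightarrow> bool" where
  "proper_subbundle E W \<longleftrightarrow> holomorphic_subbundle E W \<and> (\<exists>z\<in>bidisc. W z \<noteq> fibre E z)"

definition orthogonal_direct_sum :: "('e, 'n::finite) hbundle \<Rightarrow> (complex \<times> complex \<Rightarrow> 'e set)
    \<Rightarrow> (complex \<times> complex \<Rightarrow> 'e set) \<Rightarrow> bool" where
  "orthogonal_direct_sum E W W' \<longleftrightarrow>
     (\<forall>z\<in>bidisc. (\<forall>u\<in>W z. \<forall>v\<in>W' z. bherm E u v = 0) \<and>
        fibre E z = {badd E u v | u v. u \<in> W z \<and> v \<in> W' z})"

definition irreducible_bundle :: "('e, 'n::finite) hbundle \<Rightarrow> bool" where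
  "irreducible_bundle E \<longleftrightarrow>
     \<not> (\<exists>W W'. proper_subbundle E W \<and> proper_subbundle E W' \<and> orthogonal_direct_sum E W W')"


section \<open>Homogeneous bundles and their cocycles\<close>

definition isometric_automorphism :: "('e, 'n::finite) hbundle \<Rightarrow> (complex \<times> complex \<Rightarrow> complex \<times> complex)
    \<Rightarrow> ('e \<Rightarrow> 'e) \<Rightarrow> bool" where
  "isometric_automorphism E g T \<longleftrightarrow>
     (\<forall>z\<in>bidisc. bij_betw T (fibre E z) (fibre E (g z)) \<and>
        (\<forall>u\<in>fibre E z. \<forall>v\<in>fibre E z. T (badd E u v) = badd E (T u) (T v)) \<and>
        (\<forall>c. \<forall>u\<in>fibre E z. T (bscale E c u) = bscale E c (T u)) \<and>
        (\<forall>u\<in>fibre E z. \<forall>v\<in>fibre E z. bherm E (T u) (T v) = bherm E u v)) \<and>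
     (\<forall>(U, \<phi>)\<in>batlas E. \<forall>(V, \<psi>)\<in>batlas E. \<forall>v.
        vec_holomorphic2_on (\<lambda>z. \<psi> (T (from_triv E \<phi> z v))) {z \<in> U. g z \<in> V})"

definition homogeneous_bundle :: "('e, 'n::finite) hbundle \<Rightarrow> bool" where
  "homogeneous_bundle E \<longleftrightarrow>
     (\<forall>g1\<in>Moeb. \<forall>g2\<in>Moeb. \<exists>T. isometric_automorphism E (map_prod g1 g2) T)"

text \<open>
  As usual for Lie groups, actions are smooth; the manifold structure of the covering group is the
  one of \<open>UNIV \<times> disc\<close>.\<close>

definition isometric_action :: "('e, 'n::finite) hbundle \<Rightarrow> (mob2 \<Rightarrow> 'e \<Rightarrow> 'e) \<Rightarrow> bool" where
  "isometric_action E act \<longleftrightarrow>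
     (\<forall>x\<in>carrier mob2_cover. isometric_automorphism E (mob2_of x) (act x)) \<and>
     (\<forall>e\<in>total E. act \<one>\<^bsub>mob2_cover\<^esub> e = e) \<and>
     (\<forall>x\<in>carrier mob2_cover. \<forall>y\<in>carrier mob2_cover. \<forall>e\<in>total E.
        act (x \<otimes>\<^bsub>mob2_cover\<^esub> y) e = act x (act y e)) \<and>
     (\<forall>(U, \<phi>)\<in>batlas E. \<forall>(V, \<psi>)\<in>batlas E. \<forall>v.
        smooth_fun_on {(x, z). x \<in> carrier mob2_cover \<and> z \<in> U \<and> mob2_of x z \<in> V}
          (\<lambda>(x, z). \<psi> (act x (from_triv E \<phi> z v))))"

text \<open>The matrix of \<open>\<phi>\<^sub>z \<circ> x\<^sub>z\<^sup>-\<^sup>1 \<circ> \<phi>\<^sub>x\<^sub>z\<^sup>-\<^sup>1\<close>.\<close>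

definition cocycle :: "('e, 'n::finite) hbundle \<Rightarrow> (mob2 \<Rightarrow> 'e \<Rightarrow> 'e) \<Rightarrow> ('e \<Rightarrow> complex ^ 'n)
    \<Rightarrow> mob2 \<Rightarrow> complex \<times> complex \<Rightarrow> complex ^ 'n ^ 'n" where
  "cocycle E act \<phi> x z =
     matrix (\<lambda>v. \<phi> (inv_into (fibre E z) (act x) (from_triv E \<phi> (mob2_of x z) v)))"


section \<open>Matrices\<close>

definition mat_scale :: "complex \<Rightarrow> complex ^ 'n ^ 'm \<Rightarrow> complex ^ 'n ^ 'm" where
  "mat_scale c M = (\<chi> i j. c * M $ i $ j)"

primrec mat_pow :: "complex ^ 'n ^ 'n \<Rightarrow> nat \<Rightarrow> complex ^ 'n ^ 'n" where
  "mat_pow M 0 = mat 1"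
| "mat_pow M (Suc k) = M ** mat_pow M k"

definition mat_exp :: "complex ^ 'n ^ 'n \<Rightarrow> complex ^ 'n ^ 'n" where
  "mat_exp M = (\<Sum>k. (1 / fact k) *\<^sub>R mat_pow M k)"

definition eigenspace :: "complex ^ 'n ^ 'n \<Rightarrow> complex \<Rightarrow> (complex ^ 'n) set" where
  "eigenspace M \<mu> = {v. M *v v = \<mu> *s v}"

definition eigenvalues :: "complex ^ 'n ^ 'n \<Rightarrow> complex set" where
  "eigenvalues M = {\<mu>. \<exists>v. v \<noteq> 0 \<and> M *v v = \<mu> *s v}"

text \<open>\<open>l\<close> is the largest eigenvalue of \<open>M\<close>; in particular all eigenvalues of \<open>M\<close> are real.\<close>

definition largest_eigenvalue :: "complex ^ 'n ^ 'n \<Rightarrow> real \<Rightarrow> bool" where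
  "largest_eigenvalue M l \<longleftrightarrow> complex_of_real l \<in> eigenvalues M \<and>
     (\<forall>\<mu>\<in>eigenvalues M. \<mu> \<in> \<real> \<and> Re \<mu> \<le> l)"

definition diagonalizable :: "complex ^ 'n ^ 'n \<Rightarrow> bool" where
  "diagonalizable M \<longleftrightarrow> (\<exists>P :: complex ^ 'n ^ 'n. invertible P \<and>
     (\<forall>i j. i \<noteq> j \<longrightarrow> (matrix_inv P ** M ** P) $ i $ j = 0))"


section \<open>Representations of the sum of two copies of the lower triangular algebra\<close>

type_synonym mat22 = "complex ^ 2 ^ 2"

text \<open>The ambient Lie algebra \<open>sl(2) \<oplus> sl(2)\<close> sits in \<open>mat22 \<times> mat22\<close>.\<close>

definition lower_triangular_sl2 :: "mat22 set" where
  "lower_triangular_sl2 = {X. X $ 1 $ 2 = 0 \<and> X $ 1 $ 1 + X $ 2 $ 2 = 0}"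

abbreviation bb :: "(mat22 \<times> mat22) set" where
  "bb \<equiv> lower_triangular_sl2 \<times> lower_triangular_sl2"

definition h_mat :: mat22 where
  "h_mat = vector [vector [1/2, 0], vector [0, - 1/2]]"

definition y_mat :: mat22 where
  "y_mat = vector [vector [0, 0], vector [1, 0]]"

definition h1 :: "mat22 \<times> mat22" where "h1 = (h_mat, 0)"
definition h2 :: "mat22 \<times> mat22" where "h2 = (0, h_mat)"
definition y1 :: "mat22 \<times> mat22" where "y1 = (y_mat, 0)"
definition y2 :: "mat22 \<times> mat22" where "y2 = (0, y_mat)"

definition lie_bracket :: "mat22 \<times> mat22 \<Rightarrow> mat22 \<times> mat22 \<Rightarrow> mat22 \<times> mat22" where
  "lie_bracket X Y = (fst X ** fst Y - fst Y ** fst X, snd X ** snd Y - snd Y ** snd X)"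

text \<open>
  Complex representations. Following the standing convention, the images of \<open>h1\<close> and \<open>h2\<close>
  are required to be diagonalizable.\<close>

definition bb_representation :: "(mat22 \<times> mat22 \<Rightarrow> complex ^ 'n ^ 'n) \<Rightarrow> bool" where
  "bb_representation \<rho> \<longleftrightarrow>
     (\<forall>X\<in>bb. \<forall>Y\<in>bb. \<rho> (X + Y) = \<rho> X + \<rho> Y) \<and>
     (\<forall>c. \<forall>X\<in>bb. \<rho> (map_prod (mat_scale c) (mat_scale c) X) = mat_scale c (\<rho> X)) \<and>
     (\<forall>X\<in>bb. \<forall>Y\<in>bb. \<rho> (lie_bracket X Y) = \<rho> X ** \<rho> Y - \<rho> Y ** \<rho> X) \<and>
     diagonalizable (\<rho> h1) \<and> diagonalizable (\<rho> h2)"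

definition joint_eigenspace :: "(mat22 \<times> mat22 \<Rightarrow> complex ^ 'n ^ 'n) \<Rightarrow> complex \<Rightarrow> complex \<Rightarrow> (complex ^ 'n) set" where
  "joint_eigenspace \<rho> \<mu>1 \<mu>2 = eigenspace (\<rho> h1) \<mu>1 \<inter> eigenspace (\<rho> h2) \<mu>2"

definition multiplicity_free :: "(mat22 \<times> mat22 \<Rightarrow> complex ^ 'n ^ 'n) \<Rightarrow> bool" where
  "multiplicity_free \<rho> \<longleftrightarrow>
     (\<forall>\<mu>1 \<mu>2. joint_eigenspace \<rho> \<mu>1 \<mu>2 \<noteq> {0} \<longrightarrow> vec.dim (joint_eigenspace \<rho> \<mu>1 \<mu>2) = 1)"

definition invariant_subspace :: "(mat22 \<times> mat22 \<Rightarrow> complex ^ 'n ^ 'n) \<Rightarrow> (complex ^ 'n) set \<Rightarrow> bool" where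
  "invariant_subspace \<rho> W \<longleftrightarrow> vec.subspace W \<and> (\<forall>X\<in>bb. \<forall>w\<in>W. \<rho> X *v w \<in> W)"

definition indecomposable :: "(mat22 \<times> mat22 \<Rightarrow> complex ^ 'n ^ 'n) \<Rightarrow> bool" where
  "indecomposable \<rho> \<longleftrightarrow>
     \<not> (\<exists>W W'. invariant_subspace \<rho> W \<and> invariant_subspace \<rho> W' \<and> W \<noteq> {0} \<and> W' \<noteq> {0} \<and>
          W \<inter> W' = {0} \<and> {u + v | u v. u \<in> W \<and> v \<in> W'} = UNIV)"


section \<open>The representation associated with a homogeneous bundle\<close>

text \<open>
  The conjugation of \<open>sl(2)\<close> with respect to the real form \<open>su(1,1)\<close>, and the components of
  \<open>X = su_re X + \<i> su_im X\<close> in \<open>su(1,1)\<close>.\<close>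

definition su_conj :: "mat22 \<Rightarrow> mat22" where
  "su_conj X = vector [vector [- cnj (X $ 1 $ 1), cnj (X $ 2 $ 1)],
                       vector [cnj (X $ 1 $ 2), - cnj (X $ 2 $ 2)]]"

definition su_re :: "mat22 \<Rightarrow> mat22" where
  "su_re X = mat_scale (1 / 2) (X + su_conj X)"

definition su_im :: "mat22 \<Rightarrow> mat22" where
  "su_im X = mat_scale (1 / (2 * \<i>)) (X - su_conj X)"

text \<open>
  The tangent vector at the identity \<open>(0, 0)\<close> of the covering group, in its coordinates
  \<open>real \<times> complex\<close>, of the one-parameter group generated by \<open>X\<close> in \<open>su(1,1)\<close>: to first order
  in \<open>\<epsilon>\<close>, the matrix \<open>1 + \<epsilon> X\<close> acts by \<open>z \<mapsto> ((1 + \<epsilon> X\<^sub>1\<^sub>1) z + \<epsilon> X\<^sub>1\<^sub>2) / (\<epsilon> X\<^sub>2\<^sub>1 z + 1 + \<epsilon> X\<^sub>2\<^sub>2)\<close>, that is,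
  with \<open>t = \<epsilon> Im (X\<^sub>1\<^sub>1 - X\<^sub>2\<^sub>2)\<close> and \<open>a = - \<epsilon> X\<^sub>1\<^sub>2\<close>; see the lemma \<open>su_tangent\<close>.\<close>

definition tangent_coord :: "mat22 \<Rightarrow> real \<times> complex" where
  "tangent_coord X = (Im (X $ 1 $ 1 - X $ 2 $ 2), - (X $ 1 $ 2))"

lemma su_components:
  "su_re X + mat_scale \<i> (su_im X) = X" "su_conj (su_re X) = su_re X" "su_conj (su_im X) = su_im X"
  by (simp_all add: su_re_def su_im_def su_conj_def mat_scale_def vec_eq_iff forall_2 vector_2 field_simps)

lemma su_tangent:
  fixes X :: mat22 and z :: complex
  assumes "su_conj X = X" "X $ 1 $ 1 + X $ 2 $ 2 = 0" "z \<in> disc"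
  shows "((\<lambda>\<epsilon>::real. mob_of (\<epsilon> *\<^sub>R tangent_coord X) z) has_vector_derivative
           X $ 1 $ 2 + (X $ 1 $ 1 - X $ 2 $ 2) * z - X $ 2 $ 1 * z\<^sup>2) (at 0)"
proof -
  have c: "- cnj (X $ 1 $ 1) = X $ 1 $ 1" "cnj (X $ 1 $ 2) = X $ 2 $ 1"
    using assms(1) unfolding su_conj_def
    by (metis vector_2(1) , metis vector_2(1) vector_2(2))
  define p where "p = Im (X $ 1 $ 1 - X $ 2 $ 2)"
  define a where "a = - X $ 1 $ 2"
  have "X $ 2 $ 2 = - X $ 1 $ 1" using assms(2) by (simp add: eq_neg_iff_add_eq_0 add.commute)
  moreover have "Re (X $ 1 $ 1) = 0" using arg_cong[OF c(1), of Re] by simp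
  ultimately have p: "X $ 1 $ 1 - X $ 2 $ 2 = \<i> * of_real p" by (simp add: p_def complex_eq_iff)
  have "((\<lambda>\<epsilon>. exp (\<i> * (\<epsilon> * of_real p)) * (z - \<epsilon> * a) / (1 - cnj a * \<epsilon> * z))
      has_field_derivative \<i> * of_real p * z - a + cnj a * z\<^sup>2) (at (of_real 0))"
    by (auto intro!: derivative_eq_intros simp: algebra_simps power2_eq_square)
  then have "((\<lambda>\<epsilon>::real. exp (\<i> * of_real (\<epsilon> * p)) * (z - of_real \<epsilon> * a) / (1 - cnj a * of_real \<epsilon> * z))
      has_vector_derivative \<i> * of_real p * z - a + cnj a * z\<^sup>2) (at 0)"
    by (drule_tac has_vector_derivative_real_field) simp
  moreover have "(\<lambda>\<epsilon>::real. mob_of (\<epsilon> *\<^sub>R tangent_coord X) z)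
      = (\<lambda>\<epsilon>. exp (\<i> * of_real (\<epsilon> * p)) * (z - of_real \<epsilon> * a) / (1 - cnj a * of_real \<epsilon> * z))"
    by (simp add: fun_eq_iff mob_of_def Moebius_function_def tangent_coord_def p_def a_def
        scaleR_conv_of_real mult.commute)
  ultimately show ?thesis using c by (simp add: p a_def algebra_simps)
qed

text \<open>
  \<open>F\<close> is differentiable at \<open>x\<close>, and the left invariant complex vector field defined by \<open>X\<close>
  in \<open>sl(2) \<oplus> sl(2)\<close> has the value \<open>w\<close> on \<open>F\<close> at \<open>x\<close>.\<close>

definition has_left_inv_derivative :: "(mob2 \<Rightarrow> complex ^ 'n) \<Rightarrow> mat22 \<times> mat22 \<Rightarrow> mob2 \<Rightarrow> complex ^ 'n \<Rightarrow> bool" where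
  "has_left_inv_derivative F X x w \<longleftrightarrow>
     (\<exists>D. ((\<lambda>y. F (x \<otimes>\<^bsub>mob2_cover\<^esub> y)) has_derivative D) (at \<one>\<^bsub>mob2_cover\<^esub>) \<and>
        w = D (tangent_coord (su_re (fst X)), tangent_coord (su_re (snd X)))
          + \<i> *s D (tangent_coord (su_im (fst X)), tangent_coord (su_im (snd X))))"

text \<open>
  The function on the covering group corresponding to a section, where the fibre over \<open>(0, 0)\<close>
  is identified with \<open>complex ^ 'n\<close> by the trivialization \<open>\<phi>\<close>.\<close>

definition section_lift :: "('e, 'n::finite) hbundle \<Rightarrow> (mob2 \<Rightarrow> 'e \<Rightarrow> 'e) \<Rightarrow> ('e \<Rightarrow> complex ^ 'n)
    \<Rightarrow> (complex \<times> complex \<Rightarrow> 'e) \<Rightarrow> mob2 \<Rightarrow> complex ^ 'n" where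
  "section_lift E act \<phi> \<sigma> x = \<phi> (act (inv\<^bsub>mob2_cover\<^esub> x) (\<sigma> (mob2_of x (0, 0))))"

text \<open>
  The stabilizer of \<open>(0, 0)\<close> consists of the elements \<open>((t1, 0), (t2, 0))\<close>, and \<open>(t, 0)\<close> is the
  lift of \<open>exp (t \<i> h)\<close>, which acts on the disc as multiplication by \<open>cis t\<close>. So its action on the
  fibre has the derivatives \<open>\<i> \<rho> h1\<close> and \<open>\<i> \<rho> h2\<close> at the identity.\<close>

definition associated_representation :: "('e, 'n::finite) hbundle \<Rightarrow> (mob2 \<Rightarrow> 'e \<Rightarrow> 'e) \<Rightarrow> ('e \<Rightarrow> complex ^ 'n)
    \<Rightarrow> (mat22 \<times> mat22 \<Rightarrow> complex ^ 'n ^ 'n) \<Rightarrow> bool" where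
  "associated_representation E act \<phi> \<rho> \<longleftrightarrow> bb_representation \<rho> \<and>
     (\<forall>v. ((\<lambda>t. \<phi> (act ((t, 0), (0, 0)) (from_triv E \<phi> (0, 0) v)))
             has_vector_derivative \<i> *s (\<rho> h1 *v v)) (at 0)) \<and>
     (\<forall>v. ((\<lambda>t. \<phi> (act ((0, 0), (t, 0)) (from_triv E \<phi> (0, 0) v)))
             has_vector_derivative \<i> *s (\<rho> h2 *v v)) (at 0)) \<and>
     (\<forall>\<sigma>. bundle_section E \<sigma> \<longrightarrow>
        (holomorphic_section E \<sigma> \<longleftrightarrow>
           (\<forall>X\<in>bb. \<forall>x\<in>carrier mob2_cover.
              has_left_inv_derivative (section_lift E act \<phi> \<sigma>) X x
                (- (\<rho> X *v section_lift E act \<phi> \<sigma> x)))))"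


section \<open>The staircase of joint eigenvalues\<close>

definition staircase :: "nat \<Rightarrow> (nat \<Rightarrow> nat) \<Rightarrow> (nat \<Rightarrow> nat) \<Rightarrow> (nat \<times> nat) set" where
  "staircase s m j = {(i, j i + k) | i k. i \<le> s \<and> k \<le> m i}"

text \<open>The spaces \<open>V\<^sub>\<theta>\<close>, with the convention that they vanish outside the index set \<open>S\<close>.\<close>

definition weight_space :: "(mat22 \<times> mat22 \<Rightarrow> complex ^ 'n ^ 'n) \<Rightarrow> real \<Rightarrow> real \<Rightarrow> (nat \<times> nat) set
    \<Rightarrow> nat \<times> nat \<Rightarrow> (complex ^ 'n) set" where
  "weight_space \<rho> l1 l2 S \<theta> =
     (if \<theta> \<in> S then joint_eigenspace \<rho> (of_real l1 - of_nat (fst \<theta>)) (of_real l2 - of_nat (snd \<theta>))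
      else {0})"

end

theory Submission
  imports Defs
begin

text \<open>
  Write \<open>J\<^sub>\<rho> (g, z)\<close> for the right hand side of the formula. Two arguments prove the
  theorem.

  The formula. The relations of \<open>\<bb> \<oplus> \<bb>\<close> and the chain rule give
  \<open>J\<^sub>\<rho> (g h, z) = J\<^sub>\<rho> (h, z) J\<^sub>\<rho> (g, h z)\<close> for every representation \<open>\<rho>\<close> (\<open>formula_cocycle_mult\<close>). Let
  \<open>\<rho>\<close> be the representation associated with the bundle. The function \<open>g \<mapsto> J\<^sub>\<rho> (g, 0) v\<close> then
  transforms under the stabilizer of \<open>0\<close> in the same way as the lift of a section
  (\<open>torus_formula_cocycle\<close>), so it is the lift of a section of \<open>E\<close>, and it satisfies
  \<open>X F = - \<rho> (X) F\<close> because \<open>J\<^sub>\<rho>\<close> depends holomorphically on \<open>z\<close> and has the right derivative at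
  the identity (\<open>has_left_inv_derivative_formula_cocycle\<close>). So the section is holomorphic, and
  these sections, for \<open>v\<close> in a basis, form a global holomorphic frame. In the trivialization \<open>\<psi>\<close>
  defined by this frame the cocycle of \<open>E\<close> is \<open>J\<^sub>\<rho>\<close> (\<open>cocycle_\<psi>\<close>).

  The shape of \<open>\<rho>\<close>. A basis change makes \<open>\<rho> (h\<^sub>1)\<close> and \<open>\<rho> (h\<^sub>2)\<close> diagonal. The stabilizer of \<open>0\<close>
  acts on the fibre by unitary maps, so the weights are real and, being distinct, have orthogonal
  weight vectors. A set of weights closed under all arrows of \<open>\<rho> (y\<^sub>1)\<close> and \<open>\<rho> (y\<^sub>2)\<close> in both
  directions therefore gives an orthogonal decomposition of \<open>E\<close>, and irreducibility makes the graph
  of these arrows connected (\<open>no_splitting\<close>). What remains is a combinatorial statement about two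
  commuting partial injections that move the points of a plane lattice by unit steps. Since
  \<open>\<rho> (y\<^sub>1) \<rho> (y\<^sub>2) = \<rho> (y\<^sub>2) \<rho> (y\<^sub>1)\<close>, a detour in a path can be pushed across and cancelled, so that two
  points of a connected graph are joined by a path that never turns back in either direction
  (\<open>connected_imp_monotone_path\<close>). Hence comparable weights are joined by a path of forward arrows.
  This makes the set of weights convex, which is the staircase condition, and makes every arrow
  between neighbouring weights nonzero.\<close>

section \<open>The matrix exponential\<close>

text \<open>A copy of the type of square matrices that carries the operator norm. The Euclidean norm of the
  original type does not give the unit matrix the norm \<open>1\<close>; the operator norm makes the matrices
  a Banach algebra, on which the general exponential function and its laws are available.\<close>

typedef ('n::finite) cmat = "UNIV :: (complex ^ 'n ^ 'n) set" morphisms to_mat of_mat ..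

setup_lifting type_definition_cmat

instantiation cmat :: (finite) real_algebra_1
begin
lift_definition zero_cmat :: "'a cmat" is "0" .
lift_definition one_cmat :: "'a cmat" is "mat 1" .
lift_definition plus_cmat :: "'a cmat \<Rightarrow> 'a cmat \<Rightarrow> 'a cmat" is "(+)" .
lift_definition minus_cmat :: "'a cmat \<Rightarrow> 'a cmat \<Rightarrow> 'a cmat" is "(-)" .
lift_definition uminus_cmat :: "'a cmat \<Rightarrow> 'a cmat" is "uminus" .
lift_definition times_cmat :: "'a cmat \<Rightarrow> 'a cmat \<Rightarrow> 'a cmat" is "(**)" .
lift_definition scaleR_cmat :: "real \<Rightarrow> 'a cmat \<Rightarrow> 'a cmat" is "scaleR" .
instance
proof
  fix x y :: "'a cmat" and a :: real
  show "a *\<^sub>R x * y = a *\<^sub>R (x * y)"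
    by transfer (simp add: matrix_matrix_mult_def vec_eq_iff scaleR_sum_right)
  show "x * a *\<^sub>R y = a *\<^sub>R (x * y)"
    by transfer (simp add: matrix_matrix_mult_def vec_eq_iff scaleR_sum_right)
  show "(x + y) * z = x * z + y * z" for z
    by transfer (simp add: matrix_matrix_mult_def vec_eq_iff sum.distrib distrib_right)
  show "(0::'a cmat) \<noteq> 1"
    by transfer (simp add: vec_eq_iff mat_def)
qed (transfer; simp add: matrix_mul_assoc matrix_add_ldistrib algebra_simps)+
end

lemma norm_entry_le_onorm:
  fixes M :: "complex ^ 'n ^ 'm"
  shows "cmod (M $ i $ j) \<le> onorm ((*v) M)"
proof -
  have "cmod (M $ i $ j) = cmod ((M *v axis j 1) $ i)"
    by (simp add: matrix_vector_mult_def axis_def if_distrib cong: if_cong)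
  also have "\<dots> \<le> norm (M *v axis j 1)" by (rule Finite_Cartesian_Product.norm_nth_le)
  also have "\<dots> \<le> onorm ((*v) M) * norm (axis j (1::complex))"
    by (rule onorm) simp
  finally show ?thesis by simp
qed

lemma onorm_le_sum_entries:
  fixes M :: "complex ^ 'n ^ 'm"
  shows "onorm ((*v) M) \<le> (\<Sum>i\<in>UNIV. \<Sum>j\<in>UNIV. cmod (M $ i $ j))"
proof (rule onorm_le)
  fix x :: "complex ^ 'n"
  have "norm (M *v x) \<le> (\<Sum>i\<in>UNIV. cmod ((M *v x) $ i))"
    unfolding norm_vec_def by (rule L2_set_le_sum) simp
  also have "\<dots> \<le> (\<Sum>i\<in>UNIV. \<Sum>j\<in>UNIV. cmod (M $ i $ j) * norm x)"
  proof (rule sum_mono)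
    fix i
    have "cmod ((M *v x) $ i) \<le> (\<Sum>j\<in>UNIV. cmod (M $ i $ j * x $ j))"
      unfolding matrix_vector_mult_def by (simp add: norm_sum)
    also have "\<dots> \<le> (\<Sum>j\<in>UNIV. cmod (M $ i $ j) * norm x)"
      by (intro sum_mono) (simp add: norm_mult mult_left_mono Finite_Cartesian_Product.norm_nth_le[of x])
    finally show "cmod ((M *v x) $ i) \<le> (\<Sum>j\<in>UNIV. cmod (M $ i $ j) * norm x)" .
  qed
  finally show "norm (M *v x) \<le> (\<Sum>i\<in>UNIV. \<Sum>j\<in>UNIV. cmod (M $ i $ j)) * norm x"
    by (simp add: sum_distrib_right)
qed

instantiation cmat :: (finite) real_normed_algebra_1
begin
lift_definition norm_cmat :: "'a cmat \<Rightarrow> real" is "\<lambda>M. onorm ((*v) M)" .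
definition dist_cmat :: "'a cmat \<Rightarrow> 'a cmat \<Rightarrow> real" where "dist_cmat x y = norm (x - y)"
definition sgn_cmat :: "'a cmat \<Rightarrow> 'a cmat" where "sgn_cmat x = inverse (norm x) *\<^sub>R x"
definition uniformity_cmat :: "('a cmat \<times> 'a cmat) filter"
  where "uniformity_cmat = (INF e\<in>{0<..}. principal {(x, y). dist x y < e})"
definition open_cmat :: "'a cmat set \<Rightarrow> bool"
  where "open_cmat U \<longleftrightarrow> (\<forall>x\<in>U. eventually (\<lambda>(x', y). x' = x \<longrightarrow> y \<in> U) uniformity)"
instance
proof
  fix x y :: "'a cmat" and a :: real
  show "norm x = 0 \<longleftrightarrow> x = 0"
  proof
    assume "norm x = 0"
    then show "x = 0"
    proof transfer
      fix x :: "complex ^ 'a ^ 'a"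
      assume "onorm ((*v) x) = 0"
      then have "cmod (x $ i $ j) \<le> 0" for i j using norm_entry_le_onorm[of x i j] by simp
      then show "x = 0" by (simp add: vec_eq_iff)
    qed
  next
    assume "x = 0"
    then show "norm x = 0"
    proof (simp, transfer)
      have "(*v) (0 :: complex ^ 'a ^ 'a) = (\<lambda>v. 0)" by auto
      then show "onorm ((*v) (0 :: complex ^ 'a ^ 'a)) = 0" by (simp add: onorm_zero)
    qed
  qed
  show "norm (x + y) \<le> norm x + norm y"
  proof transfer
    fix x y :: "complex ^ 'a ^ 'a"
    have "(*v) (x + y) = (\<lambda>v. x *v v + y *v v)" by (auto simp: matrix_vector_mult_add_rdistrib)
    then show "onorm ((*v) (x + y)) \<le> onorm ((*v) x) + onorm ((*v) y)"
      by (simp add: onorm_triangle)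
  qed
  show "norm (a *\<^sub>R x) = \<bar>a\<bar> * norm x"
  proof transfer
    fix a :: real and x :: "complex ^ 'a ^ 'a"
    have "(*v) (a *\<^sub>R x) = (\<lambda>v. a *\<^sub>R (x *v v))"
      by (auto simp: matrix_vector_mult_def vec_eq_iff scaleR_sum_right)
    then show "onorm ((*v) (a *\<^sub>R x)) = \<bar>a\<bar> * onorm ((*v) x)"
      by (simp add: onorm_scaleR)
  qed
  show "norm (x * y) \<le> norm x * norm y"
  proof transfer
    fix x y :: "complex ^ 'a ^ 'a"
    have "(*v) (x ** y) = (*v) x \<circ> (*v) y" by (auto simp: matrix_vector_mul_assoc)
    then show "onorm ((*v) (x ** y)) \<le> onorm ((*v) x) * onorm ((*v) y)"
      by (simp add: onorm_compose)
  qed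
  show "norm (1 :: 'a cmat) = 1"
  proof transfer
    have "(*v) (mat 1) = (\<lambda>v :: complex ^ 'a. v)" by auto
    then show "onorm ((*v) (mat 1 :: complex ^ 'a ^ 'a)) = 1" by (simp add: onorm_id)
  qed
qed (simp_all add: dist_cmat_def sgn_cmat_def uniformity_cmat_def open_cmat_def)
end

lemma to_mat_simps [simp]:
  "to_mat 0 = 0" "to_mat 1 = mat 1" "to_mat (x + y) = to_mat x + to_mat y"
  "to_mat (x - y) = to_mat x - to_mat y" "to_mat (- x) = - to_mat x"
  "to_mat (x * y) = to_mat x ** to_mat y" "to_mat (r *\<^sub>R x) = r *\<^sub>R to_mat x"
  by (transfer; simp)+

lemma to_mat_of_mat [simp]: "to_mat (of_mat M) = M"
  by (simp add: of_mat_inverse)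

lemma norm_le_sum_entries: "norm x \<le> (\<Sum>i\<in>UNIV. \<Sum>j\<in>UNIV. cmod (to_mat x $ i $ j))"
  by transfer (rule onorm_le_sum_entries)

lemma norm_to_mat_entry_le: "cmod (to_mat x $ i $ j) \<le> norm x"
  by transfer (rule norm_entry_le_onorm)

lemma bounded_linear_entry: "bounded_linear (\<lambda>x. to_mat x $ i $ j)"
  by (rule bounded_linear_intro[where K = 1]) (auto simp: norm_to_mat_entry_le)

lemma bounded_linear_to_mat: "bounded_linear to_mat"
proof (rule bounded_linear_intro[where K = "\<Sum>i\<in>(UNIV::'a set). \<Sum>j\<in>(UNIV::'a set). 1"])
  fix x :: "'a cmat"
  have "norm (to_mat x) \<le> (\<Sum>i\<in>UNIV. norm (to_mat x $ i))"
    unfolding norm_vec_def by (rule L2_set_le_sum) simp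
  also have "\<dots> \<le> (\<Sum>i\<in>UNIV. \<Sum>j\<in>UNIV. cmod (to_mat x $ i $ j))"
    unfolding norm_vec_def by (intro sum_mono L2_set_le_sum) simp
  also have "\<dots> \<le> (\<Sum>i\<in>(UNIV::'a set). \<Sum>j\<in>(UNIV::'a set). norm x)"
    by (intro sum_mono norm_to_mat_entry_le)
  finally show "norm (to_mat x) \<le> norm x * (\<Sum>i\<in>(UNIV::'a set). \<Sum>j\<in>(UNIV::'a set). 1)"
    by (simp add: algebra_simps)
qed simp_all

lemma bounded_linear_of_mat: "bounded_linear of_mat"
proof (rule bounded_linear_intro[where K = "\<Sum>i\<in>(UNIV::'a set). \<Sum>j\<in>(UNIV::'a set). 1"])
  fix M :: "complex ^ 'a ^ 'a"
  have "norm (of_mat M) \<le> (\<Sum>i\<in>UNIV. \<Sum>j\<in>UNIV. cmod (M $ i $ j))"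
    using norm_le_sum_entries[of "of_mat M"] by simp
  also have "\<dots> \<le> (\<Sum>i\<in>(UNIV::'a set). \<Sum>j\<in>(UNIV::'a set). norm M)"
    by (intro sum_mono order_trans[OF Finite_Cartesian_Product.norm_nth_le Finite_Cartesian_Product.norm_nth_le])
  finally show "norm (of_mat M) \<le> norm M * (\<Sum>i\<in>(UNIV::'a set). \<Sum>j\<in>(UNIV::'a set). 1)"
    by (simp add: algebra_simps)
qed (simp_all add: to_mat_inject[symmetric])

instance cmat :: (finite) banach
proof
  fix X :: "nat \<Rightarrow> 'a cmat"
  assume "Cauchy X"
  then have "Cauchy (\<lambda>n. to_mat (X n))"
    by (rule bounded_linear.Cauchy[OF bounded_linear_to_mat])
  then obtain L where "(\<lambda>n. to_mat (X n)) \<longlonglongrightarrow> L"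
    using Cauchy_convergent_iff convergent_def by blast
  then have "(\<lambda>n. of_mat (to_mat (X n))) \<longlonglongrightarrow> of_mat L"
    by (rule bounded_linear.tendsto[OF bounded_linear_of_mat])
  then show "convergent X"
    by (auto simp: convergent_def to_mat_inverse)
qed

lemma to_mat_power: "to_mat (x ^ k) = mat_pow (to_mat x) k"
  by (induction k) simp_all

lemma mat_exp_eq_to_mat_exp: "mat_exp M = to_mat (exp (of_mat M))"
proof -
  have "to_mat (exp (of_mat M)) = (\<Sum>k. to_mat (of_mat M ^ k /\<^sub>R fact k))"
    unfolding exp_def
    by (rule bounded_linear.suminf[OF bounded_linear_to_mat]) (rule summable_exp_generic)
  then show ?thesis
    by (simp add: mat_exp_def to_mat_power inverse_eq_divide)
qed

lemma mat_exp_add_commuting: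
  assumes "A ** B = B ** A"
  shows "mat_exp (A + B) = mat_exp A ** mat_exp B"
proof -
  have "of_mat A * of_mat B = of_mat B * of_mat A"
    using assms by (simp add: to_mat_inject[symmetric])
  moreover have "of_mat (A + B) = of_mat A + of_mat B" by (simp add: to_mat_inject[symmetric])
  ultimately show ?thesis
    by (simp add: mat_exp_eq_to_mat_exp exp_add_commuting)
qed

lemma mat_exp_zero: "mat_exp 0 = mat 1"
  using mat_exp_eq_to_mat_exp[of 0] by (simp add: zero_cmat_def[symmetric])

lemma exp_entry_sums: "(\<lambda>k. (1 / fact k) *\<^sub>R (mat_pow M k $ i $ j)) sums (mat_exp M $ i $ j)"
proof -
  have "(\<lambda>k. of_mat M ^ k /\<^sub>R fact k) sums exp (of_mat M)"
    unfolding exp_def by (intro summable_sums summable_exp_generic)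
  from bounded_linear.sums[OF bounded_linear_entry this, of i j]
  show ?thesis by (simp add: to_mat_power mat_exp_eq_to_mat_exp inverse_eq_divide)
qed

text \<open>The hypothesis passes to all powers, \<open>D A\<^sup>k = B\<^sup>k D\<close>, and so to the two series.\<close>

lemma mat_exp_intertwine:
  fixes A B D :: "complex ^ 'n ^ 'n"
  assumes "D ** A = B ** D"
  shows "D ** mat_exp A = mat_exp B ** D"
proof -
  define d where "d = of_mat D"
  define a where "a = of_mat A"
  define b where "b = of_mat B"
  have da: "d * a = b * d"
    using assms by (simp add: d_def a_def b_def to_mat_inject[symmetric])
  have p: "d * a ^ k = b ^ k * d" for k
  proof (induction k)
    case (Suc k)
    have "d * a ^ Suc k = (d * a) * a ^ k" by (simp add: mult.assoc)
    also have "\<dots> = b * (d * a ^ k)" by (simp add: da mult.assoc)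
    finally show ?case by (simp add: Suc mult.assoc)
  qed simp
  have "(\<lambda>k. d * (a ^ k /\<^sub>R fact k)) sums (d * exp a)"
    unfolding exp_def by (intro sums_mult summable_sums summable_exp_generic)
  moreover have "(\<lambda>k. (b ^ k /\<^sub>R fact k) * d) sums (exp b * d)"
    unfolding exp_def by (intro sums_mult2 summable_sums summable_exp_generic)
  ultimately have "d * exp a = exp b * d"
    by (simp add: p sums_unique2)
  then have "to_mat (d * exp a) = to_mat (exp b * d)" by simp
  then show ?thesis by (simp add: d_def a_def b_def mat_exp_eq_to_mat_exp)
qed

text \<open>The terms of order at least two are dominated by those of the real exponential series in
  \<open>norm h\<close>, whose sum is \<open>o (norm h)\<close>.\<close>

lemma exp_has_derivative_at_zero:
  "((exp :: 'a::{real_normed_algebra_1,banach} \<Rightarrow> 'a) has_derivative (\<lambda>h. h)) (at 0)"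
proof -
  have bound: "norm (exp h - 1 - h) \<le> exp (norm h) - 1 - norm h" for h :: 'a
  proof -
    have s: "summable (\<lambda>n. norm (inverse (fact (n + 2)) *\<^sub>R h ^ (n + 2)))"
      using summable_norm_exp[of h] by (rule summable_ignore_initial_segment)
    have t: "summable (\<lambda>n. inverse (fact (n + 2)) *\<^sub>R norm h ^ (n + 2))"
      using summable_exp_generic[of "norm h"] by (rule summable_ignore_initial_segment)
    have "norm (exp h - 1 - h) = norm (\<Sum>n. inverse (fact (n + 2)) *\<^sub>R h ^ (n + 2))"
      unfolding exp_first_two_terms[of h] by simp
    also have "\<dots> \<le> (\<Sum>n. norm (inverse (fact (n + 2)) *\<^sub>R h ^ (n + 2)))"
      by (rule summable_norm[OF s])
    also have "\<dots> \<le> (\<Sum>n. inverse (fact (n + 2)) *\<^sub>R norm h ^ (n + 2))"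
    proof (rule suminf_le[OF _ s t])
      fix n
      show "norm (inverse (fact (n + 2)) *\<^sub>R h ^ (n + 2)) \<le> inverse (fact (n + 2)) *\<^sub>R norm h ^ (n + 2)"
        unfolding norm_scaleR by (simp add: norm_power_ineq mult_left_mono del: power_Suc)
    qed
    also have "\<dots> = exp (norm h) - 1 - norm h"
      unfolding exp_first_two_terms[of "norm h"] by simp
    finally show ?thesis .
  qed
  have real_lim: "((\<lambda>r::real. norm (exp r - exp 0 - r) / norm r) \<longlongrightarrow> 0) (at 0)"
    using DERIV_exp[of "0::real"] unfolding has_field_derivative_def has_derivative_at by simp
  have "filterlim norm (at (0::real)) (at (0::'a))"
    unfolding filterlim_at by (auto simp: eventually_at_filter intro: tendsto_eq_intros)
  from filterlim_compose[OF real_lim this]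
  have lim: "((\<lambda>h::'a. norm (exp (norm h) - 1 - norm h) / norm h) \<longlongrightarrow> 0) (at 0)" by simp
  have "((\<lambda>h::'a. norm (exp (0 + h) - exp 0 - h) / norm h) \<longlongrightarrow> 0) (at 0)"
    by (rule Lim_null_comparison[OF _ lim])
       (auto intro!: always_eventually divide_right_mono order_trans[OF bound[unfolded diff_diff_eq]] simp: diff_diff_eq)
  then show ?thesis
    unfolding has_derivative_at by (simp add: bounded_linear_ident)
qed

section \<open>Matrix identities\<close>

lemma matrix_add_rdistrib:
  fixes A B :: "complex ^ 'n ^ 'm" and C :: "complex ^ 'k ^ 'n"
  shows "(A + B) ** C = A ** C + B ** C"
  by (simp add: matrix_matrix_mult_def vec_eq_iff sum.distrib distrib_right)

lemma mat_scale_mult: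
  "mat_scale c A ** B = mat_scale c (A ** B)" "A ** mat_scale c B = mat_scale c (A ** B)"
  "mat_scale c A *v v = c *s (A *v v)" "mat_scale c (mat_scale d A) = mat_scale (c * d) A"
  "mat_scale 1 A = A" "mat_scale 0 A = 0" "mat_scale (c + d) A = mat_scale c A + mat_scale d A"
  "mat_scale c (A + B) = mat_scale c A + mat_scale c B" "mat_scale (- c) A = - mat_scale c A"
  by (simp_all add: mat_scale_def matrix_matrix_mult_def matrix_vector_mult_def vec_eq_iff
      sum_distrib_left algebra_simps)

lemma mat_scale_combinations_commute:
  fixes A B :: "complex ^ 'n ^ 'n"
  assumes "A ** B = B ** A"
  shows "(mat_scale a A + mat_scale b B) ** (mat_scale c A + mat_scale d B)
    = (mat_scale c A + mat_scale d B) ** (mat_scale a A + mat_scale b B)"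
  using assms by (simp add: matrix_add_rdistrib matrix_add_ldistrib mat_scale_mult(1,2,4,8) mult.commute add_ac)

definition diag_mat :: "('n \<Rightarrow> complex) \<Rightarrow> complex ^ 'n ^ 'n" where
  "diag_mat d = (\<chi> i j. if i = j then d i else 0)"

lemma diag_mat_mult:
  "diag_mat d ** M = (\<chi> i j. d i * M $ i $ j)" "M' ** diag_mat d = (\<chi> i j. M' $ i $ j * d j)"
  "diag_mat d *v v = (\<chi> i. d i * v $ i)"
  by (simp_all add: diag_mat_def matrix_matrix_mult_def matrix_vector_mult_def vec_eq_iff
      if_distrib if_distribR sum.delta sum.delta' cong: if_cong)

lemma diag_mat_axis: "diag_mat d *v axis i 1 = d i *s axis i 1"
  by (simp add: diag_mat_mult vec_eq_iff axis_def)

lemma mat_exp_diag_mat: "mat_exp (diag_mat d) = diag_mat (\<lambda>i. exp (d i))"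
proof -
  have "mat_pow (diag_mat d) k = diag_mat (\<lambda>i. d i ^ k)" for k
  proof (induction k)
    case 0
    show ?case by (simp add: diag_mat_def mat_def vec_eq_iff)
  next
    case (Suc k)
    then show ?case by (simp add: diag_mat_mult) (simp add: diag_mat_def vec_eq_iff)
  qed
  then have "(\<lambda>k. (1 / fact k) *\<^sub>R (diag_mat (\<lambda>i. d i ^ k) $ i $ j)) sums (mat_exp (diag_mat d) $ i $ j)" for i j
    using exp_entry_sums[of "diag_mat d" i j] by simp
  moreover have "(\<lambda>k. (1 / fact k) *\<^sub>R (diag_mat (\<lambda>i. d i ^ k) $ i $ j)) sums (diag_mat (\<lambda>i. exp (d i)) $ i $ j)" for i j
    using exp_converges[of "d i"] by (auto simp: diag_mat_def inverse_eq_divide)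
  ultimately show ?thesis unfolding vec_eq_iff by (intro allI) (rule sums_unique2)
qed

lemma mat_exp_mat: "mat_exp (mat c :: complex ^ 'n ^ 'n) = mat (exp c)"
proof -
  have "(mat c :: complex ^ 'n ^ 'n) = diag_mat (\<lambda>_. c)" for c :: complex by (simp add: mat_def diag_mat_def)
  then show ?thesis by (simp add: mat_exp_diag_mat)
qed

lemma bounded_linear_mat_scale: "bounded_linear (\<lambda>c. of_mat (mat_scale c M))"
proof -
  have "linear (\<lambda>c. mat_scale c M)"
    by (rule linearI) (simp_all add: mat_scale_def vec_eq_iff algebra_simps)
  then have "bounded_linear (\<lambda>c. mat_scale c M)" by (simp add: linear_conv_bounded_linear)
  then show ?thesis by (rule bounded_linear_compose[OF bounded_linear_of_mat])
qed

lemma bounded_bilinear_matrix_vector: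
  "bounded_bilinear (\<lambda>(M :: 'n::finite cmat) v. to_mat M *v v)"
proof
  show "\<exists>K. \<forall>(a :: 'n cmat) b. norm (to_mat a *v b) \<le> norm a * norm b * K"
  proof (intro exI[of _ 1] allI)
    fix a :: "'n cmat" and b :: "complex ^ 'n"
    have "norm (to_mat a *v b) \<le> norm a * norm b"
      unfolding norm_cmat.rep_eq by (rule onorm) simp
    then show "norm (to_mat a *v b) \<le> norm a * norm b * 1" by simp
  qed
qed (simp_all add: matrix_vector_mult_def vec_eq_iff scaleR_sum_right sum.distrib distrib_left distrib_right)

text \<open>Since \<open>exp (L x) = exp (L y) exp (L x - L y)\<close>, the derivative at zero determines this one.\<close>

lemma exp_has_derivative_commuting:
  fixes L :: "'b::real_normed_vector \<Rightarrow> 'a::{real_normed_algebra_1,banach}"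
  assumes L: "(L has_derivative L') (at y)" and comm: "\<And>x. L x * L y = L y * L x"
  shows "((\<lambda>x. exp (L x)) has_derivative (\<lambda>h. exp (L y) * L' h)) (at y)"
proof -
  have eq: "exp (L x) = exp (L y) * exp (L x - L y)" for x
    using exp_add_commuting[of "L y" "L x - L y"] comm[of x] by (simp add: algebra_simps)
  have "((\<lambda>x. L x - L y) has_derivative L') (at y)"
    using L by (auto intro!: derivative_eq_intros)
  moreover have "((exp :: 'a \<Rightarrow> 'a) has_derivative (\<lambda>h. h)) (at (L y - L y))"
    using exp_has_derivative_at_zero by simp
  ultimately have "((\<lambda>x. exp (L x - L y)) has_derivative L') (at y)"
    using has_derivative_compose by blast
  then have "((\<lambda>x. exp (L y) * exp (L x - L y)) has_derivative (\<lambda>h. exp (L y) * L' h)) (at y)"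
    by (rule has_derivative_mult_right)
  then show ?thesis unfolding eq[symmetric] .
qed

section \<open>The cocycle defined by a representation\<close>

text \<open>The relations between the images of the basis \<open>h\<^sub>1, h\<^sub>2, y\<^sub>1, y\<^sub>2\<close> of \<open>\<bb> \<oplus> \<bb>\<close> under a representation.\<close>

locale lowering_operators =
  fixes H1 H2 Y1 Y2 :: "complex ^ 'n::finite ^ 'n"
  assumes HH: "H1 ** H2 = H2 ** H1" and YY: "Y1 ** Y2 = Y2 ** Y1"
    and HY11: "H1 ** Y1 = Y1 ** H1 - Y1" and HY12: "H1 ** Y2 = Y2 ** H1"
    and HY21: "H2 ** Y1 = Y1 ** H2" and HY22: "H2 ** Y2 = Y2 ** H2 - Y2"
begin

definition y_exp :: "complex \<Rightarrow> complex \<Rightarrow> complex ^ 'n ^ 'n" where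
  "y_exp c1 c2 = mat_exp (mat_scale c1 Y1 + mat_scale c2 Y2)"

definition h_exp :: "complex \<Rightarrow> complex \<Rightarrow> complex ^ 'n ^ 'n" where
  "h_exp l1 l2 = mat_exp (mat_scale (- l1) H1 + mat_scale (- l2) H2)"

lemmas mat_simps = matrix_add_rdistrib matrix_add_ldistrib mat_scale_mult

lemma y_exp_add: "y_exp (c1 + d1) (c2 + d2) = y_exp c1 c2 ** y_exp d1 d2"
proof -
  have "mat_scale (c1 + d1) Y1 + mat_scale (c2 + d2) Y2
      = (mat_scale c1 Y1 + mat_scale c2 Y2) + (mat_scale d1 Y1 + mat_scale d2 Y2)"
    by (simp add: mat_simps)
  then show ?thesis
    unfolding y_exp_def by (simp only: mat_exp_add_commuting[OF mat_scale_combinations_commute[OF YY]])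
qed

lemma h_exp_add: "h_exp (c1 + d1) (c2 + d2) = h_exp c1 c2 ** h_exp d1 d2"
proof -
  have "mat_scale (- (c1 + d1)) H1 + mat_scale (- (c2 + d2)) H2
      = (mat_scale (- c1) H1 + mat_scale (- c2) H2) + (mat_scale (- d1) H1 + mat_scale (- d2) H2)"
    by (simp only: minus_add_distrib mat_scale_mult(7) add_ac)
  then show ?thesis
    unfolding h_exp_def by (simp only: mat_exp_add_commuting[OF mat_scale_combinations_commute[OF HH]])
qed

lemma y_exp_zero: "y_exp 0 0 = mat 1"
  by (simp add: y_exp_def mat_simps mat_exp_zero)

lemma h_exp_zero: "h_exp 0 0 = mat 1"
  by (simp add: h_exp_def mat_simps mat_exp_zero)

text \<open>The hypothesis says that \<open>Y\<close> intertwines \<open>B + l\<close> with \<open>B = - l\<^sub>1 H\<^sub>1 - l\<^sub>2 H\<^sub>2\<close>; so it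
  intertwines \<open>exp l \<cdot> exp B\<close> with \<open>exp B\<close>.\<close>

lemma h_exp_Y_aux:
  assumes "(mat_scale (- l1) H1 + mat_scale (- l2) H2) ** Y
    = Y ** (mat_scale (- l1) H1 + mat_scale (- l2) H2) + mat_scale l Y"
  shows "h_exp l1 l2 ** Y = mat_scale (exp l) Y ** h_exp l1 l2"
proof -
  define B where "B = mat_scale (- l1) H1 + mat_scale (- l2) H2"
  have m: "mat_scale c A = A ** mat c" "mat c ** A = A ** mat c" for c and A :: "complex ^ 'n ^ 'n"
    by (auto simp: mat_scale_def mat_def matrix_matrix_mult_def vec_eq_iff if_distrib
        if_distribR sum.delta sum.delta' mult.commute cong: if_cong)
  have "Y ** (B + mat l) = B ** Y"
    using assms unfolding B_def[symmetric] m(1)[of l] by (simp add: matrix_add_ldistrib)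
  then have "Y ** mat_exp (B + mat l) = mat_exp B ** Y" by (rule mat_exp_intertwine)
  moreover have "mat_exp (B + mat l) = mat_exp B ** mat (exp l)"
    by (simp add: mat_exp_add_commuting m(2) mat_exp_mat)
  ultimately have "mat_exp B ** Y = mat_scale (exp l) (Y ** mat_exp B)"
    by (simp add: m(1) matrix_mul_assoc)
  then show ?thesis unfolding h_exp_def B_def[symmetric] mat_scale_mult(1) .
qed

lemma h_exp_Y: "h_exp l1 l2 ** Y1 = mat_scale (exp l1) Y1 ** h_exp l1 l2"
    "h_exp l1 l2 ** Y2 = mat_scale (exp l2) Y2 ** h_exp l1 l2"
  by (rule h_exp_Y_aux,
      simp add: matrix_add_rdistrib matrix_add_ldistrib mat_scale_mult(1,2) HY11 HY12 HY21 HY22,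
      simp add: mat_scale_def vec_eq_iff algebra_simps)+

lemma h_exp_y_exp: "h_exp l1 l2 ** y_exp c1 c2 = y_exp (exp l1 * c1) (exp l2 * c2) ** h_exp l1 l2"
  unfolding y_exp_def
  by (rule mat_exp_intertwine)
     (simp add: mat_simps h_exp_Y mult.commute)

text \<open>This is applied twice: to the dependence of the cocycle on \<open>z\<close>, with constant \<open>u\<close>, and to its
  dependence on the group element, where \<open>u\<close> is the second factor in the cocycle identity.\<close>

lemma y_h_exp_has_derivative:
  fixes u :: "'b::real_normed_vector \<Rightarrow> complex ^ 'n"
  assumes f: "(f1 has_derivative f1') (at y)" "(f2 has_derivative f2') (at y)"
    and g: "(g1 has_derivative g1') (at y)" "(g2 has_derivative g2') (at y)"
    and u: "(u has_derivative u') (at y)"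
  shows "((\<lambda>x. (y_exp (f1 x) (f2 x) ** h_exp (g1 x) (g2 x)) *v u x) has_derivative
    (\<lambda>h. (y_exp (f1 y) (f2 y) ** (mat_scale (f1' h) Y1 + mat_scale (f2' h) Y2) ** h_exp (g1 y) (g2 y)) *v u y
       + (y_exp (f1 y) (f2 y) ** h_exp (g1 y) (g2 y) ** (mat_scale (- g1' h) H1 + mat_scale (- g2' h) H2)) *v u y
       + (y_exp (f1 y) (f2 y) ** h_exp (g1 y) (g2 y)) *v u' h)) (at y)"
proof -
  define P where "P x = of_mat (mat_scale (f1 x) Y1) + of_mat (mat_scale (f2 x) Y2)" for x
  define Q where "Q x = of_mat (mat_scale (- g1 x) H1) + of_mat (mat_scale (- g2 x) H2)" for x
  define P' where "P' h = of_mat (mat_scale (f1' h) Y1) + of_mat (mat_scale (f2' h) Y2)" for h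
  define Q' where "Q' h = of_mat (mat_scale (- g1' h) H1) + of_mat (mat_scale (- g2' h) H2)" for h
  have P: "(P has_derivative P') (at y)"
    unfolding P_def P'_def
    by (intro has_derivative_add bounded_linear.has_derivative[OF bounded_linear_mat_scale] f)
  have Q: "(Q has_derivative Q') (at y)"
    unfolding Q_def Q'_def
    by (intro has_derivative_add bounded_linear.has_derivative[OF bounded_linear_mat_scale]
        has_derivative_minus g)
  have eP: "((\<lambda>x. exp (P x)) has_derivative (\<lambda>h. exp (P y) * P' h)) (at y)"
    by (rule exp_has_derivative_commuting[OF P])
       (simp only: P_def to_mat_inject[symmetric] to_mat_simps to_mat_of_mat mat_scale_combinations_commute[OF YY])
  have eQ: "((\<lambda>x. exp (Q x)) has_derivative (\<lambda>h. exp (Q y) * Q' h)) (at y)"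
    by (rule exp_has_derivative_commuting[OF Q])
       (simp only: Q_def to_mat_inject[symmetric] to_mat_simps to_mat_of_mat mat_scale_combinations_commute[OF HH])
  have y_exp: "y_exp (f1 x) (f2 x) = to_mat (exp (P x))" for x
    by (simp add: y_exp_def mat_exp_eq_to_mat_exp P_def linear_add[OF bounded_linear.linear[OF bounded_linear_of_mat]])
  have h_exp: "h_exp (g1 x) (g2 x) = to_mat (exp (Q x))" for x
    by (simp add: h_exp_def mat_exp_eq_to_mat_exp Q_def linear_add[OF bounded_linear.linear[OF bounded_linear_of_mat]])
  have "((\<lambda>x. exp (P x) * exp (Q x)) has_derivative
      (\<lambda>h. exp (P y) * (exp (Q y) * Q' h) + exp (P y) * P' h * exp (Q y))) (at y)"
    by (rule has_derivative_mult[OF eP eQ])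
  from bounded_bilinear.FDERIV[OF bounded_bilinear_matrix_vector this u]
  have "((\<lambda>x. to_mat (exp (P x) * exp (Q x)) *v u x) has_derivative
     (\<lambda>h. to_mat (exp (P y) * exp (Q y)) *v u' h +
        to_mat (exp (P y) * (exp (Q y) * Q' h) + exp (P y) * P' h * exp (Q y)) *v u y)) (at y)" .
  then show ?thesis
    unfolding y_exp h_exp to_mat_simps(6)
    by (rule has_derivative_eq_rhs)
       (simp add: fun_eq_iff P'_def Q'_def matrix_vector_mult_add_rdistrib matrix_mul_assoc add_ac)
qed

end

lemma matrix_minus_simps:
  fixes A B :: "complex ^ 'n ^ 'n"
  shows "A ** (- B) = - (A ** B)" "(- A) ** B = - (A ** B)" "(- A) *v v = - (A *v v)"
    "A ** (B - C) = A ** B - A ** C" "(A - B) ** C = A ** C - B ** C"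
  by (simp_all add: matrix_matrix_mult_def matrix_vector_mult_def vec_eq_iff sum_negf sum_subtractf algebra_simps)

section \<open>The chain rule for the logarithmic derivative of the derivative\<close>

text \<open>The function \<open>g'' / (2 g')\<close> of a Moebius transformation \<open>g\<close>, see \<open>deriv_deriv_mob_of\<close>.\<close>

definition half_log_deriv2 :: "real \<times> complex \<Rightarrow> complex \<Rightarrow> complex" where
  "half_log_deriv2 x z = cnj (snd x) / (1 - cnj (snd x) * z)"

lemma one_minus_nonzero:
  assumes "cmod a < 1" "cmod z < 1"
  shows "1 - cnj a * z \<noteq> 0" "1 - cnj a * z \<notin> \<real>\<^sub>\<le>\<^sub>0"
  using Re_one_plus_pos(2)[of "cnj a" z] assms
  by (auto simp: complex_nonpos_Reals_iff simp del: minus_complex.sel)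

lemma deriv_deriv_mob_of:
  assumes "cmod (snd x) < 1" "cmod z < 1"
  shows "deriv (deriv (mob_of x)) z / (2 * deriv (mob_of x) z) = half_log_deriv2 x z"
proof -
  define c where "c = cis (fst x) * complex_of_real (1 - (cmod (snd x))\<^sup>2)"
  have "c \<noteq> 0" using assms by (simp add: c_def abs_square_eq_1 del: of_real_diff of_real_power)
  note nz = one_minus_nonzero(1)[OF assms]
  have d: "deriv (mob_of x) w = c / (1 - cnj (snd x) * w)\<^sup>2" if "w \<in> disc" for w
    unfolding c_def using has_field_derivative_mob_of[of x w] assms that by (auto intro: DERIV_imp_deriv)
  have "((\<lambda>w. c / (1 - cnj (snd x) * w)\<^sup>2) has_field_derivative 2 * c * cnj (snd x) / (1 - cnj (snd x) * z) ^ 3) (at z)"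
    using nz by (auto intro!: derivative_eq_intros simp: divide_simps power2_eq_square power3_eq_cube)
  then have "(deriv (mob_of x) has_field_derivative 2 * c * cnj (snd x) / (1 - cnj (snd x) * z) ^ 3) (at z)"
    by (rule has_field_derivative_transform_within_open[of _ _ _ disc]) (use d assms in auto)
  then have "deriv (deriv (mob_of x)) z = 2 * c * cnj (snd x) / (1 - cnj (snd x) * z) ^ 3"
    by (rule DERIV_imp_deriv)
  moreover have "deriv (mob_of x) z = c / (1 - cnj (snd x) * z)\<^sup>2" using d assms by simp
  ultimately have "deriv (deriv (mob_of x)) z / (2 * deriv (mob_of x) z)
      = (2 * c * cnj (snd x) / (1 - cnj (snd x) * z) ^ 3) / (2 * (c / (1 - cnj (snd x) * z)\<^sup>2))"
    by (simp only:)
  also have "\<dots> = half_log_deriv2 x z"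
    using \<open>c \<noteq> 0\<close> nz by (simp add: half_log_deriv2_def divide_simps power2_eq_square power3_eq_cube)
  finally show ?thesis .
qed

lemma log_mob_deriv_has_field_derivative:
  assumes "cmod (snd x) < 1" "cmod z < 1"
  shows "(log_mob_deriv x has_field_derivative 2 * half_log_deriv2 x z) (at z)"
proof -
  have "((\<lambda>z. \<i> * of_real (fst x) + of_real (ln (1 - (cmod (snd x))\<^sup>2)) - 2 * Ln (1 - cnj (snd x) * z))
      has_field_derivative 2 * half_log_deriv2 x z) (at z)"
    using one_minus_nonzero[OF assms]
    by (auto intro!: derivative_eq_intros simp: half_log_deriv2_def divide_simps)
  then show ?thesis unfolding log_mob_deriv_def[abs_def] .
qed

lemma half_log_deriv2_has_field_derivative:
  assumes "cmod (snd x) < 1" "cmod z < 1"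
  shows "(half_log_deriv2 x has_field_derivative (half_log_deriv2 x z)\<^sup>2) (at z)"
proof -
  have "((\<lambda>z. cnj (snd x) / (1 - cnj (snd x) * z)) has_field_derivative (half_log_deriv2 x z)\<^sup>2) (at z)"
    using one_minus_nonzero(1)[OF assms]
    by (auto intro!: derivative_eq_intros simp: half_log_deriv2_def divide_simps power2_eq_square)
  then show ?thesis unfolding half_log_deriv2_def[abs_def] .
qed

text \<open>This is the derivative of the cocycle identity of \<open>log g'\<close>.\<close>

lemma half_log_deriv2_mult:
  assumes "x \<in> carrier mob_cover" "y \<in> carrier mob_cover" "z \<in> disc"
  shows "half_log_deriv2 (x \<otimes>\<^bsub>mob_cover\<^esub> y) z
    = half_log_deriv2 y z + exp (log_mob_deriv y z) * half_log_deriv2 x (mob_of y z)"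
proof -
  have c: "cmod (snd x) < 1" "cmod (snd y) < 1" "cmod z < 1"
      "cmod (snd (x \<otimes>\<^bsub>mob_cover\<^esub> y)) < 1" "cmod (mob_of y z) < 1"
    using assms mult_mob_cover_closed[OF assms(1,2)] mob_of_in_disc[of y z] by auto
  have "(mob_of y has_field_derivative exp (log_mob_deriv y z)) (at z)"
    using has_field_derivative_mob_of[OF c(2,3)] exp_log_mob_deriv[OF assms(2,3)] DERIV_imp_deriv by metis
  from DERIV_chain2[OF log_mob_deriv_has_field_derivative[OF c(1,5)] this]
  have "((\<lambda>z. log_mob_deriv x (mob_of y z) + log_mob_deriv y z) has_field_derivative
      2 * half_log_deriv2 x (mob_of y z) * exp (log_mob_deriv y z) + 2 * half_log_deriv2 y z) (at z)"
    using log_mob_deriv_has_field_derivative[OF c(2,3)] by (rule DERIV_add)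
  moreover have "((\<lambda>z. log_mob_deriv x (mob_of y z) + log_mob_deriv y z) has_field_derivative
      2 * half_log_deriv2 (x \<otimes>\<^bsub>mob_cover\<^esub> y) z) (at z)"
    by (rule has_field_derivative_transform_within_open[OF log_mob_deriv_has_field_derivative[OF c(4,3)], of disc])
       (use assms log_mob_deriv_mult in auto)
  ultimately have "2 * half_log_deriv2 x (mob_of y z) * exp (log_mob_deriv y z) + 2 * half_log_deriv2 y z
      = 2 * half_log_deriv2 (x \<otimes>\<^bsub>mob_cover\<^esub> y) z" by (rule DERIV_unique)
  then have "2 * half_log_deriv2 (x \<otimes>\<^bsub>mob_cover\<^esub> y) z
      = 2 * (half_log_deriv2 y z + exp (log_mob_deriv y z) * half_log_deriv2 x (mob_of y z))"
    by (simp only: distrib_left mult_ac add_ac)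
  then show ?thesis by (simp only: mult_cancel_left) simp
qed

lemma mob2_cover_simps:
  "x \<in> carrier mob2_cover \<longleftrightarrow> fst x \<in> carrier mob_cover \<and> snd x \<in> carrier mob_cover"
  "x \<otimes>\<^bsub>mob2_cover\<^esub> y = (fst x \<otimes>\<^bsub>mob_cover\<^esub> fst y, snd x \<otimes>\<^bsub>mob_cover\<^esub> snd y)"
  "\<one>\<^bsub>mob2_cover\<^esub> = ((0, 0), (0, 0))"
  by (cases x; cases y; simp add: DirProd_def)+

lemma group_mob2_cover: "group mob2_cover"
  by (intro DirProd_group group_mob_cover)

lemma mob2_of_in_bidisc: "x \<in> carrier mob2_cover \<Longrightarrow> z \<in> bidisc \<Longrightarrow> mob2_of x z \<in> bidisc"
  by (cases z) (auto simp: mob2_of_def mob2_cover_simps mob_of_in_disc)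

lemma mob2_of_mult:
  "x \<in> carrier mob2_cover \<Longrightarrow> y \<in> carrier mob2_cover \<Longrightarrow> z \<in> bidisc \<Longrightarrow>
    mob2_of (x \<otimes>\<^bsub>mob2_cover\<^esub> y) z = mob2_of x (mob2_of y z)"
  by (cases z) (auto simp: mob2_of_def mob2_cover_simps mob_of_mult simp del: carrier_mob_cover mem_ball)

lemma mob2_of_one: "mob2_of \<one>\<^bsub>mob2_cover\<^esub> z = z"
  by (cases z) (simp add: mob2_of_def mob2_cover_simps mob_of_def Moebius_function_def)

lemma open_carrier_mob2_cover: "open (carrier mob2_cover)"
proof -
  have "carrier mob2_cover = ((UNIV :: real set) \<times> disc) \<times> ((UNIV :: real set) \<times> disc)"
    by (auto simp: mob2_cover_simps)
  then show ?thesis by (simp add: open_Times)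
qed

lemma mob_of_zero_has_derivative:
  "((\<lambda>x. mob_of x 0) has_derivative (\<lambda>h. - snd h)) (at (0, 0))"
proof -
  have "((\<lambda>x :: real \<times> complex. \<i> * of_real (fst x)) has_derivative (\<lambda>h. \<i> * of_real (fst h))) (at (0, 0))"
    by (auto intro!: derivative_eq_intros)
  moreover have "(exp has_derivative (*) (exp (\<i> * of_real (fst (0 :: real \<times> complex)))))
      (at (\<i> * of_real (fst (0 :: real, 0 :: complex))))"
    using DERIV_exp[of "0 :: complex"] by (simp add: has_field_derivative_def)
  ultimately have e: "((\<lambda>x :: real \<times> complex. exp (\<i> * of_real (fst x))) has_derivative
      (\<lambda>h. exp (\<i> * of_real (fst (0 :: real \<times> complex))) * (\<i> * of_real (fst h)))) (at (0, 0))"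
    by (rule has_derivative_compose)
  have "((\<lambda>x :: real \<times> complex. - (exp (\<i> * of_real (fst x)) * snd x)) has_derivative (\<lambda>h. - snd h)) (at (0, 0))"
    by (rule has_derivative_eq_rhs, rule has_derivative_minus, rule has_derivative_mult[OF e],
        rule has_derivative_snd, rule has_derivative_ident) (simp add: fun_eq_iff)
  then show ?thesis by (simp add: mob_of_def Moebius_function_def)
qed

lemma log_mob_deriv_zero_has_derivative:
  "((\<lambda>x. log_mob_deriv x 0) has_derivative (\<lambda>h. \<i> * of_real (fst h))) (at (0, 0))"
proof -
  have "((\<lambda>x :: real \<times> complex. \<i> * of_real (fst x) + of_real (ln (1 - (snd x \<bullet> snd x)))) has_derivative
      (\<lambda>h. \<i> * of_real (fst h))) (at (0, 0))"
    by (auto intro!: derivative_eq_intros simp: fun_eq_iff)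
  then show ?thesis by (simp add: log_mob_deriv_def power2_norm_eq_inner)
qed

lemma half_log_deriv2_zero_has_derivative:
  "((\<lambda>x. half_log_deriv2 x 0) has_derivative (\<lambda>h. cnj (snd h))) (at (0, 0))"
  unfolding half_log_deriv2_def
  by (auto intro!: derivative_eq_intros simp: fun_eq_iff)

context lowering_operators
begin

definition formula_cocycle :: "mob2 \<Rightarrow> complex \<times> complex \<Rightarrow> complex ^ 'n ^ 'n" where
  "formula_cocycle x z =
     y_exp (half_log_deriv2 (fst x) (fst z)) (half_log_deriv2 (snd x) (snd z))
     ** h_exp (log_mob_deriv (fst x) (fst z)) (log_mob_deriv (snd x) (snd z))"

lemma h_exp_y_exp_left:
  "h_exp l1 l2 ** (y_exp c1 c2 ** M) = y_exp (exp l1 * c1) (exp l2 * c2) ** (h_exp l1 l2 ** M)"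
  by (simp add: matrix_mul_assoc h_exp_y_exp)

text \<open>By the chain rules for \<open>log g'\<close> and \<open>g'' / (2 g')\<close> this amounts to moving
  \<open>exp (- l\<^sub>1 H\<^sub>1 - l\<^sub>2 H\<^sub>2)\<close> past \<open>exp (c\<^sub>1 Y\<^sub>1 + c\<^sub>2 Y\<^sub>2)\<close>, which multiplies each \<open>c\<^sub>i\<close> by
  \<open>exp l\<^sub>i = g\<^sub>i'\<close>.\<close>

lemma formula_cocycle_mult:
  assumes "x \<in> carrier mob2_cover" "y \<in> carrier mob2_cover" "z \<in> bidisc"
  shows "formula_cocycle (x \<otimes>\<^bsub>mob2_cover\<^esub> y) z = formula_cocycle y z ** formula_cocycle x (mob2_of y z)"
proof -
  obtain x1 x2 y1 y2 z1 z2 where xyz: "x = (x1, x2)" "y = (y1, y2)" "z = (z1, z2)"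
    by (cases x; cases y; cases z)
  have c: "x1 \<in> carrier mob_cover" "x2 \<in> carrier mob_cover" "y1 \<in> carrier mob_cover"
      "y2 \<in> carrier mob_cover" "z1 \<in> disc" "z2 \<in> disc"
    using assms by (auto simp: xyz mob2_cover_simps)
  show ?thesis
    unfolding formula_cocycle_def
    by (simp add: xyz mob2_cover_simps mob2_of_def half_log_deriv2_mult[OF c(1,3,5)]
        half_log_deriv2_mult[OF c(2,4,6)] log_mob_deriv_mult[OF c(1,3,5)] log_mob_deriv_mult[OF c(2,4,6)]
        add.commute[of "log_mob_deriv x1 _"] add.commute[of "log_mob_deriv x2 _"])
       (simp only: y_exp_add h_exp_add h_exp_y_exp_left matrix_mul_assoc[symmetric])
qed

lemma formula_cocycle_one: "formula_cocycle \<one>\<^bsub>mob2_cover\<^esub> z = mat 1"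
  by (simp add: formula_cocycle_def mob2_cover_simps half_log_deriv2_def log_mob_deriv_def
      y_exp_zero h_exp_zero)

text \<open>The derivatives of \<open>log g'\<close> and \<open>k = g'' / (2 g')\<close> are \<open>2 k\<close> and \<open>k\<^sup>2\<close>, which gives the
  coefficients of \<open>A\<close> and \<open>B\<close>.\<close>

lemma formula_cocycle_holomorphic:
  assumes "x \<in> carrier mob2_cover" "z \<in> bidisc"
  obtains A B where "((\<lambda>z. formula_cocycle x z *v v) has_derivative (\<lambda>h. fst h *s A + snd h *s B)) (at z)"
proof -
  obtain x1 x2 z1 z2 where xz: "x = (x1, x2)" "z = (z1, z2)" by (cases x; cases z)
  have c: "cmod (snd x1) < 1" "cmod (snd x2) < 1" "cmod z1 < 1" "cmod z2 < 1"
    using assms by (auto simp: xz mob2_cover_simps)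
  have 1: "((\<lambda>z. f (fst z)) has_derivative (\<lambda>h. f' * fst h)) (at z)"
    if "(f has_field_derivative f') (at z1)" for f :: "complex \<Rightarrow> complex" and f'
    using has_derivative_compose[OF has_derivative_fst[OF has_derivative_ident], of f "(*) f'" z UNIV] that
    by (simp add: has_field_derivative_def xz)
  have 2: "((\<lambda>z. f (snd z)) has_derivative (\<lambda>h. f' * snd h)) (at z)"
    if "(f has_field_derivative f') (at z2)" for f :: "complex \<Rightarrow> complex" and f'
    using has_derivative_compose[OF has_derivative_snd[OF has_derivative_ident], of f "(*) f'" z UNIV] that
    by (simp add: has_field_derivative_def xz)
  define P Q where "P = y_exp (half_log_deriv2 x1 z1) (half_log_deriv2 x2 z2)"
    and "Q = h_exp (log_mob_deriv x1 z1) (log_mob_deriv x2 z2)"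
  define A B where "A = (half_log_deriv2 x1 z1)\<^sup>2 *s ((P ** Y1 ** Q) *v v) - (2 * half_log_deriv2 x1 z1) *s ((P ** Q ** H1) *v v)"
    and "B = (half_log_deriv2 x2 z2)\<^sup>2 *s ((P ** Y2 ** Q) *v v) - (2 * half_log_deriv2 x2 z2) *s ((P ** Q ** H2) *v v)"
  have "((\<lambda>z. formula_cocycle x z *v v) has_derivative (\<lambda>h. fst h *s A + snd h *s B)) (at z)"
    unfolding formula_cocycle_def xz fst_conv snd_conv
    by (rule has_derivative_eq_rhs, rule y_h_exp_has_derivative[unfolded xz],
        rule 1[unfolded xz], rule half_log_deriv2_has_field_derivative[OF c(1,3)],
        rule 2[unfolded xz], rule half_log_deriv2_has_field_derivative[OF c(2,4)],
        rule 1[unfolded xz], rule log_mob_deriv_has_field_derivative[OF c(1,3)],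
        rule 2[unfolded xz], rule log_mob_deriv_has_field_derivative[OF c(2,4)],
        rule has_derivative_const)
       (simp add: fun_eq_iff A_def B_def P_def Q_def matrix_add_ldistrib matrix_add_rdistrib mat_scale_mult
         matrix_minus_simps matrix_vector_mult_add_rdistrib matrix_vector_mult_diff_rdistrib vec_eq_iff algebra_simps)
  then show ?thesis by (rule that)
qed

end

section \<open>Holomorphic functions of two variables\<close>

lemma holomorphic2_on_const: "holomorphic2_on (\<lambda>z. c) U"
  unfolding holomorphic2_on_def
proof
  fix z
  show "\<exists>a b. ((\<lambda>z. c) has_derivative (\<lambda>v. a * fst v + b * snd v)) (at z)"
    by (rule exI[of _ 0], rule exI[of _ 0]) simp
qed

lemma holomorphic2_on_add:
  assumes "holomorphic2_on f U" "holomorphic2_on g U"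
  shows "holomorphic2_on (\<lambda>z. f z + g z) U"
  unfolding holomorphic2_on_def
proof
  fix z assume "z \<in> U"
  then obtain a b c d where "(f has_derivative (\<lambda>v. a * fst v + b * snd v)) (at z)"
      "(g has_derivative (\<lambda>v. c * fst v + d * snd v)) (at z)"
    using assms unfolding holomorphic2_on_def by meson
  from has_derivative_add[OF this]
  have "((\<lambda>z. f z + g z) has_derivative (\<lambda>v. (a + c) * fst v + (b + d) * snd v)) (at z)"
    by (rule has_derivative_eq_rhs) (simp add: fun_eq_iff algebra_simps)
  then show "\<exists>a b. ((\<lambda>z. f z + g z) has_derivative (\<lambda>v. a * fst v + b * snd v)) (at z)" by blast
qed

lemma holomorphic2_on_mult:
  assumes "holomorphic2_on f U" "holomorphic2_on g U"
  shows "holomorphic2_on (\<lambda>z. f z * g z) U"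
  unfolding holomorphic2_on_def
proof
  fix z assume "z \<in> U"
  then obtain a b c d where "(f has_derivative (\<lambda>v. a * fst v + b * snd v)) (at z)"
      "(g has_derivative (\<lambda>v. c * fst v + d * snd v)) (at z)"
    using assms unfolding holomorphic2_on_def by meson
  from has_derivative_mult[OF this]
  have "((\<lambda>z. f z * g z) has_derivative
      (\<lambda>v. (f z * c + a * g z) * fst v + (f z * d + b * g z) * snd v)) (at z)"
    by (rule has_derivative_eq_rhs) (simp add: fun_eq_iff algebra_simps)
  then show "\<exists>a b. ((\<lambda>z. f z * g z) has_derivative (\<lambda>v. a * fst v + b * snd v)) (at z)" by blast
qed

lemma holomorphic2_on_inverse:
  assumes "holomorphic2_on f U" "\<And>z. z \<in> U \<Longrightarrow> f z \<noteq> 0"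
  shows "holomorphic2_on (\<lambda>z. inverse (f z)) U"
  unfolding holomorphic2_on_def
proof
  fix z assume z: "z \<in> U"
  then obtain a b where "(f has_derivative (\<lambda>v. a * fst v + b * snd v)) (at z)"
    using assms unfolding holomorphic2_on_def by meson
  from Deriv.has_derivative_inverse[OF assms(2)[OF z] this]
  have "((\<lambda>z. inverse (f z)) has_derivative
      (\<lambda>v. (- (inverse (f z) * a * inverse (f z))) * fst v + (- (inverse (f z) * b * inverse (f z))) * snd v)) (at z)"
    by (rule has_derivative_eq_rhs) (simp add: fun_eq_iff algebra_simps)
  then show "\<exists>a b. ((\<lambda>z. inverse (f z)) has_derivative (\<lambda>v. a * fst v + b * snd v)) (at z)" by blast
qed

lemma holomorphic2_on_sum:
  "(\<And>i. i \<in> I \<Longrightarrow> holomorphic2_on (f i) U) \<Longrightarrow> holomorphic2_on (\<lambda>z. \<Sum>i\<in>I. f i z) U"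
  by (induction I rule: infinite_finite_induct) (auto intro: holomorphic2_on_const holomorphic2_on_add)

lemma holomorphic2_on_prod:
  "(\<And>i. i \<in> I \<Longrightarrow> holomorphic2_on (f i) U) \<Longrightarrow> holomorphic2_on (\<lambda>z. \<Prod>i\<in>I. f i z) U"
  by (induction I rule: infinite_finite_induct) (auto intro: holomorphic2_on_const holomorphic2_on_mult)

lemma holomorphic2_on_det:
  fixes M :: "complex \<times> complex \<Rightarrow> complex ^ 'n ^ 'n"
  assumes "\<And>i j. holomorphic2_on (\<lambda>z. M z $ i $ j) U"
  shows "holomorphic2_on (\<lambda>z. det (M z)) U"
  unfolding det_def
  by (intro holomorphic2_on_sum holomorphic2_on_mult holomorphic2_on_const holomorphic2_on_prod assms)

lemma holomorphic2_on_cong: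
  assumes "open U" "\<And>z. z \<in> U \<Longrightarrow> f z = g z" "holomorphic2_on f U"
  shows "holomorphic2_on g U"
  using assms unfolding holomorphic2_on_def by (meson has_derivative_transform_within_open)

lemma vec_holomorphic2_on_cong:
  assumes "open U" "\<And>z. z \<in> U \<Longrightarrow> f z = g z" "vec_holomorphic2_on f U"
  shows "vec_holomorphic2_on g U"
  unfolding vec_holomorphic2_on_def
proof
  fix i
  show "holomorphic2_on (\<lambda>z. g z $ i) U"
    by (rule holomorphic2_on_cong[OF assms(1), of "\<lambda>z. f z $ i"])
       (use assms in \<open>auto simp: vec_holomorphic2_on_def\<close>)
qed

text \<open>Cramer's rule expresses the solution by holomorphic functions.\<close>

lemma holomorphic2_on_linear_system:
  fixes M :: "complex \<times> complex \<Rightarrow> complex ^ 'n ^ 'n"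
  assumes "\<And>i j. holomorphic2_on (\<lambda>z. M z $ i $ j) U" "\<And>z. z \<in> U \<Longrightarrow> det (M z) \<noteq> 0"
    and "open U" "\<And>z. z \<in> U \<Longrightarrow> M z *v x z = b"
  shows "vec_holomorphic2_on x U"
proof -
  define y where "y z = (\<chi> k. det (\<chi> i j. if j = k then b $ i else M z $ i $ j) * inverse (det (M z)))" for z
  have "holomorphic2_on (\<lambda>z. if j = k then b $ i else M z $ i $ j) U" for i j k
    using assms(1) holomorphic2_on_const by (cases "j = k") auto
  then have "vec_holomorphic2_on y U"
    unfolding vec_holomorphic2_on_def y_def
    by (auto intro!: holomorphic2_on_mult holomorphic2_on_det holomorphic2_on_inverse assms)
  moreover have "y z = x z" if "z \<in> U" for z
    using cramer[OF assms(2)[OF that], of "x z" b] assms(4)[OF that] by (simp add: y_def divide_inverse)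
  ultimately show ?thesis using vec_holomorphic2_on_cong[OF assms(3), of y x] by blast
qed

section \<open>Representations of the lower triangular algebra\<close>

lemma mat22_eq_iff: "(X :: mat22) = Y \<longleftrightarrow> X $ 1 $ 1 = Y $ 1 $ 1 \<and> X $ 1 $ 2 = Y $ 1 $ 2 \<and>
    X $ 2 $ 1 = Y $ 2 $ 1 \<and> X $ 2 $ 2 = Y $ 2 $ 2"
  by (auto simp: vec_eq_iff forall_2)

lemma hy_entries [simp]:
  "h_mat $ 1 $ 1 = 1 / 2" "h_mat $ 1 $ 2 = 0" "h_mat $ 2 $ 1 = 0" "h_mat $ 2 $ 2 = - 1 / 2"
  "y_mat $ 1 $ 1 = 0" "y_mat $ 1 $ 2 = 0" "y_mat $ 2 $ 1 = 1" "y_mat $ 2 $ 2 = 0"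
  by (simp_all add: h_mat_def y_mat_def)

lemma mat_scale_entry [simp]: "mat_scale c M $ i $ j = c * M $ i $ j"
  by (simp add: mat_scale_def)

lemma basis_in_bb [simp]: "h1 \<in> bb" "h2 \<in> bb" "y1 \<in> bb" "y2 \<in> bb"
  by (simp_all add: h1_def h2_def y1_def y2_def lower_triangular_sl2_def)

lemma bb_representation_lowering:
  assumes "bb_representation \<rho>"
  shows "lowering_operators (\<rho> h1) (\<rho> h2) (\<rho> y1) (\<rho> y2)"
proof -
  have scale: "\<rho> (map_prod (mat_scale c) (mat_scale c) X) = mat_scale c (\<rho> X)" if "X \<in> bb" for c X
    using assms that unfolding bb_representation_def by blast
  have bracket: "\<rho> X ** \<rho> Y - \<rho> Y ** \<rho> X = mat_scale c (\<rho> Z)"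
    if "X \<in> bb" "Y \<in> bb" "Z \<in> bb" "lie_bracket X Y = map_prod (mat_scale c) (mat_scale c) Z" for c X Y Z
    using assms that scale[of Z c] unfolding bb_representation_def by metis
  have "lie_bracket h1 h2 = map_prod (mat_scale 0) (mat_scale 0) h1"
    "lie_bracket y1 y2 = map_prod (mat_scale 0) (mat_scale 0) h1"
    "lie_bracket h1 y1 = map_prod (mat_scale (- 1)) (mat_scale (- 1)) y1"
    "lie_bracket h1 y2 = map_prod (mat_scale 0) (mat_scale 0) h1"
    "lie_bracket h2 y1 = map_prod (mat_scale 0) (mat_scale 0) h1"
    "lie_bracket h2 y2 = map_prod (mat_scale (- 1)) (mat_scale (- 1)) y2"
    by (simp_all add: lie_bracket_def h1_def h2_def y1_def y2_def mat22_eq_iff matrix_matrix_mult_def sum_2)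
  note b = this[THEN bracket[rotated 3]]
  show ?thesis
  proof
    show "\<rho> h1 ** \<rho> h2 = \<rho> h2 ** \<rho> h1" using b(1) by (simp add: mat_scale_mult)
    show "\<rho> y1 ** \<rho> y2 = \<rho> y2 ** \<rho> y1" using b(2) by (simp add: mat_scale_mult)
    show "\<rho> h1 ** \<rho> y1 = \<rho> y1 ** \<rho> h1 - \<rho> y1" using b(3) by (simp add: mat_scale_mult diff_eq_eq)
    show "\<rho> h1 ** \<rho> y2 = \<rho> y2 ** \<rho> h1" using b(4) by (simp add: mat_scale_mult)
    show "\<rho> h2 ** \<rho> y1 = \<rho> y1 ** \<rho> h2" using b(5) by (simp add: mat_scale_mult)
    show "\<rho> h2 ** \<rho> y2 = \<rho> y2 ** \<rho> h2 - \<rho> y2" using b(6) by (simp add: mat_scale_mult diff_eq_eq)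
  qed
qed

lemma bb_representation_expand:
  assumes "bb_representation \<rho>" "X \<in> bb"
  shows "\<rho> X = mat_scale (2 * fst X $ 1 $ 1) (\<rho> h1) + mat_scale (fst X $ 2 $ 1) (\<rho> y1)
    + (mat_scale (2 * snd X $ 1 $ 1) (\<rho> h2) + mat_scale (snd X $ 2 $ 1) (\<rho> y2))"
proof -
  have scale: "\<rho> (map_prod (mat_scale c) (mat_scale c) X) = mat_scale c (\<rho> X)" if "X \<in> bb" for c X
    using assms that unfolding bb_representation_def by blast
  have add: "\<rho> (X + Y) = \<rho> X + \<rho> Y" if "X \<in> bb" "Y \<in> bb" for X Y
    using assms that unfolding bb_representation_def by blast
  have mem: "map_prod (mat_scale c) (mat_scale c) X \<in> bb" if "X \<in> bb" for c X
    using that by (auto simp: lower_triangular_sl2_def simp flip: distrib_left)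
  have mem': "X + Y \<in> bb" if "X \<in> bb" "Y \<in> bb" for X Y
    using that by (auto simp: lower_triangular_sl2_def algebra_simps)
  let ?s = "\<lambda>c. map_prod (mat_scale c) (mat_scale c) :: mat22 \<times> mat22 \<Rightarrow> mat22 \<times> mat22"
  have "X = ?s (2 * fst X $ 1 $ 1) h1 + ?s (fst X $ 2 $ 1) y1 + (?s (2 * snd X $ 1 $ 1) h2 + ?s (snd X $ 2 $ 1) y2)"
    using assms(2)
    by (auto simp: prod_eq_iff mat22_eq_iff h1_def h2_def y1_def y2_def lower_triangular_sl2_def add_eq_0_iff)
  then have "\<rho> X = \<rho> (?s (2 * fst X $ 1 $ 1) h1 + ?s (fst X $ 2 $ 1) y1 + (?s (2 * snd X $ 1 $ 1) h2 + ?s (snd X $ 2 $ 1) y2))"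
    by simp
  also have "\<dots> = mat_scale (2 * fst X $ 1 $ 1) (\<rho> h1) + mat_scale (fst X $ 2 $ 1) (\<rho> y1)
    + (mat_scale (2 * snd X $ 1 $ 1) (\<rho> h2) + mat_scale (snd X $ 2 $ 1) (\<rho> y2))"
    by (simp only: add scale mem mem' basis_in_bb)
  finally show ?thesis .
qed

lemma tangent_coord_lower:
  assumes "X \<in> lower_triangular_sl2"
  shows "tangent_coord (su_re X) = (2 * Im (X $ 1 $ 1), - cnj (X $ 2 $ 1) / 2)"
    "tangent_coord (su_im X) = (- 2 * Re (X $ 1 $ 1), - \<i> * cnj (X $ 2 $ 1) / 2)"
proof -
  have "X $ 1 $ 2 = 0" "X $ 2 $ 2 = - X $ 1 $ 1"
    using assms by (auto simp: lower_triangular_sl2_def add_eq_0_iff)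
  then show "tangent_coord (su_re X) = (2 * Im (X $ 1 $ 1), - cnj (X $ 2 $ 1) / 2)"
    "tangent_coord (su_im X) = (- 2 * Re (X $ 1 $ 1), - \<i> * cnj (X $ 2 $ 1) / 2)"
    by (simp_all add: tangent_coord_def su_re_def su_im_def su_conj_def complex_eq_iff)
qed

text \<open>By the cocycle identity \<open>F (x y) = J (y, 0) J (x, y 0) v\<close>. For \<open>X\<close> in \<open>\<bb> \<oplus> \<bb>\<close> the complex tangent
  vector \<open>X\<close> of the group is mapped to a vector of type \<open>(0, 1)\<close> at \<open>0\<close> in the bidisc, so
  the second factor, being holomorphic in \<open>y 0\<close>, does not contribute. The first factor contributes
  \<open>- \<rho> (X) F\<close>.\<close>

lemma has_left_inv_derivative_formula_cocycle:
  assumes \<rho>: "bb_representation \<rho>" and X: "X \<in> bb" and x: "x \<in> carrier mob2_cover"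
    and F: "\<And>x. x \<in> carrier mob2_cover \<Longrightarrow>
      F x = lowering_operators.formula_cocycle (\<rho> h1) (\<rho> h2) (\<rho> y1) (\<rho> y2) x (0, 0) *v v"
  shows "has_left_inv_derivative F X x (- (\<rho> X *v F x))"
proof -
  interpret lowering_operators "\<rho> h1" "\<rho> h2" "\<rho> y1" "\<rho> y2"
    by (rule bb_representation_lowering[OF \<rho>])
  interpret group mob2_cover by (rule group_mob2_cover)
  let ?o = "((0, 0), (0, 0)) :: mob2"
  have o: "\<one>\<^bsub>mob2_cover\<^esub> = ?o" by (rule mob2_cover_simps)
  obtain A B where "((\<lambda>z. formula_cocycle x z *v v) has_derivative (\<lambda>h. fst h *s A + snd h *s B)) (at (0, 0))"
    using formula_cocycle_holomorphic[OF x, of "(0, 0)" v] by auto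
  moreover have "mob2_of ?o (0, 0) = (0, 0)" using mob2_of_one[of "(0, 0)"] by (simp add: o)
  ultimately have zder: "((\<lambda>z. formula_cocycle x z *v v) has_derivative (\<lambda>h. fst h *s A + snd h *s B)) (at (mob2_of ?o (0, 0)))"
    by simp
  have fst_o: "((\<lambda>y. f (fst y)) has_derivative (\<lambda>h. f' (fst h))) (at ?o)"
    if "(f has_derivative f') (at (0, 0))" for f :: "real \<times> complex \<Rightarrow> complex" and f'
    using has_derivative_compose[OF has_derivative_fst[OF has_derivative_ident], of f f' ?o UNIV] that by simp
  have snd_o: "((\<lambda>y. f (snd y)) has_derivative (\<lambda>h. f' (snd h))) (at ?o)"
    if "(f has_derivative f') (at (0, 0))" for f :: "real \<times> complex \<Rightarrow> complex" and f'
    using has_derivative_compose[OF has_derivative_snd[OF has_derivative_ident], of f f' ?o UNIV] that by simp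
  have "((\<lambda>y. mob2_of y (0, 0)) has_derivative (\<lambda>h. (- snd (fst h), - snd (snd h)))) (at ?o)"
    unfolding mob2_of_def map_prod_def prod.case
    by (rule has_derivative_Pair[OF fst_o[OF mob_of_zero_has_derivative] snd_o[OF mob_of_zero_has_derivative]])
  from has_derivative_compose[OF this zder]
  have u: "((\<lambda>y. formula_cocycle x (mob2_of y (0, 0)) *v v) has_derivative
      (\<lambda>h. - snd (fst h) *s A + - snd (snd h) *s B)) (at ?o)" by simp
  define w where "w = formula_cocycle x (0, 0) *v v"
  define D where "D h = (mat_scale (cnj (snd (fst h))) (\<rho> y1) + mat_scale (cnj (snd (snd h))) (\<rho> y2)) *v w
      + (mat_scale (- (\<i> * of_real (fst (fst h)))) (\<rho> h1) + mat_scale (- (\<i> * of_real (fst (snd h)))) (\<rho> h2)) *v w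
      + (- snd (fst h) *s A + - snd (snd h) *s B)" for h :: mob2
  have l0: "log_mob_deriv (0, 0) 0 = 0" by (simp add: log_mob_deriv_def)
  have k0: "half_log_deriv2 (0, 0) 0 = 0" by (simp add: half_log_deriv2_def)
  have uo: "formula_cocycle x (mob2_of ?o (0, 0)) *v v = w" by (simp add: w_def \<open>mob2_of ?o (0, 0) = (0, 0)\<close>)
  have "((\<lambda>y. formula_cocycle y (0, 0) *v (formula_cocycle x (mob2_of y (0, 0)) *v v)) has_derivative D) (at ?o)"
    unfolding formula_cocycle_def[of _ "(0, 0)"] fst_conv snd_conv
    by (rule has_derivative_eq_rhs, rule y_h_exp_has_derivative,
        rule fst_o[OF half_log_deriv2_zero_has_derivative], rule snd_o[OF half_log_deriv2_zero_has_derivative],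
        rule fst_o[OF log_mob_deriv_zero_has_derivative], rule snd_o[OF log_mob_deriv_zero_has_derivative],
        rule u)
       (simp add: fun_eq_iff D_def uo l0 k0 y_exp_zero h_exp_zero)
  then have "((\<lambda>y. F (x \<otimes>\<^bsub>mob2_cover\<^esub> y)) has_derivative D) (at ?o)"
  proof (rule has_derivative_transform_within_open[OF _ open_carrier_mob2_cover])
    show "?o \<in> carrier mob2_cover" by (simp add: mob2_cover_simps)
    fix y assume y: "y \<in> carrier mob2_cover"
    show "formula_cocycle y (0, 0) *v (formula_cocycle x (mob2_of y (0, 0)) *v v) = F (x \<otimes>\<^bsub>mob2_cover\<^esub> y)"
      using F[OF m_closed[OF x y]] formula_cocycle_mult[OF x y, of "(0, 0)"]
      by (simp add: matrix_vector_mul_assoc)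
  qed
  moreover have "- (\<rho> X *v F x) = D (tangent_coord (su_re (fst X)), tangent_coord (su_re (snd X)))
          + \<i> *s D (tangent_coord (su_im (fst X)), tangent_coord (su_im (snd X)))"
  proof -
    have Xl: "fst X \<in> lower_triangular_sl2" "snd X \<in> lower_triangular_sl2" using X by auto
    define a b c d where abcd: "a = fst X $ 1 $ 1" "b = fst X $ 2 $ 1" "c = snd X $ 1 $ 1" "d = snd X $ 2 $ 1"
    have re: "a * (2 * u) = 2 * (complex_of_real (Re a) * u) + \<i> * (2 * (complex_of_real (Im a) * u))" for a u
      by (subst (1) complex_eq) (simp add: algebra_simps)
    have "\<rho> X *v F x = (2 * a) *s (\<rho> h1 *v w) + b *s (\<rho> y1 *v w) + ((2 * c) *s (\<rho> h2 *v w) + d *s (\<rho> y2 *v w))"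
      unfolding bb_representation_expand[OF \<rho> X] F[OF x] w_def[symmetric] abcd[symmetric]
      by (simp add: mat_scale_mult matrix_vector_mult_add_rdistrib)
    then show ?thesis
      unfolding D_def tangent_coord_lower[OF Xl(1)] tangent_coord_lower[OF Xl(2)] abcd[symmetric]
      by (simp add: mat_scale_mult matrix_minus_simps matrix_vector_mult_add_rdistrib matrix_vector_mult_diff_rdistrib vec_eq_iff
          re[of a] re[of c] algebra_simps)
  qed
  ultimately show ?thesis unfolding has_left_inv_derivative_def o by blast
qed

section \<open>Trivializations and the isotropy action\<close>

lemma linear_triv_simps:
  assumes "linear_triv E U \<phi>" "z \<in> U"
  shows "from_triv E \<phi> z v \<in> fibre E z" "\<phi> (from_triv E \<phi> z v) = v"
    "e \<in> fibre E z \<Longrightarrow> from_triv E \<phi> z (\<phi> e) = e"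
    "bij_betw (from_triv E \<phi> z) UNIV (fibre E z)" "inj_on \<phi> (fibre E z)"
    "u \<in> fibre E z \<Longrightarrow> u' \<in> fibre E z \<Longrightarrow> \<phi> (badd E u u') = \<phi> u + \<phi> u'"
    "u \<in> fibre E z \<Longrightarrow> \<phi> (bscale E c u) = c *s \<phi> u"
proof -
  have b: "bij_betw \<phi> (fibre E z) UNIV" using assms by (auto simp: linear_triv_def)
  show "bij_betw (from_triv E \<phi> z) UNIV (fibre E z)"
    unfolding from_triv_def using bij_betw_inv_into[OF b] .
  then show "from_triv E \<phi> z v \<in> fibre E z" by (auto simp: bij_betw_def)
  show "\<phi> (from_triv E \<phi> z v) = v"
    unfolding from_triv_def using b by (simp add: bij_betw_inv_into_right)
  show "e \<in> fibre E z \<Longrightarrow> from_triv E \<phi> z (\<phi> e) = e"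
    unfolding from_triv_def using b by (simp add: bij_betw_inv_into_left)
  show "inj_on \<phi> (fibre E z)" using b by (simp add: bij_betw_def)
qed (use assms in \<open>auto simp: linear_triv_def\<close>)

text \<open>A one-parameter group of linear maps acts on an eigenvector of its generator by scalars,
  because both sides solve the same linear differential equation.\<close>

lemma one_parameter_group_eigenvector:
  fixes \<tau> :: "real \<Rightarrow> complex ^ 'n \<Rightarrow> complex ^ 'n"
  assumes lin: "\<And>t u v. \<tau> t (u + v) = \<tau> t u + \<tau> t v" "\<And>t c u. \<tau> t (c *s u) = c *s \<tau> t u"
    and grp: "\<And>s t v. \<tau> (s + t) v = \<tau> s (\<tau> t v)" "\<tau> 0 v = v"
    and der: "((\<lambda>t. \<tau> t v) has_vector_derivative c *s v) (at 0)"
  shows "\<tau> t v = exp (c * of_real t) *s v"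
proof -
  have bl: "bounded_linear (\<tau> s)" for s
  proof -
    have "\<tau> s (r *\<^sub>R u) = r *\<^sub>R \<tau> s u" for r u
      using lin(2)[of s "of_real r" u] by (simp add: vec_eq_iff scaleR_conv_of_real[symmetric] vector_scalar_mult_def scaleR_vec_def)
    then have "linear (\<tau> s)" using lin(1) by (intro linearI) auto
    then show ?thesis by (simp add: linear_conv_bounded_linear)
  qed
  have d: "((\<lambda>t. \<tau> t v) has_vector_derivative c *s \<tau> s v) (at s)" for s
  proof -
    have "((\<lambda>t. \<tau> (t - s) v) has_vector_derivative c *s v) (at s)"
    proof -
      have "((\<lambda>t. t - s) has_vector_derivative 1) (at s)"
        unfolding has_vector_derivative_def by (auto intro!: derivative_eq_intros)
      from vector_diff_chain_at[OF this, of "\<lambda>t. \<tau> t v" "c *s v"] der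
      show ?thesis by (simp add: o_def)
    qed
    from bounded_linear.has_vector_derivative[OF bl this, of s]
    show ?thesis by (simp add: grp(1)[symmetric] lin(2))
  qed
  have "\<tau> t v $ j = (exp (c * of_real t) *s v) $ j" for j
  proof -
    \<comment> \<open>The quotient of the two sides, up to a constant, has derivative zero.\<close>
    define f where "f t = exp (- c * of_real t) * \<tau> t v $ j" for t
    have "(f has_vector_derivative 0) (at s)" for s
    proof -
      have "((\<lambda>t. \<tau> t v $ j) has_vector_derivative c * \<tau> s v $ j) (at s)"
        using bounded_linear.has_vector_derivative[OF bounded_linear_vec_nth d, of j s] by simp
      moreover have "((\<lambda>t. exp (- c * of_real t)) has_vector_derivative (exp (- c * of_real s) * - c)) (at s)"
        by (rule has_vector_derivative_real_field) (auto intro!: derivative_eq_intros)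
      ultimately show ?thesis
        unfolding f_def by (auto intro!: derivative_eq_intros simp: algebra_simps)
    qed
    then have "f t = f 0" by (rule has_vector_derivative_zero_constant[of UNIV, simplified, THEN iffD1, THEN exE]) auto
    then show ?thesis by (simp add: f_def grp(2) exp_minus field_simps)
  qed
  then show ?thesis by (simp add: vec_eq_iff)
qed

lemma mob2_cover_torus_mult:
  "((s, 0), (t, 0)) \<otimes>\<^bsub>mob2_cover\<^esub> ((s', 0), (t', 0)) = ((s + s', 0), (t + t', 0))"
  by (simp add: mob2_cover_simps mult_mob_cover)

lemma mob2_of_torus_zero: "mob2_of ((s, 0), (t, 0)) (0, 0) = (0, 0)"
  by (simp add: mob2_of_def mob_of_def Moebius_function_def)

text \<open>A choice of a group element that maps \<open>(0, 0)\<close> to \<open>z\<close>. By \<open>act_fib0_formula\<close> below, what is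
  constructed from it does not depend on the choice.\<close>

definition to_point :: "complex \<times> complex \<Rightarrow> mob2" where
  "to_point z = ((0, - fst z), (0, - snd z))"

lemma to_point:
  "z \<in> bidisc \<Longrightarrow> to_point z \<in> carrier mob2_cover" "mob2_of (to_point z) (0, 0) = z"
  by (auto simp: to_point_def mob2_cover_simps mob2_of_def mob_of_def Moebius_function_def prod_eq_iff)

text \<open>A homogeneous bundle for which the basis of the fibre over \<open>(0, 0)\<close> given by \<open>\<phi>\<close> consists of joint
  eigenvectors of the associated representation; \<open>w1 i\<close> and \<open>w2 i\<close> are the eigenvalues of the
  \<open>i\<close>-th vector.\<close>

locale weight_bundle =
  fixes E :: "('e, 'n::finite) hbundle" and act :: "mob2 \<Rightarrow> 'e \<Rightarrow> 'e"
    and \<phi> :: "'e \<Rightarrow> complex ^ 'n" and \<rho> :: "mat22 \<times> mat22 \<Rightarrow> complex ^ 'n ^ 'n"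
    and w1 w2 :: "'n \<Rightarrow> complex"
  assumes herm: "hermitian_holomorphic_bundle E" and action: "isometric_action E act"
    and triv: "global_holomorphic_triv E \<phi>" and assoc: "associated_representation E act \<phi> \<rho>"
    and weights: "\<rho> h1 = diag_mat w1" "\<rho> h2 = diag_mat w2"
begin

lemma rep: "bb_representation \<rho>"
  using assoc by (simp add: associated_representation_def)

sublocale lowering_operators "\<rho> h1" "\<rho> h2" "\<rho> y1" "\<rho> y2"
  by (rule bb_representation_lowering[OF rep])

sublocale mob2: group mob2_cover by (rule group_mob2_cover)

lemma lin_triv: "linear_triv E bidisc \<phi>"
  using triv by (simp add: holomorphic_triv_def)

lemma zero_in_bidisc: "(0, 0) \<in> bidisc" by simp

abbreviation fib0 :: "complex ^ 'n \<Rightarrow> 'e" where "fib0 \<equiv> from_triv E \<phi> (0, 0)"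

lemmas fib0 = linear_triv_simps[OF lin_triv zero_in_bidisc]

lemma add_in_fibre: "z \<in> bidisc \<Longrightarrow> u \<in> fibre E z \<Longrightarrow> v \<in> fibre E z \<Longrightarrow> badd E u v \<in> fibre E z"
  using herm unfolding hermitian_holomorphic_bundle_def holomorphic_bundle_def by blast

lemma scale_in_fibre: "z \<in> bidisc \<Longrightarrow> u \<in> fibre E z \<Longrightarrow> bscale E c u \<in> fibre E z"
  using herm unfolding hermitian_holomorphic_bundle_def holomorphic_bundle_def by blast

lemma fib0_add: "fib0 (u + v) = badd E (fib0 u) (fib0 v)"
  by (rule inj_onD[OF fib0(5)]) (simp_all add: fib0 add_in_fibre del: mem_Times_iff)

lemma fib0_scale: "fib0 (c *s u) = bscale E c (fib0 u)"
  by (rule inj_onD[OF fib0(5)]) (simp_all add: fib0 scale_in_fibre del: mem_Times_iff)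

lemma act_auto: "x \<in> carrier mob2_cover \<Longrightarrow> isometric_automorphism E (mob2_of x) (act x)"
  using action unfolding isometric_action_def by blast

lemma act_bij: "x \<in> carrier mob2_cover \<Longrightarrow> z \<in> bidisc \<Longrightarrow> bij_betw (act x) (fibre E z) (fibre E (mob2_of x z))"
  using act_auto unfolding isometric_automorphism_def by blast

lemma act_in_fibre: "x \<in> carrier mob2_cover \<Longrightarrow> z \<in> bidisc \<Longrightarrow> e \<in> fibre E z \<Longrightarrow> act x e \<in> fibre E (mob2_of x z)"
  using act_bij bij_betwE by blast

lemma act_add: "x \<in> carrier mob2_cover \<Longrightarrow> z \<in> bidisc \<Longrightarrow> u \<in> fibre E z \<Longrightarrow> v \<in> fibre E z \<Longrightarrow>
    act x (badd E u v) = badd E (act x u) (act x v)"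
  using act_auto unfolding isometric_automorphism_def by blast

lemma act_scale: "x \<in> carrier mob2_cover \<Longrightarrow> z \<in> bidisc \<Longrightarrow> u \<in> fibre E z \<Longrightarrow>
    act x (bscale E c u) = bscale E c (act x u)"
  using act_auto unfolding isometric_automorphism_def by blast

lemma act_herm: "x \<in> carrier mob2_cover \<Longrightarrow> z \<in> bidisc \<Longrightarrow> u \<in> fibre E z \<Longrightarrow> v \<in> fibre E z \<Longrightarrow>
    bherm E (act x u) (act x v) = bherm E u v"
  using act_auto unfolding isometric_automorphism_def by blast

lemma fibre_total: "e \<in> fibre E z \<Longrightarrow> e \<in> total E"
  by (simp add: fibre_def)

lemma act_mult: "x \<in> carrier mob2_cover \<Longrightarrow> y \<in> carrier mob2_cover \<Longrightarrow> e \<in> fibre E z \<Longrightarrow>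
    act (x \<otimes>\<^bsub>mob2_cover\<^esub> y) e = act x (act y e)"
  using action fibre_total unfolding isometric_action_def by blast

lemma act_one: "e \<in> fibre E z \<Longrightarrow> act \<one>\<^bsub>mob2_cover\<^esub> e = e"
  using action fibre_total unfolding isometric_action_def by blast

lemma act_act_inv:
  assumes "x \<in> carrier mob2_cover" "e \<in> fibre E z"
  shows "act x (act (inv\<^bsub>mob2_cover\<^esub> x) e) = e"
  using act_mult[OF assms(1) mob2.inv_closed[OF assms(1)] assms(2)] assms act_one by (simp add: mob2.r_inv)

text \<open>The action on the fibre of the stabilizer of \<open>(0, 0)\<close>, which is the universal cover of a torus.\<close>

definition torus :: "real \<Rightarrow> real \<Rightarrow> complex ^ 'n \<Rightarrow> complex ^ 'n" where
  "torus s t v = \<phi> (act ((s, 0), (t, 0)) (fib0 v))"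

lemma torus_carrier: "((s, 0), (t, 0)) \<in> carrier mob2_cover"
  by (simp add: mob2_cover_simps)

lemma torus_in_fibre: "act ((s, 0), (t, 0)) (fib0 v) \<in> fibre E (0, 0)"
  using act_in_fibre[OF torus_carrier zero_in_bidisc fib0(1)] by (simp add: mob2_of_torus_zero)

lemma fib0_torus: "fib0 (torus s t v) = act ((s, 0), (t, 0)) (fib0 v)"
  unfolding torus_def by (rule fib0(3)[OF torus_in_fibre])

lemma torus_linear: "torus s t (u + v) = torus s t u + torus s t v" "torus s t (c *s u) = c *s torus s t u"
  unfolding torus_def fib0_add fib0_scale
  by (simp_all add: act_add[OF torus_carrier zero_in_bidisc fib0(1) fib0(1)]
      act_scale[OF torus_carrier zero_in_bidisc fib0(1)] fib0(6,7) torus_in_fibre)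

lemma torus_add: "torus (s + s') (t + t') v = torus s t (torus s' t' v)"
  unfolding torus_def mob2_cover_torus_mult[symmetric] act_mult[OF torus_carrier torus_carrier fib0(1)]
  using fib0_torus[of s' t' v] by (simp add: torus_def)

lemma torus_zero: "torus 0 0 v = v"
  unfolding torus_def using act_one[OF fib0(1)] by (simp add: mob2_cover_simps(3) fib0(2))

lemma torus_axis: "torus s t (axis i 1) = exp (\<i> * (of_real s * w1 i + of_real t * w2 i)) *s axis i 1"
proof -
  have "((\<lambda>s. torus s 0 (axis i 1)) has_vector_derivative \<i> *s (\<rho> h1 *v axis i 1)) (at 0)"
    using assoc unfolding associated_representation_def torus_def by blast
  then have d1: "((\<lambda>s. torus s 0 (axis i 1)) has_vector_derivative (\<i> * w1 i) *s axis i 1) (at 0)"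
    by (simp add: weights diag_mat_axis vector_smult_assoc)
  have "((\<lambda>t. torus 0 t (axis i 1)) has_vector_derivative \<i> *s (\<rho> h2 *v axis i 1)) (at 0)"
    using assoc unfolding associated_representation_def torus_def by blast
  then have d2: "((\<lambda>t. torus 0 t (axis i 1)) has_vector_derivative (\<i> * w2 i) *s axis i 1) (at 0)"
    by (simp add: weights diag_mat_axis vector_smult_assoc)
  have "torus s 0 (axis i 1) = exp (\<i> * w1 i * of_real s) *s axis i 1"
    by (rule one_parameter_group_eigenvector[where \<tau> = "\<lambda>s. torus s 0", OF _ _ _ _ d1])
       (use torus_add[of _ _ 0 0] in \<open>auto simp: torus_linear torus_zero\<close>)
  note e1 = this
  have e2: "torus 0 t (axis i 1) = exp (\<i> * w2 i * of_real t) *s axis i 1"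
    by (rule one_parameter_group_eigenvector[where \<tau> = "\<lambda>t. torus 0 t", OF _ _ _ _ d2])
       (use torus_add[of 0 0] in \<open>auto simp: torus_linear torus_zero\<close>)
  have "torus s t (axis i 1) = torus s 0 (torus 0 t (axis i 1))"
    using torus_add[of s 0 0 t "axis i 1"] by simp
  then show ?thesis
    unfolding e2 torus_linear(2) e1 by (simp add: vec_eq_iff exp_add algebra_simps)
qed

lemma torus_eq: "torus s t v = diag_mat (\<lambda>i. exp (\<i> * (of_real s * w1 i + of_real t * w2 i))) *v v"
proof -
  have "torus s t (\<Sum>i\<in>I. v $ i *s axis i 1) = (\<Sum>i\<in>I. v $ i *s torus s t (axis i 1))" if "finite I" for I
    using that torus_linear(2)[of s t 0 0]
    by (induction I rule: finite_induct) (simp_all add: torus_linear)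
  from this[of UNIV] have "torus s t v = (\<Sum>i\<in>UNIV. v $ i *s torus s t (axis i 1))"
    by (simp add: basis_expansion)
  also have "\<dots> = diag_mat (\<lambda>i. exp (\<i> * (of_real s * w1 i + of_real t * w2 i))) *v v"
    unfolding torus_axis
    by (simp add: diag_mat_mult vec_eq_iff axis_def if_distrib mult.commute cong: if_cong)
  finally show ?thesis .
qed

text \<open>On the stabilizer both factors are determined by the infinitesimal action on the fibre, with opposite
  signs.\<close>

lemma torus_formula_cocycle: "torus s t (formula_cocycle ((s, 0), (t, 0)) (0, 0) *v v) = v"
proof -
  have "mat_scale (- (\<i> * of_real s)) (\<rho> h1) + mat_scale (- (\<i> * of_real t)) (\<rho> h2)
      = diag_mat (\<lambda>i. - (\<i> * (of_real s * w1 i + of_real t * w2 i)))"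
    unfolding weights by (simp add: diag_mat_def vec_eq_iff algebra_simps)
  then have eq: "formula_cocycle ((s, 0), (t, 0)) (0, 0) = diag_mat (\<lambda>i. exp (- (\<i> * (of_real s * w1 i + of_real t * w2 i))))"
    by (simp only: formula_cocycle_def half_log_deriv2_def log_mob_deriv_def fst_conv snd_conv complex_cnj_zero
        div_0 y_exp_zero h_exp_def) (simp add: mat_exp_diag_mat)
  show ?thesis unfolding torus_eq eq diag_mat_mult by (simp add: vec_eq_iff exp_minus)
qed

section \<open>The holomorphic frame\<close>

text \<open>The section of \<open>E\<close> whose lift to the group is \<open>x \<mapsto> J\<^sub>\<rho> (x, 0) v\<close>.\<close>

definition frame :: "complex ^ 'n \<Rightarrow> complex \<times> complex \<Rightarrow> 'e" where
  "frame v z = act (to_point z) (fib0 (formula_cocycle (to_point z) (0, 0) *v v))"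

lemma act_fib0_in_fibre: "x \<in> carrier mob2_cover \<Longrightarrow> act x (fib0 v) \<in> fibre E (mob2_of x (0, 0))"
  using act_in_fibre[OF _ zero_in_bidisc fib0(1)] .

lemma frame_in_fibre: "z \<in> bidisc \<Longrightarrow> frame v z \<in> fibre E z"
  unfolding frame_def using act_fib0_in_fibre[OF to_point(1)] to_point(2) by metis

lemma stabilizer_is_torus:
  assumes "k \<in> carrier mob2_cover" "mob2_of k (0, 0) = (0, 0)"
  obtains s t where "k = ((s, 0), (t, 0))"
  using assms by (cases k) (auto simp: mob2_of_def mob_of_def Moebius_function_def)

text \<open>The element \<open>to_point (x 0)\<close> is \<open>x k\<close> with \<open>k\<close> in the stabilizer, and the two occurrences of
  \<open>k\<close>, in the action and in the cocycle, cancel.\<close>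

lemma section_lift_frame:
  assumes x: "x \<in> carrier mob2_cover"
  shows "section_lift E act \<phi> (frame v) x = formula_cocycle x (0, 0) *v v"
proof -
  define z where "z = mob2_of x (0, 0)"
  have z: "z \<in> bidisc" unfolding z_def by (rule mob2_of_in_bidisc[OF x zero_in_bidisc])
  define k where "k = inv\<^bsub>mob2_cover\<^esub> x \<otimes>\<^bsub>mob2_cover\<^esub> to_point z"
  have k: "k \<in> carrier mob2_cover" unfolding k_def using mob2.inv_closed[OF x] to_point(1)[OF z] by (rule mob2.m_closed)
  have "mob2_of k (0, 0) = mob2_of (inv\<^bsub>mob2_cover\<^esub> x) (mob2_of x (0, 0))"
    unfolding k_def mob2_of_mult[OF mob2.inv_closed[OF x] to_point(1)[OF z] zero_in_bidisc] to_point(2)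
    by (simp only: z_def)
  then have k0: "mob2_of k (0, 0) = (0, 0)"
    by (simp only: mob2_of_mult[OF mob2.inv_closed[OF x] x zero_in_bidisc, symmetric] mob2.l_inv[OF x] mob2_of_one)
  obtain s t where st: "k = ((s, 0), (t, 0))" using stabilizer_is_torus[OF k k0] by blast
  have p: "to_point z = x \<otimes>\<^bsub>mob2_cover\<^esub> k"
    unfolding k_def
    by (simp only: mob2.m_assoc[OF x mob2.inv_closed[OF x] to_point(1)[OF z], symmetric]
        mob2.r_inv[OF x] mob2.l_one[OF to_point(1)[OF z]])
  have "section_lift E act \<phi> (frame v) x
      = \<phi> (act (inv\<^bsub>mob2_cover\<^esub> x) (act (to_point z) (fib0 (formula_cocycle (to_point z) (0, 0) *v v))))"
    by (simp add: section_lift_def frame_def z_def)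
  also have "\<dots> = \<phi> (act k (fib0 (formula_cocycle (to_point z) (0, 0) *v v)))"
    unfolding k_def by (simp only: act_mult[OF mob2.inv_closed[OF x] to_point(1)[OF z] fib0(1)])
  also have "\<dots> = torus s t (formula_cocycle (to_point z) (0, 0) *v v)" by (simp add: torus_def st)
  also have "formula_cocycle (to_point z) (0, 0) *v v = formula_cocycle k (0, 0) *v (formula_cocycle x (0, 0) *v v)"
    unfolding p formula_cocycle_mult[OF x k zero_in_bidisc] k0 by (simp add: matrix_vector_mul_assoc)
  finally show ?thesis by (simp only: st torus_formula_cocycle)
qed

lemma act_fib0_formula:
  assumes x: "x \<in> carrier mob2_cover"
  shows "act x (fib0 (formula_cocycle x (0, 0) *v v)) = frame v (mob2_of x (0, 0))"
proof -
  let ?z = "mob2_of x (0, 0)"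
  have z: "?z \<in> bidisc" by (rule mob2_of_in_bidisc[OF x zero_in_bidisc])
  have "mob2_of (inv\<^bsub>mob2_cover\<^esub> x) ?z = (0, 0)"
    by (simp only: mob2_of_mult[OF mob2.inv_closed[OF x] x zero_in_bidisc, symmetric] mob2.l_inv[OF x] mob2_of_one)
  then have "act (inv\<^bsub>mob2_cover\<^esub> x) (frame v ?z) \<in> fibre E (0, 0)"
    using act_in_fibre[OF mob2.inv_closed[OF x] z frame_in_fibre[OF z]] by metis
  from fib0(3)[OF this] have "fib0 (formula_cocycle x (0, 0) *v v) = act (inv\<^bsub>mob2_cover\<^esub> x) (frame v ?z)"
    using section_lift_frame[OF x, of v] by (simp add: section_lift_def)
  then show ?thesis using act_act_inv[OF x frame_in_fibre[OF z]] by simp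
qed

lemma holomorphic_frame: "holomorphic_section E (frame v)"
proof -
  have "bundle_section E (frame v)" using frame_in_fibre by (simp add: bundle_section_def)
  moreover have "has_left_inv_derivative (section_lift E act \<phi> (frame v)) X x
      (- (\<rho> X *v section_lift E act \<phi> (frame v) x))"
    if "X \<in> bb" "x \<in> carrier mob2_cover" for X x
    using has_left_inv_derivative_formula_cocycle[OF rep that section_lift_frame] .
  ultimately show ?thesis using assoc unfolding associated_representation_def by blast
qed

lemma formula_cocycle_bij:
  assumes "x \<in> carrier mob2_cover" "z \<in> bidisc"
  shows "bij ((*v) (formula_cocycle x z))"
proof -
  let ?y = "inv\<^bsub>mob2_cover\<^esub> x"
  note y = mob2.inv_closed[OF assms(1)]
  have z': "mob2_of x z \<in> bidisc" by (rule mob2_of_in_bidisc[OF assms])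
  have zz: "mob2_of ?y (mob2_of x z) = z"
    by (simp only: mob2_of_mult[OF y assms, symmetric] mob2.l_inv[OF assms(1)] mob2_of_one)
  have "formula_cocycle x z ** formula_cocycle ?y (mob2_of x z) = mat 1"
    by (simp only: formula_cocycle_mult[OF y assms, symmetric] mob2.l_inv[OF assms(1)] formula_cocycle_one)
  moreover have "formula_cocycle ?y (mob2_of x z) ** formula_cocycle x z = mat 1"
    using formula_cocycle_mult[OF assms(1) y z']
    by (simp only: zz mob2.r_inv[OF assms(1)] formula_cocycle_one)
  ultimately show ?thesis
    by (intro o_bij[where g = "(*v) (formula_cocycle ?y (mob2_of x z))"])
       (auto simp: fun_eq_iff matrix_vector_mul_assoc)
qed

lemma frame_bij:
  assumes z: "z \<in> bidisc"
  shows "bij_betw (\<lambda>v. frame v z) UNIV (fibre E z)"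
proof -
  have "bij_betw (act (to_point z)) (fibre E (0, 0)) (fibre E z)"
    using act_bij[OF to_point(1)[OF z] zero_in_bidisc] by (simp add: to_point(2))
  from bij_betw_trans[OF bij_betw_trans[OF formula_cocycle_bij[OF to_point(1)[OF z] zero_in_bidisc] fib0(4)] this]
  show ?thesis by (simp add: frame_def o_def)
qed

lemma frame_add: "z \<in> bidisc \<Longrightarrow> frame (u + v) z = badd E (frame u z) (frame v z)"
  unfolding frame_def matrix_vector_right_distrib fib0_add
  by (rule act_add[OF to_point(1) zero_in_bidisc fib0(1) fib0(1)])

lemma frame_scale: "z \<in> bidisc \<Longrightarrow> frame (c *s v) z = bscale E c (frame v z)"
  unfolding frame_def by (simp only: vector_scalar_commute fib0_scale
      act_scale[OF to_point(1) zero_in_bidisc fib0(1)])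

text \<open>The trivialization defined by the frame.\<close>

definition \<psi> :: "'e \<Rightarrow> complex ^ 'n" where
  "\<psi> e = inv_into UNIV (\<lambda>v. frame v (bproj E e)) e"

lemma \<psi>_frame: "z \<in> bidisc \<Longrightarrow> \<psi> (frame v z) = v"
  using frame_in_fibre[of z v] frame_bij[of z]
  by (simp add: \<psi>_def fibre_def bij_betw_def inv_f_f[of "\<lambda>v. frame v z" v])

lemma \<psi>_linear_triv: "linear_triv E bidisc \<psi>"
  unfolding linear_triv_def
proof (intro conjI ballI allI)
  fix z assume z: "z \<in> bidisc"
  have ex: "\<exists>v. e = frame v z" if "e \<in> fibre E z" for e
    using that frame_bij[OF z] by (auto simp: bij_betw_def)
  have \<psi>_inv: "frame (\<psi> e) z = e" if "e \<in> fibre E z" for e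
    using ex[OF that] \<psi>_frame[OF z] by metis
  show "bij_betw \<psi> (fibre E z) UNIV"
    by (rule bij_betw_byWitness[where f' = "\<lambda>v. frame v z"])
       (use \<psi>_inv \<psi>_frame[OF z] frame_in_fibre[OF z] in auto)
  show "\<psi> (badd E u v) = \<psi> u + \<psi> v" if "u \<in> fibre E z" "v \<in> fibre E z" for u v
    using ex[OF that(1)] ex[OF that(2)] \<psi>_frame[OF z] frame_add[OF z] by metis
  show "\<psi> (bscale E c u) = c *s \<psi> u" if "u \<in> fibre E z" for c u
    using ex[OF that] \<psi>_frame[OF z] frame_scale[OF z] by metis
qed (auto simp: open_Times)

lemma from_triv_\<psi>: "z \<in> bidisc \<Longrightarrow> from_triv E \<psi> z v = frame v z"
  using linear_triv_simps(3)[OF \<psi>_linear_triv _ frame_in_fibre] \<psi>_frame by metis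

text \<open>In a local trivialization the frame becomes a holomorphic matrix function, and \<open>\<psi>\<close> is given by the
  inverse matrix.\<close>

lemma \<psi>_triv: "global_holomorphic_triv E \<psi>"
  unfolding holomorphic_triv_def
proof (intro conjI \<psi>_linear_triv, clarify)
  fix V \<eta> assume at: "(V, \<eta>) \<in> batlas E"
  have lt: "linear_triv E V \<eta>"
    using herm at unfolding hermitian_holomorphic_bundle_def holomorphic_bundle_def by blast
  then have V: "open V" "V \<subseteq> bidisc" by (auto simp: linear_triv_def)
  then have VV: "bidisc \<inter> V = V" "V \<inter> bidisc = V" by auto
  have hol: "vec_holomorphic2_on (\<lambda>z. \<eta> (frame v z)) V" for v
    using holomorphic_frame at unfolding holomorphic_section_def by blast
  have "holomorphic_transition E bidisc \<psi> V \<eta>"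
    unfolding holomorphic_transition_def VV
  proof
    fix v
    show "vec_holomorphic2_on (\<lambda>z. \<eta> (from_triv E \<psi> z v)) V"
    proof (rule vec_holomorphic2_on_cong[OF V(1) _ hol[of v]])
      fix z assume "z \<in> V"
      then have "z \<in> bidisc" using V(2) by blast
      then show "\<eta> (frame v z) = \<eta> (from_triv E \<psi> z v)" by (simp only: from_triv_\<psi>)
    qed
  qed
  moreover have "holomorphic_transition E V \<eta> bidisc \<psi>"
    unfolding holomorphic_transition_def VV
  proof
    fix b
    define M where "M z = (\<chi> i j. \<eta> (frame (axis j 1) z) $ i)" for z
    have M: "M z *v v = \<eta> (frame v z)" if "z \<in> V" for z v
    proof -
      have zb: "z \<in> bidisc" using that V by auto
      note f = frame_in_fibre[OF zb]
      note l = linear_triv_simps[OF lt that]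
      have lin: "Vector_Spaces.linear (*s) (*s) (\<lambda>v. \<eta> (frame v z))"
        by unfold_locales (simp_all add: frame_add[OF zb] frame_scale[OF zb] l(6,7) f)
      have "M z = matrix (\<lambda>v. \<eta> (frame v z))" by (simp add: M_def matrix_def)
      then show ?thesis using matrix_works[OF lin] by simp
    qed
    show "vec_holomorphic2_on (\<lambda>z. \<psi> (from_triv E \<eta> z b)) V"
    proof (rule holomorphic2_on_linear_system[where M = M and b = b])
      show "holomorphic2_on (\<lambda>z. M z $ i $ j) V" for i j
        using hol[of "axis j 1"] by (simp add: M_def vec_holomorphic2_on_def)
      fix z assume z: "z \<in> V"
      then have zb: "z \<in> bidisc" using V by auto
      note l = linear_triv_simps[OF lt z]
      have "inj ((*v) (M z))"
      proof (rule injI)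
        fix u v assume "M z *v u = M z *v v"
        then have "frame u z = frame v z"
          using M[OF z] l(5) frame_in_fibre[OF zb] by (metis inj_onD)
        then show "u = v" using \<psi>_frame[OF zb] by metis
      qed
      then obtain N where "N ** M z = mat 1" using matrix_left_invertible_injective by blast
      then show "det (M z) \<noteq> 0" by (metis det_I det_mul mult_zero_right zero_neq_one)
      have "from_triv E \<eta> z b = frame (\<psi> (from_triv E \<eta> z b)) z"
        using from_triv_\<psi>[OF zb] linear_triv_simps(3)[OF \<psi>_linear_triv zb l(1)] by metis
      then show "M z *v \<psi> (from_triv E \<eta> z b) = b"
        using M[OF z] l(2) by metis
    qed (rule V)
  qed
  ultimately show "holomorphic_transition E bidisc \<psi> V \<eta> \<and> holomorphic_transition E V \<eta> bidisc \<psi>" ..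
qed

text \<open>By \<open>act_fib0_formula\<close> the action maps the frame vector of \<open>J\<^sub>\<rho> (x, z) v\<close> at \<open>z\<close> to that of \<open>v\<close>
  at \<open>x z\<close>.\<close>

lemma cocycle_\<psi>:
  assumes x: "x \<in> carrier mob2_cover" and z: "z \<in> bidisc"
  shows "cocycle E act \<psi> x z = formula_cocycle x z"
proof -
  let ?p = "to_point z"
  note p = to_point(1)[OF z]
  have xp: "mob2_of (x \<otimes>\<^bsub>mob2_cover\<^esub> ?p) (0, 0) = mob2_of x z"
    by (simp only: mob2_of_mult[OF x p zero_in_bidisc] to_point(2))
  have "frame v (mob2_of x z) = act x (frame (formula_cocycle x z *v v) z)" for v
  proof -
    have "frame v (mob2_of x z)
        = act (x \<otimes>\<^bsub>mob2_cover\<^esub> ?p) (fib0 (formula_cocycle (x \<otimes>\<^bsub>mob2_cover\<^esub> ?p) (0, 0) *v v))"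
      using act_fib0_formula[OF mob2.m_closed[OF x p]] by (simp only: xp)
    also have "\<dots> = act x (act ?p (fib0 (formula_cocycle ?p (0, 0) *v (formula_cocycle x z *v v))))"
      by (simp only: act_mult[OF x p fib0(1)] formula_cocycle_mult[OF x p zero_in_bidisc] to_point(2)
          matrix_vector_mul_assoc)
    finally show ?thesis by (simp only: frame_def)
  qed
  then have "\<psi> (inv_into (fibre E z) (act x) (from_triv E \<psi> (mob2_of x z) v)) = formula_cocycle x z *v v" for v
    using act_bij[OF x z] frame_in_fibre[OF z] \<psi>_frame[OF z]
    by (simp add: from_triv_\<psi>[OF mob2_of_in_bidisc[OF x z]] bij_betw_inv_into_left)
  then show ?thesis by (simp add: cocycle_def)
qed

end

section \<open>Connectedness in commuting partial permutations\<close>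

text \<open>Paths in the graph of two commuting relations \<open>U\<close> and \<open>V\<close>: steps along \<open>U\<close> can be moved past steps
  along \<open>V\<close>.\<close>

lemma rtrancl_mult_commute:
  assumes "U O V = V O U"
  shows "U\<^sup>* O V = V O U\<^sup>*"
proof (rule subset_antisym; rule subrelI)
  fix a c assume "(a, c) \<in> U\<^sup>* O V"
  then obtain b where "(a, b) \<in> U\<^sup>*" "(b, c) \<in> V" by blast
  then show "(a, c) \<in> V O U\<^sup>*"
  proof (induction arbitrary: c)
    case (step b b')
    then have "(b, c) \<in> V O U" using assms by blast
    then obtain d where "(b, d) \<in> V" "(d, c) \<in> U" by blast
    with step.IH[of d] show ?case by (meson relcomp.cases relcompI rtrancl.rtrancl_into_rtrancl)
  qed blast
next
  fix a c assume "(a, c) \<in> V O U\<^sup>*"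
  then obtain b where "(b, c) \<in> U\<^sup>*" "(a, b) \<in> V" by blast
  then show "(a, c) \<in> U\<^sup>* O V"
  proof (induction)
    case (step c c')
    then obtain d where "(a, d) \<in> U\<^sup>*" "(d, c) \<in> V" by blast
    moreover from this step.hyps have "(d, c') \<in> U O V" using assms by blast
    ultimately show ?case by (meson relcomp.cases relcompI rtrancl.rtrancl_into_rtrancl)
  qed blast
qed

text \<open>Two points are in this relation if they are joined by a path which takes steps along \<open>U\<close> in one
  direction only and steps along \<open>V\<close> in one direction only. If the two directions agree, the steps
  commute and can be sorted; otherwise the path is a zigzag.\<close>

definition monotone_path :: "'a rel \<Rightarrow> 'a rel \<Rightarrow> 'a rel" where
  "monotone_path U V = U\<^sup>* O V\<^sup>* \<union> (U\<inverse>)\<^sup>* O (V\<inverse>)\<^sup>* \<union> (U \<union> V\<inverse>)\<^sup>* \<union> (U\<inverse> \<union> V)\<^sup>*"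

lemma rtrancl_commute:
  assumes "U O V = V O U"
  shows "U\<^sup>* O V\<^sup>* = V\<^sup>* O U\<^sup>*"
  using rtrancl_mult_commute[OF rtrancl_mult_commute[OF assms, symmetric]] by simp

text \<open>A zigzag path followed by a step against its direction in \<open>U\<close> can be shortened: the step
  cancels the last step of the path along \<open>U\<inverse>\<close>, after being moved past the intervening steps
  along \<open>V\<close>. If the path has no step along \<open>U\<inverse>\<close>, the result is a forward path.\<close>

lemma zigzag_step_back:
  assumes comm: "U O V = V O U" and U: "single_valued U"
    and path: "(a, b) \<in> (U\<inverse> \<union> V)\<^sup>*"
  shows "(b, c) \<in> V\<^sup>* O U \<Longrightarrow> (a, c) \<in> (U\<inverse> \<union> V)\<^sup>* \<union> U\<^sup>* O V\<^sup>*"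
  using path
proof (induction arbitrary: c)
  case base
  then have "(a, c) \<in> U O V\<^sup>*"
    using rtrancl_mult_commute[OF comm[symmetric]] by auto
  then show ?case by blast
next
  case (step b b')
  then obtain d where d: "(b', d) \<in> V\<^sup>*" "(d, c) \<in> U" by blast
  show ?case
  proof (cases "(b, b') \<in> V")
    case True
    then have "(b, c) \<in> V\<^sup>* O U" using d by (meson converse_rtrancl_into_rtrancl relcompI)
    then show ?thesis by (rule step.IH)
  next
    case False
    then have bb': "(b', b) \<in> U" using step.hyps by blast
    have "(b', c) \<in> U O V\<^sup>*" using d rtrancl_mult_commute[OF comm[symmetric]] by auto
    then have "(b, c) \<in> V\<^sup>*" using bb' U by (auto dest: single_valuedD)
    then have "(b, c) \<in> (U\<inverse> \<union> V)\<^sup>*" by (meson in_rtrancl_UnI)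
    with step.hyps(1) show ?thesis by (meson UnI1 rtrancl_trans)
  qed
qed


text \<open>A further step along \<open>U\<close> either continues the path or cancels against a step in the opposite
  direction, because \<open>U\<close> and its converse are single valued.\<close>

lemma monotone_path_step:
  assumes comm: "U O V = V O U" and U: "single_valued U" "single_valued (U\<inverse>)"
    and ab: "(a, b) \<in> monotone_path U V" and bc: "(b, c) \<in> U"
  shows "(a, c) \<in> monotone_path U V"
proof -
  from ab consider "(a, b) \<in> U\<^sup>* O V\<^sup>*" | "(a, b) \<in> (U\<inverse>)\<^sup>* O (V\<inverse>)\<^sup>*"
    | "(a, b) \<in> (U \<union> V\<inverse>)\<^sup>*" | "(a, b) \<in> (U\<inverse> \<union> V)\<^sup>*"
    unfolding monotone_path_def by blast
  then show ?thesis
  proof cases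
    case 1
    then obtain d where d: "(a, d) \<in> U\<^sup>*" "(d, c) \<in> V\<^sup>* O U" using bc by blast
    then have "(d, c) \<in> U O V\<^sup>*" using rtrancl_mult_commute[OF comm[symmetric]] by simp
    then have "(a, c) \<in> U\<^sup>* O V\<^sup>*" using d(1) by (meson relcomp.cases relcompI rtrancl.rtrancl_into_rtrancl)
    then show ?thesis by (simp add: monotone_path_def)
  next
    case 2
    have "U\<inverse> O V\<inverse> = V\<inverse> O U\<inverse>" using comm by (metis converse_relcomp)
    then have "(a, b) \<in> (V\<inverse>)\<^sup>* O (U\<inverse>)\<^sup>*" using 2 rtrancl_commute by blast
    then obtain d where d: "(a, d) \<in> (V\<inverse>)\<^sup>*" "(d, b) \<in> (U\<inverse>)\<^sup>*" by blast
    from d(2) show ?thesis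
    proof (cases rule: rtranclE)
      case base
      have "(a, b) \<in> (U \<union> V\<inverse>)\<^sup>*" using d(1) base by (meson in_rtrancl_UnI)
      then have "(a, c) \<in> (U \<union> V\<inverse>)\<^sup>*" using bc by (meson UnI1 rtrancl.rtrancl_into_rtrancl)
      then show ?thesis by (simp add: monotone_path_def)
    next
      case (step e)
      then have "e = c" using bc U by (auto dest: single_valuedD)
      then have "(a, c) \<in> (V\<inverse>)\<^sup>* O (U\<inverse>)\<^sup>*" using d(1) step(1) by blast
      then have "(a, c) \<in> (U\<inverse>)\<^sup>* O (V\<inverse>)\<^sup>*"
        using \<open>U\<inverse> O V\<inverse> = V\<inverse> O U\<inverse>\<close> rtrancl_commute by blast
      then show ?thesis by (simp add: monotone_path_def)
    qed
  next
    case 3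
    then have "(a, c) \<in> (U \<union> V\<inverse>)\<^sup>*" using bc by (meson UnI1 rtrancl.rtrancl_into_rtrancl)
    then show ?thesis by (simp add: monotone_path_def)
  next
    case 4
    then have "(a, c) \<in> (U\<inverse> \<union> V)\<^sup>* \<union> U\<^sup>* O V\<^sup>*"
      using zigzag_step_back[OF comm U(1) 4, of c] bc by blast
    then show ?thesis by (auto simp: monotone_path_def)
  qed
qed

text \<open>Monotone paths are stable under every kind of step: the lemma above covers the steps along \<open>U\<close>, and
  the other three kinds follow by symmetry.\<close>

theorem connected_imp_monotone_path:
  assumes comm: "U O V = V O U"
    and sv: "single_valued U" "single_valued (U\<inverse>)" "single_valued V" "single_valued (V\<inverse>)"
    and conn: "(a, b) \<in> (U \<union> U\<inverse> \<union> V \<union> V\<inverse>)\<^sup>*"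
  shows "(a, b) \<in> monotone_path U V"
  using conn
proof (induction)
  case base
  show ?case by (simp add: monotone_path_def)
next
  case (step b c)
  have comm': "U\<inverse> O V\<inverse> = V\<inverse> O U\<inverse>" using comm by (metis converse_relcomp)
  have inv: "monotone_path (U\<inverse>) (V\<inverse>) = monotone_path U V" for U V :: "'a rel"
    unfolding monotone_path_def converse_converse by (simp only: Un_ac)
  have swap: "monotone_path V U = monotone_path U V"
    unfolding monotone_path_def rtrancl_commute[OF comm, symmetric] rtrancl_commute[OF comm', symmetric]
    by (simp only: Un_ac)
  from step.hyps(2) consider "(b, c) \<in> U" | "(b, c) \<in> U\<inverse>" | "(b, c) \<in> V" | "(b, c) \<in> V\<inverse>" by blast
  then show ?case
  proof cases
    case 1
    with step.IH show ?thesis by (rule monotone_path_step[OF comm sv(1,2)])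
  next
    case 2
    with step.IH show ?thesis
      using monotone_path_step[OF comm', of a b c] sv inv by simp
  next
    case 3
    with step.IH show ?thesis
      using monotone_path_step[OF comm[symmetric] sv(3,4), of a b c] by (simp add: swap)
  next
    case 4
    with step.IH show ?thesis
      using monotone_path_step[OF comm'[symmetric], of a b c] sv inv[of V U] by (simp add: swap)
  qed
qed

text \<open>The situation of the weights of an irreducible bundle: \<open>t\<close> is the position of a weight relative to
  the largest eigenvalues, \<open>U\<close> and \<open>V\<close> are the nonzero matrix entries of \<open>\<rho> (y\<^sub>1)\<close> and \<open>\<rho> (y\<^sub>2)\<close>.\<close>

locale commuting_arrows =
  fixes U V :: "'a rel" and t :: "'a \<Rightarrow> nat \<times> nat"
  assumes U_step: "(a, b) \<in> U \<Longrightarrow> t b = t a + (1, 0)"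
    and V_step: "(a, b) \<in> V \<Longrightarrow> t b = t a + (0, 1)"
    and inj_t: "inj t"
    and comm: "U O V = V O U"
    and connected: "(a, b) \<in> (U \<union> U\<inverse> \<union> V \<union> V\<inverse>)\<^sup>*"
begin

lemma t_inject [simp]: "t a = t b \<longleftrightarrow> a = b"
  using inj_t by (auto dest: injD)

lemma U_path: "(a, b) \<in> U\<^sup>* \<Longrightarrow> fst (t a) \<le> fst (t b) \<and> snd (t a) = snd (t b)"
  by (induction rule: rtrancl_induct) (auto dest: U_step)

lemma V_path: "(a, b) \<in> V\<^sup>* \<Longrightarrow> fst (t a) = fst (t b) \<and> snd (t a) \<le> snd (t b)"
  by (induction rule: rtrancl_induct) (auto dest: V_step)

lemma U_path_intermediate:
  "(a, b) \<in> U\<^sup>* \<Longrightarrow> fst (t a) \<le> k \<Longrightarrow> k \<le> fst (t b) \<Longrightarrow> \<exists>c. (c, b) \<in> U\<^sup>* \<and> fst (t c) = k"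
proof (induction rule: converse_rtrancl_induct)
  case (step a a')
  show ?case
  proof (cases "fst (t a) = k")
    case True
    with step.hyps show ?thesis by (intro exI[of _ a]) (auto intro: converse_rtrancl_into_rtrancl)
  next
    case False
    with step.prems U_step[OF step.hyps(1)] have "fst (t a') \<le> k" by simp
    with step show ?thesis by blast
  qed
qed auto

lemma V_path_intermediate:
  "(a, b) \<in> V\<^sup>* \<Longrightarrow> snd (t a) \<le> k \<Longrightarrow> k \<le> snd (t b) \<Longrightarrow> \<exists>c. (a, c) \<in> V\<^sup>* \<and> snd (t c) = k"
proof (induction rule: rtrancl_induct)
  case (step b b')
  show ?case
  proof (cases "snd (t b') = k")
    case True
    with step.hyps show ?thesis by (intro exI[of _ b']) (auto intro: rtrancl.rtrancl_into_rtrancl)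
  next
    case False
    with step.prems V_step[OF step.hyps(2)] have "k \<le> snd (t b)" by simp
    with step show ?thesis by blast
  qed
qed auto

lemma zigzag_path: "(a, b) \<in> (U \<union> V\<inverse>)\<^sup>* \<Longrightarrow>
    fst (t a) \<le> fst (t b) \<and> snd (t b) \<le> snd (t a) \<and>
    (snd (t b) = snd (t a) \<longrightarrow> (a, b) \<in> U\<^sup>*) \<and> (fst (t b) = fst (t a) \<longrightarrow> (b, a) \<in> V\<^sup>*)"
proof (induction rule: rtrancl_induct)
  case (step b c)
  from step.hyps(2) consider "(b, c) \<in> U" | "(c, b) \<in> V" by blast
  then show ?case
  proof cases
    case 1
    with step.IH U_step[OF this] show ?thesis by (auto intro: rtrancl.rtrancl_into_rtrancl)
  next
    case 2
    with step.IH V_step[OF this] show ?thesis by (auto intro: converse_rtrancl_into_rtrancl)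
  qed
qed simp

text \<open>A monotone path between comparable points takes only forward steps: a zigzag changes the two
  coordinates in opposite directions, so it runs along one axis.\<close>

lemma directed_path:
  assumes "fst (t a) \<le> fst (t b)" "snd (t a) \<le> snd (t b)"
  shows "(a, b) \<in> U\<^sup>* O V\<^sup>*"
proof -
  have sv: "single_valued U" "single_valued (U\<inverse>)" "single_valued V" "single_valued (V\<inverse>)"
    unfolding single_valued_def using U_step V_step
    by (simp_all, metis t_inject, metis add_right_cancel t_inject, metis t_inject, metis add_right_cancel t_inject)
  from connected_imp_monotone_path[OF comm sv connected]
  consider "(a, b) \<in> U\<^sup>* O V\<^sup>*" | "(a, b) \<in> (U\<inverse>)\<^sup>* O (V\<inverse>)\<^sup>*"
    | "(a, b) \<in> (U \<union> V\<inverse>)\<^sup>*" | "(a, b) \<in> (U\<inverse> \<union> V)\<^sup>*"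
    unfolding monotone_path_def by blast
  then show ?thesis
  proof cases
    case 2
    then obtain c where "(c, a) \<in> U\<^sup>*" "(b, c) \<in> V\<^sup>*" by (auto simp: rtrancl_converse)
    then have "t a = t b" using U_path[of c a] V_path[of b c] assms by (simp add: prod_eq_iff)
    then show ?thesis by auto
  next
    case 3
    from zigzag_path[OF this] assms have "(a, b) \<in> U\<^sup>*" by simp
    then show ?thesis by auto
  next
    case 4
    then have "(a, b) \<in> ((U \<union> V\<inverse>)\<inverse>)\<^sup>*" by (simp add: converse_Un)
    then have "(b, a) \<in> (U \<union> V\<inverse>)\<^sup>*" by (simp only: rtrancl_converse converse_iff)
    from zigzag_path[OF this] assms have "(a, b) \<in> V\<^sup>*" by simp
    then show ?thesis by auto
  qed
qed

lemma adjacent_U: "t b = t a + (1, 0) \<Longrightarrow> (a, b) \<in> U"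
proof -
  assume t: "t b = t a + (1, 0)"
  have ft: "fst (t b) = fst (t a) + 1" "snd (t b) = snd (t a)" unfolding t by simp_all
  then obtain c where c: "(a, c) \<in> U\<^sup>*" "(c, b) \<in> V\<^sup>*"
    using directed_path[of a b] by auto
  then have "t c = t b" using U_path[OF c(1)] V_path[OF c(2)] ft by (simp add: prod_eq_iff)
  with c(1) have "(a, b) \<in> U\<^sup>*" by simp
  then show ?thesis
  proof (cases rule: converse_rtranclE)
    case base
    from ft[unfolded base] show ?thesis by linarith
  next
    case (step a')
    have "t a' = t b" using U_step[OF step(1)] t by (rule trans[OF _ sym])
    with step(1) show ?thesis by simp
  qed
qed

lemma adjacent_V: "t b = t a + (0, 1) \<Longrightarrow> (a, b) \<in> V"
proof -
  assume t: "t b = t a + (0, 1)"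
  have ft: "fst (t b) = fst (t a)" "snd (t b) = snd (t a) + 1" unfolding t by simp_all
  then obtain c where c: "(a, c) \<in> U\<^sup>*" "(c, b) \<in> V\<^sup>*"
    using directed_path[of a b] by auto
  then have "t c = t a" using U_path[OF c(1)] V_path[OF c(2)] ft by (simp add: prod_eq_iff)
  with c(2) have "(a, b) \<in> V\<^sup>*" by simp
  then show ?thesis
  proof (cases rule: converse_rtranclE)
    case base
    from ft[unfolded base] show ?thesis by linarith
  next
    case (step a')
    have "t a' = t b" using V_step[OF step(1)] t by (rule trans[OF _ sym])
    with step(1) show ?thesis by simp
  qed
qed

text \<open>A forward path can be rearranged, because the two kinds of steps commute, to pass through any
  given point of the rectangle that it spans.\<close>

lemma convex:
  assumes "(i, k) \<in> range t" "(i', k') \<in> range t" "i \<le> p" "p \<le> i'" "k \<le> q" "q \<le> k'"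
  shows "(p, q) \<in> range t"
proof -
  obtain a b where ab: "t a = (i, k)" "t b = (i', k')" using assms by auto
  then obtain c where c: "(a, c) \<in> U\<^sup>*" "(c, b) \<in> V\<^sup>*" using directed_path[of a b] assms by auto
  have "fst (t c) = i'" "snd (t c) = k" using U_path[OF c(1)] V_path[OF c(2)] ab by auto
  then obtain d where d: "(d, c) \<in> U\<^sup>*" "fst (t d) = p"
    using U_path_intermediate[OF c(1), of p] ab assms by auto
  have "(d, b) \<in> V\<^sup>* O U\<^sup>*" using d(1) c(2) rtrancl_commute[OF comm] by blast
  then obtain e where e: "(d, e) \<in> V\<^sup>*" "(e, b) \<in> U\<^sup>*" by blast
  have "snd (t d) = k" using U_path[OF d(1)] \<open>snd (t c) = k\<close> by simp
  moreover have "snd (t e) = k'" using U_path[OF e(2)] ab by simp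
  ultimately obtain f where f: "(d, f) \<in> V\<^sup>*" "snd (t f) = q"
    using V_path_intermediate[OF e(1), of q] assms by auto
  have "t f = (p, q)" using V_path[OF f(1)] f d by (simp add: prod_eq_iff)
  then show ?thesis by (metis rangeI)
qed

lemma rows_contiguous:
  assumes "(0, k) \<in> range t" "(i', k') \<in> range t" "i \<le> i'"
  shows "\<exists>q. (i, q) \<in> range t"
proof -
  obtain a b where ab: "t a = (0, k)" "t b = (i', k')" using assms by auto
  have "\<And>i. i \<le> fst (t b) \<Longrightarrow> \<exists>c. fst (t c) = i"
    using connected[of a b]
  proof (induction rule: rtrancl_induct)
    case base
    then have "fst (t a) = i" using ab by simp
    then show ?case by blast
  next
    case (step b c)
    have "fst (t c) \<le> Suc (fst (t b))"
      using step.hyps(2) by (auto dest: U_step V_step)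
    with step.prems step.IH[of i] show ?case by (metis le_Suc_eq order_trans)
  qed
  then show ?thesis using ab assms by (metis fst_conv prod.collapse rangeI)
qed

text \<open>By convexity each row is an interval. If one of its ends lay strictly before the corresponding end
  of a later row, convexity would put a point outside one of these rows.\<close>

theorem range_is_staircase:
  assumes "finite (UNIV :: 'a set)" "(0, k0) \<in> range t"
  shows "\<exists>s m j. range t = staircase s m j \<and>
    (\<forall>i\<le>s. card {a. fst (t a) = i} = m i + 1) \<and>
    (\<forall>i i'. i \<le> i' \<and> i' \<le> s \<longrightarrow> j i' \<le> j i \<and> j i' + m i' \<le> j i + m i)"
proof -
  define s where "s = Max (fst ` range t)"
  define R where "R i = {q. (i, q) \<in> range t}" for i
  define j where "j i = Min (R i)" for i
  define m where "m i = Max (R i) - j i" for i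
  have fin: "finite (range t)" using assms by simp
  have finR: "finite (R i)" for i
  proof (rule finite_subset)
    show "R i \<subseteq> snd ` range t"
      unfolding R_def by (rule subsetI) (metis image_eqI mem_Collect_eq snd_conv)
    show "finite (snd ` range t)" using fin by (rule finite_imageI)
  qed
  have "s \<in> fst ` range t" unfolding s_def using fin by (intro Max_in) auto
  then obtain k' where k': "(s, k') \<in> range t" by (metis imageE prod.collapse)
  have ne: "R i \<noteq> {}" if "i \<le> s" for i
    using rows_contiguous[OF assms(2) k' that] by (auto simp: R_def)
  have row: "R i = {j i..j i + m i}" if "i \<le> s" for i
  proof -
    have "j i \<le> Max (R i)" unfolding j_def using finR ne[OF that] by simp
    then have jm: "j i + m i = Max (R i)" by (simp add: m_def)
    have in_R: "j i \<in> R i" "j i + m i \<in> R i"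
      unfolding jm using finR ne[OF that] by (auto simp: j_def)
    show ?thesis
    proof
      show "R i \<subseteq> {j i..j i + m i}" unfolding jm using finR by (auto simp: j_def)
      show "{j i..j i + m i} \<subseteq> R i"
        using in_R convex[of i "j i" i "j i + m i" i] by (auto simp: R_def)
    qed
  qed
  have st: "range t = staircase s m j"
  proof (rule Set.set_eqI)
    fix x :: "nat \<times> nat"
    obtain i q where x: "x = (i, q)" by (cases x)
    have le: "i \<le> s" if "(i, q) \<in> range t"
    proof -
      have "fst (i, q) \<in> fst ` range t" using that by (rule imageI)
      then show ?thesis unfolding s_def using fin by (metis Max_ge finite_imageI fst_conv)
    qed
    have "x \<in> range t \<longleftrightarrow> i \<le> s \<and> q \<in> R i" using le by (auto simp: R_def x)
    also have "\<dots> \<longleftrightarrow> i \<le> s \<and> (\<exists>k\<le>m i. q = j i + k)"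
    proof (cases "i \<le> s")
      case True
      have "q \<in> R i \<longleftrightarrow> j i \<le> q \<and> q \<le> j i + m i" unfolding row[OF True] by (rule atLeastAtMost_iff)
      also have "\<dots> \<longleftrightarrow> (\<exists>k\<le>m i. q = j i + k)" by presburger
      finally show ?thesis using True by blast
    qed blast
    also have "\<dots> \<longleftrightarrow> x \<in> staircase s m j" by (auto simp: staircase_def x)
    finally show "x \<in> range t \<longleftrightarrow> x \<in> staircase s m j" .
  qed
  have crd: "card {a. fst (t a) = i} = m i + 1" if "i \<le> s" for i
  proof -
    have "bij_betw (\<lambda>a. snd (t a)) {a. fst (t a) = i} (R i)"
      unfolding bij_betw_def
    proof
      show "inj_on (\<lambda>a. snd (t a)) {a. fst (t a) = i}"
        by (rule inj_onI) (metis mem_Collect_eq prod.expand t_inject)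
      show "(\<lambda>a. snd (t a)) ` {a. fst (t a) = i} = R i"
      proof (rule Set.set_eqI)
        fix q
        have "q \<in> R i \<longleftrightarrow> (\<exists>a. t a = (i, q))"
          unfolding R_def by (metis mem_Collect_eq rangeE rangeI)
        then show "q \<in> (\<lambda>a. snd (t a)) ` {a. fst (t a) = i} \<longleftrightarrow> q \<in> R i"
          by (auto simp: image_iff prod_eq_iff)
      qed
    qed
    then have "card {a. fst (t a) = i} = card (R i)" by (rule bij_betw_same_card)
    then show ?thesis using row[OF that] by simp
  qed
  have mon: "j i' \<le> j i \<and> j i' + m i' \<le> j i + m i" if i: "i \<le> i'" "i' \<le> s" for i i'
  proof -
    have r: "R i = {j i..j i + m i}" "R i' = {j i'..j i' + m i'}" using row i by auto
    then have mem: "(i, j i) \<in> range t" "(i', j i') \<in> range t"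
      "(i, j i + m i) \<in> range t" "(i', j i' + m i') \<in> range t"
      unfolding R_def by (auto simp: set_eq_iff)
    have "j i' \<le> j i"
    proof (rule ccontr)
      assume "\<not> j i' \<le> j i"
      then have "(i', j i) \<in> range t" using convex[OF mem(1,2), of i' "j i"] i by simp
      then have "j i \<in> R i'" by (simp add: R_def)
      with \<open>\<not> j i' \<le> j i\<close> show False unfolding r by simp
    qed
    moreover have "j i' + m i' \<le> j i + m i"
    proof (rule ccontr)
      assume "\<not> j i' + m i' \<le> j i + m i"
      then have "(i, j i' + m i') \<in> range t" using convex[OF mem(3,4), of i "j i' + m i'"] i by simp
      then have "j i' + m i' \<in> R i" by (simp add: R_def)
      with \<open>\<not> j i' + m i' \<le> j i + m i\<close> show False unfolding r by simp
    qed
    ultimately show ?thesis ..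
  qed
  have "\<forall>i\<le>s. card {a. fst (t a) = i} = m i + 1"
    by (intro allI impI crd)
  moreover have "\<forall>i i'. i \<le> i' \<and> i' \<le> s \<longrightarrow> j i' \<le> j i \<and> j i' + m i' \<le> j i + m i"
    by (intro allI impI mon) (erule conjunct1, erule conjunct2)
  ultimately have "range t = staircase s m j \<and> (\<forall>i\<le>s. card {a. fst (t a) = i} = m i + 1) \<and>
      (\<forall>i i'. i \<le> i' \<and> i' \<le> s \<longrightarrow> j i' \<le> j i \<and> j i' + m i' \<le> j i + m i)"
    using st by (intro conjI)
  then show ?thesis by (intro exI)
qed

end

section \<open>Irreducibility and orthogonality of the weight vectors\<close>

text \<open>Block triangular matrices are closed under products and limits.\<close>

lemma mat_exp_block:
  fixes M :: "complex ^ 'n ^ 'n"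
  assumes M: "\<And>i j. j \<in> I \<Longrightarrow> i \<notin> I \<Longrightarrow> M $ i $ j = 0" and ij: "j \<in> I" "i \<notin> I"
  shows "mat_exp M $ i $ j = 0"
proof -
  have "mat_pow M k $ i $ j = 0" if "j \<in> I" "i \<notin> I" for k i j
    using that
  proof (induction k arbitrary: i j)
    case 0
    then show ?case by (auto simp: mat_def)
  next
    case (Suc k)
    have z: "M $ i $ l * mat_pow M k $ l $ j = 0" for l
      using M[of l i] Suc.IH[of j l] Suc.prems by (cases "l \<in> I") auto
    show ?case by (simp only: mat_pow.simps matrix_matrix_mult_def vec_lambda_beta z sum.neutral_const)
  qed
  then have "(\<lambda>k. 0) sums (mat_exp M $ i $ j)" using exp_entry_sums[of M i j] ij by simp
  then show ?thesis using sums_0 sums_unique2 by blast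
qed

lemma block_mult_vector:
  fixes M :: "complex ^ 'n ^ 'n"
  assumes "\<And>i j. j \<in> I \<Longrightarrow> i \<notin> I \<Longrightarrow> M $ i $ j = 0" "\<And>i. i \<notin> I \<Longrightarrow> v $ i = 0" "i \<notin> I"
  shows "(M *v v) $ i = 0"
proof -
  have z: "M $ i $ l * v $ l = 0" for l using assms by (cases "l \<in> I") auto
  show ?thesis by (simp only: matrix_vector_mult_def vec_lambda_beta z sum.neutral_const)
qed

context weight_bundle
begin

definition herm0 :: "complex ^ 'n \<Rightarrow> complex ^ 'n \<Rightarrow> complex" where
  "herm0 u v = bherm E (fib0 u) (fib0 v)"

lemma herm0_simps:
  "herm0 (u + v) w = herm0 u w + herm0 v w" "herm0 (c *s u) w = c * herm0 u w"
  "herm0 v u = cnj (herm0 u v)" "u \<noteq> 0 \<Longrightarrow> 0 < Re (herm0 u u)"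
proof -
  note h = herm[unfolded hermitian_holomorphic_bundle_def, THEN conjunct2, THEN conjunct1, rule_format, OF zero_in_bidisc]
  show "herm0 (u + v) w = herm0 u w + herm0 v w"
    unfolding herm0_def fib0_add using h[OF fib0(1)[of u] fib0(1)[of v]] fib0(1)[of w] by blast
  show "herm0 (c *s u) w = c * herm0 u w"
    unfolding herm0_def fib0_scale using h[OF fib0(1)[of u] fib0(1)[of w]] by blast
  show "herm0 v u = cnj (herm0 u v)"
    unfolding herm0_def using h[OF fib0(1)[of u] fib0(1)[of v]] by blast
  assume "u \<noteq> 0"
  have "fib0 u \<noteq> bscale E 0 (fib0 u)"
  proof
    assume "fib0 u = bscale E 0 (fib0 u)"
    then have "fib0 u = fib0 (0 *s u)" by (simp only: fib0_scale)
    then have "\<phi> (fib0 u) = \<phi> (fib0 (0 *s u))" by (rule arg_cong)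
    then show False using \<open>u \<noteq> 0\<close> by (simp add: fib0(2))
  qed
  then show "0 < Re (herm0 u u)"
    unfolding herm0_def using h[OF fib0(1)[of u] fib0(1)[of u]] by blast
qed

lemma herm0_scale_right: "herm0 u (c *s v) = cnj c * herm0 u v"
  using herm0_simps(2)[of c v u] herm0_simps(3)[of u v] herm0_simps(3)[of u "c *s v"] by simp

lemma herm0_torus: "herm0 (torus s t u) (torus s t v) = herm0 u v"
  unfolding herm0_def fib0_torus by (rule act_herm[OF torus_carrier zero_in_bidisc fib0(1) fib0(1)])

lemma herm0_axis:
  "herm0 (axis i 1) (axis j 1) = exp (\<i> * (of_real s * w1 i + of_real t * w2 i)) *
     cnj (exp (\<i> * (of_real s * w1 j + of_real t * w2 j))) * herm0 (axis i 1) (axis j 1)"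
  using herm0_torus[of s t "axis i 1" "axis j 1", symmetric]
  unfolding torus_axis herm0_simps(2) herm0_scale_right by (simp only: mult_ac)

text \<open>The stabilizer acts on a weight vector by \<open>exp (\<i> (s w\<^sub>1 + t w\<^sub>2))\<close>, which has modulus one as the
  action is unitary.\<close>

lemma weights_real: "w1 i \<in> \<real>" "w2 i \<in> \<real>"
proof -
  have nz: "herm0 (axis i 1) (axis i 1) \<noteq> 0"
    using herm0_simps(4)[of "axis i 1"] by auto
  have *: "Im w = 0" if "exp (\<i> * w) * cnj (exp (\<i> * w)) = 1" for w
  proof -
    have "complex_of_real ((cmod (exp (\<i> * w)))\<^sup>2) = of_real 1"
      unfolding complex_norm_square that by simp
    then have "(cmod (exp (\<i> * w)))\<^sup>2 = 1" by (rule of_real_eq_iff[THEN iffD1])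
    then have "cmod (exp (\<i> * w)) = 1"
      using norm_ge_zero[of "exp (\<i> * w)"] unfolding power2_eq_1_iff by linarith
    then show ?thesis by simp
  qed
  show "w1 i \<in> \<real>" using herm0_axis[of i i 1 0] nz *[of "w1 i"] by (simp add: complex_is_Real_iff)
  show "w2 i \<in> \<real>" using herm0_axis[of i i 0 1] nz *[of "w2 i"] by (simp add: complex_is_Real_iff)
qed

lemma herm0_axis_orthogonal:
  assumes "(w1 i, w2 i) \<noteq> (w1 j, w2 j)"
  shows "herm0 (axis i 1) (axis j 1) = 0"
proof -
  obtain a b c d where w: "w1 i = of_real a" "w2 i = of_real b" "w1 j = of_real c" "w2 j = of_real d"
    using weights_real[of i] weights_real[of j] by (auto elim!: Reals_cases)
  have H: "herm0 (axis i 1) (axis j 1) = exp (\<i> * of_real (s * (a - c) + t * (b - d))) * herm0 (axis i 1) (axis j 1)" for s t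
  proof -
    have "exp (\<i> * (of_real s * of_real a + of_real t * of_real b)) *
        cnj (exp (\<i> * (of_real s * of_real c + of_real t * of_real d)))
      = exp (\<i> * of_real (s * (a - c) + t * (b - d)))"
      unfolding exp_cnj exp_add[symmetric] by (rule arg_cong[where f = exp]) (simp add: algebra_simps)
    then show ?thesis using herm0_axis[of i j s t] unfolding w by simp
  qed
  \<comment> \<open>For a pair of distinct weights choose \<open>s\<close> or \<open>t\<close> such that the factor is \<open>- 1\<close>.\<close>
  have minus: "exp (\<i> * of_real pi) = - 1" by simp
  from assms w consider "a \<noteq> c" | "b \<noteq> d" by auto
  then show ?thesis
  proof cases
    case 1
    then have "pi / (a - c) * (a - c) + 0 * (b - d) = pi" by simp
    with H[of "pi / (a - c)" 0] show ?thesis by (simp only: minus) simp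
  next
    case 2
    then have "0 * (a - c) + pi / (b - d) * (b - d) = pi" by simp
    with H[of 0 "pi / (b - d)"] show ?thesis by (simp only: minus) simp
  qed
qed

end

text \<open>Distinctness of the joint weights is the condition that the representation is multiplicity-free.\<close>

locale irreducible_weight_bundle = weight_bundle E act \<phi> \<rho> w1 w2
  for E :: "('e, 'n::finite) hbundle" and act :: "mob2 \<Rightarrow> 'e \<Rightarrow> 'e"
    and \<phi> :: "'e \<Rightarrow> complex ^ 'n" and \<rho> :: "mat22 \<times> mat22 \<Rightarrow> complex ^ 'n ^ 'n"
    and w1 w2 :: "'n \<Rightarrow> complex" +
  assumes irr: "irreducible_bundle E" and distinct: "inj (\<lambda>i. (w1 i, w2 i))"
begin

lemma herm0_disjoint_support:
  assumes u: "\<And>i. i \<notin> I \<Longrightarrow> u $ i = 0" and v: "\<And>i. i \<in> I \<Longrightarrow> v $ i = 0"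
  shows "herm0 u v = 0"
proof -
  have sum: "herm0 (\<Sum>i\<in>A. c i *s axis i 1) w = (\<Sum>i\<in>A. c i * herm0 (axis i 1) w)" for A c w
    using herm0_simps(2)[of 0 0 w]
    by (induction A rule: infinite_finite_induct) (simp_all add: herm0_simps(1,2))
  have e: "herm0 u v = (\<Sum>i\<in>UNIV. u $ i * herm0 (axis i 1) v)" for u v
    using sum[of "\<lambda>i. u $ i" UNIV v] by (simp add: basis_expansion)
  have z: "u $ i * herm0 (axis i 1) v = 0" for i
  proof (cases "i \<in> I")
    case True
    have z: "v $ j * herm0 (axis j 1) (axis i 1) = 0" for j
    proof (cases "j \<in> I")
      case False
      with True have "i \<noteq> j" by auto
      then have "(w1 j, w2 j) \<noteq> (w1 i, w2 i)" using injD[OF distinct, of j i] by auto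
      from herm0_axis_orthogonal[OF this] show ?thesis by simp
    qed (simp add: v)
    have "herm0 v (axis i 1) = 0" unfolding e[of v] by (simp only: z sum.neutral_const)
    then show ?thesis using herm0_simps(3)[of "axis i 1" v] by simp
  qed (simp add: u)
  show ?thesis unfolding e[of u v] by (simp only: z sum.neutral_const)
qed

text \<open>The coordinate subspaces with support \<open>I\<close> and \<open>- I\<close> are orthogonal, and they are
  invariant under \<open>\<rho>\<close>, hence under the cocycle. In the trivialization \<open>\<psi>\<close> they are therefore the fibres
  of two subbundles that are orthogonal at every point, because the group acts by isometries.\<close>

lemma no_splitting:
  assumes split: "\<And>i j. \<rho> y1 $ i $ j \<noteq> 0 \<or> \<rho> y2 $ i $ j \<noteq> 0 \<Longrightarrow> i \<in> I \<longleftrightarrow> j \<in> I"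
  shows "I = {} \<or> I = UNIV"
proof (rule ccontr)
  assume I: "\<not> (I = {} \<or> I = UNIV)"
  define W where "W A z = {e \<in> fibre E z. \<forall>i. i \<notin> A \<longrightarrow> \<psi> e $ i = 0}" for A z
  have proper: "proper_subbundle E (W A)" if "A \<noteq> UNIV" for A
  proof -
    have "holomorphic_subbundle E (W A)"
      unfolding holomorphic_subbundle_def
    proof
      fix z0 :: "complex \<times> complex" assume z0: "z0 \<in> bidisc"
      show "\<exists>U \<phi> I. z0 \<in> U \<and> holomorphic_triv E U \<phi> \<and>
          (\<forall>z\<in>U. W A z = {e \<in> fibre E z. \<forall>i. i \<notin> I \<longrightarrow> \<phi> e $ i = 0})"
        by (rule exI[of _ bidisc], rule exI[of _ \<psi>], rule exI[of _ A]) (intro conjI ballI z0 \<psi>_triv, simp only: W_def)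
    qed
    moreover obtain k where k: "k \<notin> A" using \<open>A \<noteq> UNIV\<close> by auto
    have "frame (axis k 1) (0, 0) \<notin> W A (0, 0)"
      unfolding W_def mem_Collect_eq \<psi>_frame[OF zero_in_bidisc] using k by (metis axis_nth zero_neq_one)
    then have "\<exists>z\<in>bidisc. W A z \<noteq> fibre E z"
      using frame_in_fibre[OF zero_in_bidisc, of "axis k 1"] zero_in_bidisc by (intro bexI[of _ "(0, 0)"]) blast+
    ultimately show ?thesis by (simp add: proper_subbundle_def)
  qed
  have block: "(formula_cocycle x z *v v) $ i = 0"
    if A: "A = I \<or> A = - I" and v: "\<And>i. i \<notin> A \<Longrightarrow> v $ i = 0" and i: "i \<notin> A" for A x z v i
  proof -
    have Y: "\<rho> y1 $ i $ j = 0 \<and> \<rho> y2 $ i $ j = 0" if "j \<in> A" "i \<notin> A" for i j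
      using split[of i j] A that by blast
    have y: "y_exp a b $ i $ j = 0" if "j \<in> A" "i \<notin> A" for a b i j
      unfolding y_exp_def by (rule mat_exp_block[OF _ that]) (simp add: Y)
    have h: "h_exp a b $ i $ j = 0" if "j \<in> A" "i \<notin> A" for a b i j
      unfolding h_exp_def by (rule mat_exp_block[OF _ that]) (auto simp: weights diag_mat_def)
    show ?thesis
      unfolding formula_cocycle_def matrix_vector_mul_assoc[symmetric]
      by (intro block_mult_vector[where I = A] y h v i)
  qed
  have "orthogonal_direct_sum E (W I) (W (- I))"
    unfolding orthogonal_direct_sum_def
  proof (intro ballI conjI)
    fix z :: "complex \<times> complex" assume z: "z \<in> bidisc"
    have ex: "e = frame (\<psi> e) z" if "e \<in> fibre E z" for e
      using from_triv_\<psi>[OF z] linear_triv_simps(3)[OF \<psi>_linear_triv z that] by metis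
    show "bherm E u v = 0" if "u \<in> W I z" "v \<in> W (- I) z" for u v
    proof -
      let ?J = "\<lambda>v. formula_cocycle (to_point z) (0, 0) *v v"
      have "bherm E u v = bherm E (frame (\<psi> u) z) (frame (\<psi> v) z)"
        using ex that by (simp add: W_def)
      also have "\<dots> = herm0 (?J (\<psi> u)) (?J (\<psi> v))"
        unfolding frame_def herm0_def by (rule act_herm[OF to_point(1)[OF z] zero_in_bidisc fib0(1) fib0(1)])
      also have "\<dots> = 0"
      proof (rule herm0_disjoint_support[of I])
        show "?J (\<psi> u) $ i = 0" if "i \<notin> I" for i
          by (rule block[of I]) (use that \<open>u \<in> W I z\<close> in \<open>simp_all add: W_def\<close>)
        show "?J (\<psi> v) $ i = 0" if "i \<in> I" for i
          by (rule block[of "- I"]) (use that \<open>v \<in> W (- I) z\<close> in \<open>simp_all add: W_def\<close>)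
      qed
      finally show ?thesis .
    qed
    show "fibre E z = {badd E u v | u v. u \<in> W I z \<and> v \<in> W (- I) z}"
    proof
      show "{badd E u v | u v. u \<in> W I z \<and> v \<in> W (- I) z} \<subseteq> fibre E z"
        using add_in_fibre[OF z] by (auto simp: W_def)
      show "fibre E z \<subseteq> {badd E u v | u v. u \<in> W I z \<and> v \<in> W (- I) z}"
      proof
        fix e assume e: "e \<in> fibre E z"
        define u v where "u = (\<chi> i. if i \<in> I then \<psi> e $ i else 0)" and "v = (\<chi> i. if i \<in> I then 0 else \<psi> e $ i)"
        have "\<psi> e = u + v" by (simp add: u_def v_def vec_eq_iff)
        then have "e = badd E (frame u z) (frame v z)" using ex[OF e] frame_add[OF z] by metis
        moreover have "frame u z \<in> W I z" "frame v z \<in> W (- I) z"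
          by (simp_all add: W_def frame_in_fibre[OF z] \<psi>_frame[OF z] u_def v_def)
        ultimately show "e \<in> {badd E u v | u v. u \<in> W I z \<and> v \<in> W (- I) z}" by blast
      qed
    qed
  qed
  moreover have "proper_subbundle E (W I)" "proper_subbundle E (W (- I))"
    by (rule proper, use I in blast)+
  ultimately show False using irr unfolding irreducible_bundle_def by blast
qed

lemma y_grading:
  "\<rho> y1 $ i $ j \<noteq> 0 \<Longrightarrow> w1 i = w1 j - 1 \<and> w2 i = w2 j"
  "\<rho> y2 $ i $ j \<noteq> 0 \<Longrightarrow> w1 i = w1 j \<and> w2 i = w2 j - 1"
proof -
  have h: "(\<rho> h1 ** M) $ i $ j = w1 i * M $ i $ j" "(M ** \<rho> h1) $ i $ j = M $ i $ j * w1 j"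
    "(\<rho> h2 ** M) $ i $ j = w2 i * M $ i $ j" "(M ** \<rho> h2) $ i $ j = M $ i $ j * w2 j" for M
    by (simp_all add: weights diag_mat_mult)
  have e1: "w1 i * \<rho> y1 $ i $ j = \<rho> y1 $ i $ j * w1 j - \<rho> y1 $ i $ j"
    by (simp only: h[symmetric] HY11 vector_minus_component)
  have e2: "w2 i * \<rho> y1 $ i $ j = \<rho> y1 $ i $ j * w2 j"
    by (simp only: h[symmetric] HY21)
  have e3: "w1 i * \<rho> y2 $ i $ j = \<rho> y2 $ i $ j * w1 j"
    by (simp only: h[symmetric] HY12)
  have e4: "w2 i * \<rho> y2 $ i $ j = \<rho> y2 $ i $ j * w2 j - \<rho> y2 $ i $ j"
    by (simp only: h[symmetric] HY22 vector_minus_component)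
  show "\<rho> y1 $ i $ j \<noteq> 0 \<Longrightarrow> w1 i = w1 j - 1 \<and> w2 i = w2 j"
  proof -
    assume nz: "\<rho> y1 $ i $ j \<noteq> 0"
    have "w1 i * \<rho> y1 $ i $ j = (w1 j - 1) * \<rho> y1 $ i $ j" "w2 i * \<rho> y1 $ i $ j = w2 j * \<rho> y1 $ i $ j"
      unfolding e1 e2 by (simp_all add: algebra_simps)
    with nz show ?thesis by (metis mult_right_cancel)
  qed
  show "\<rho> y2 $ i $ j \<noteq> 0 \<Longrightarrow> w1 i = w1 j \<and> w2 i = w2 j - 1"
  proof -
    assume nz: "\<rho> y2 $ i $ j \<noteq> 0"
    have "w1 i * \<rho> y2 $ i $ j = w1 j * \<rho> y2 $ i $ j" "w2 i * \<rho> y2 $ i $ j = (w2 j - 1) * \<rho> y2 $ i $ j"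
      unfolding e3 e4 by (simp_all add: algebra_simps)
    with nz show ?thesis by (metis mult_right_cancel)
  qed
qed

lemma weight_eqD: "w1 i = w1 j \<Longrightarrow> w2 i = w2 j \<Longrightarrow> i = j"
  using injD[OF distinct, of i j] by simp

text \<open>As the weights are distinct, \<open>\<rho> (Y)\<close> has at most one nonzero entry in each column.\<close>

lemma y_axis:
  assumes "Y = y1 \<or> Y = y2" "\<rho> Y $ k $ j \<noteq> 0"
  shows "\<rho> Y *v axis j 1 = (\<rho> Y $ k $ j) *s axis k 1"
proof -
  have "\<rho> Y $ i $ j = 0" if "i \<noteq> k" for i
  proof (rule ccontr)
    assume nz: "\<rho> Y $ i $ j \<noteq> 0"
    from assms(1) have "w1 i = w1 k \<and> w2 i = w2 k"
    proof
      assume "Y = y1"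
      with nz assms(2) show ?thesis using y_grading(1)[of i j] y_grading(1)[of k j] by simp
    next
      assume "Y = y2"
      with nz assms(2) show ?thesis using y_grading(2)[of i j] y_grading(2)[of k j] by simp
    qed
    with that show False using weight_eqD by blast
  qed
  then show ?thesis
    by (auto simp: matrix_vector_mult_def vec_eq_iff axis_def if_distrib cong: if_cong)
qed

text \<open>Invariant complementary subspaces are sums of weight spaces, because these are one dimensional; so
  a decomposition splits the set of weights as in \<open>no_splitting\<close>.\<close>

theorem indecomposable_\<rho>: "indecomposable \<rho>"
  unfolding indecomposable_def
proof
  assume "\<exists>W W'. invariant_subspace \<rho> W \<and> invariant_subspace \<rho> W' \<and> W \<noteq> {0} \<and> W' \<noteq> {0} \<and>
    W \<inter> W' = {0} \<and> {u + v | u v. u \<in> W \<and> v \<in> W'} = UNIV"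
  then obtain W W' where W: "invariant_subspace \<rho> W" "invariant_subspace \<rho> W'" "W \<noteq> {0}" "W' \<noteq> {0}"
    "W \<inter> W' = {0}" "{u + v | u v. u \<in> W \<and> v \<in> W'} = UNIV" by blast
  have sub: "vec.subspace W" "vec.subspace W'" using W by (auto simp: invariant_subspace_def)
  have inv: "\<rho> X *v u \<in> W" if "u \<in> W" "X \<in> {h1, h2, y1, y2}" for u X
  proof -
    have "X \<in> bb" using that(2) basis_in_bb by (metis empty_iff insert_iff)
    with W(1) that(1) show ?thesis unfolding invariant_subspace_def by blast
  qed
  have inv': "\<rho> X *v u \<in> W'" if "u \<in> W'" "X \<in> {h1, h2, y1, y2}" for u X
  proof -
    have "X \<in> bb" using that(2) basis_in_bb by (metis empty_iff insert_iff)
    with W(2) that(1) show ?thesis unfolding invariant_subspace_def by blast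
  qed
  define I where "I = {i. axis i 1 \<in> W}"
  \<comment> \<open>The two components of an eigenvector are eigenvectors or zero: the difference below lies in
    \<open>W \<inter> W'\<close>.\<close>
  have eig: "\<rho> X *v u = c *s u \<and> \<rho> X *v v = c *s v"
    if uv: "u \<in> W" "v \<in> W'" and X: "X \<in> {h1, h2}" and c: "\<rho> X *v (u + v) = c *s (u + v)" for u v X c
  proof -
    have "\<rho> X *v u - c *s u \<in> W" using sub(1) inv[OF uv(1), of X] uv(1) X
      by (auto intro: vec.subspace_diff vec.subspace_scale)
    moreover have "c *s v - \<rho> X *v v \<in> W'" using sub(2) inv'[OF uv(2), of X] uv(2) X
      by (auto intro: vec.subspace_diff vec.subspace_scale)
    moreover have "\<rho> X *v u - c *s u = c *s v - \<rho> X *v v"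
      using c by (simp add: matrix_vector_right_distrib vector_add_ldistrib algebra_simps)
    ultimately have "\<rho> X *v u - c *s u = 0 \<and> c *s v - \<rho> X *v v = 0" using W(5) by (metis IntI singletonD)
    then show ?thesis by simp
  qed
  have axis_mem: "axis i 1 \<in> W'" if "i \<notin> I" for i
  proof -
    obtain u v where uv: "axis i 1 = u + v" "u \<in> W" "v \<in> W'" using W(6) by blast
    have "\<rho> h1 *v u = w1 i *s u" "\<rho> h2 *v u = w2 i *s u"
      using eig[OF uv(2,3), of h1 "w1 i"] eig[OF uv(2,3), of h2 "w2 i"] uv(1)[symmetric]
      by (simp_all add: weights diag_mat_axis)
    then have "w1 k * u $ k = w1 i * u $ k" "w2 k * u $ k = w2 i * u $ k" for k
      by (simp_all add: weights diag_mat_mult vec_eq_iff)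
    then have "u $ k = 0" if "k \<noteq> i" for k using weight_eqD[of k i] that by auto
    then have u: "u = u $ i *s axis i 1" by (auto simp: vec_eq_iff axis_def)
    have "u $ i = 0"
    proof (rule ccontr)
      assume "u $ i \<noteq> 0"
      then have "axis i 1 = inverse (u $ i) *s u" by (subst u) (simp add: vector_smult_assoc)
      then have "axis i 1 \<in> W" using vec.subspace_scale[OF sub(1) uv(2)] by metis
      with that show False by (simp add: I_def)
    qed
    then have "u = 0" using u by simp
    with uv show ?thesis by simp
  qed
  have full: "X = UNIV" if X: "vec.subspace X" "\<And>i. axis i 1 \<in> X" for X :: "(complex ^ 'n) set"
  proof -
    have "v \<in> X" for v
      using vec.subspace_sum[OF X(1), of UNIV "\<lambda>i. v $ i *s axis i 1"] vec.subspace_scale[OF X]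
      by (simp add: basis_expansion)
    then show ?thesis by auto
  qed
  have "I = {} \<or> I = UNIV"
  proof (rule no_splitting)
    fix i j
    assume "\<rho> y1 $ i $ j \<noteq> 0 \<or> \<rho> y2 $ i $ j \<noteq> 0"
    then obtain Y where Y: "Y = y1 \<or> Y = y2" "\<rho> Y $ i $ j \<noteq> 0" by blast
    have a: "axis i 1 = inverse (\<rho> Y $ i $ j) *s (\<rho> Y *v axis j 1)"
      unfolding y_axis[OF Y] using Y(2) by (simp add: vector_smult_assoc)
    show "i \<in> I \<longleftrightarrow> j \<in> I"
    proof (cases "j \<in> I")
      case True
      then have "axis i 1 \<in> W"
        unfolding a I_def using Y(1) inv by (intro vec.subspace_scale[OF sub(1)]) auto
      with True show ?thesis by (simp add: I_def)
    next
      case False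
      then have "axis i 1 \<in> W'"
        unfolding a using Y(1) inv' axis_mem by (intro vec.subspace_scale[OF sub(2)]) auto
      then have "axis i 1 \<notin> W" using W(5) by (metis IntI axis_eq_0_iff singletonD zero_neq_one)
      with False show ?thesis by (simp add: I_def)
    qed
  qed
  then show False
  proof
    assume "I = {}"
    then have "W' = UNIV" using full[OF sub(2)] axis_mem by auto
    then show False using W(3,5) by auto
  next
    assume "I = UNIV"
    then have "W = UNIV" using full[OF sub(1)] by (auto simp: I_def)
    then show False using W(4,5) by auto
  qed
qed

end

section \<open>The staircase of weights\<close>

lemma eigenvalues_diag: "eigenvalues (diag_mat d) = range d"
proof
  show "eigenvalues (diag_mat d) \<subseteq> range d"
  proof
    fix \<mu> assume "\<mu> \<in> eigenvalues (diag_mat d)"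
    then obtain v where v: "v \<noteq> 0" "diag_mat d *v v = \<mu> *s v" by (auto simp: eigenvalues_def)
    then obtain i where "v $ i \<noteq> 0" by (auto simp: vec_eq_iff)
    moreover have "(diag_mat d *v v) $ i = (\<mu> *s v) $ i" by (simp only: v)
    ultimately have "\<mu> = d i" by (simp add: diag_mat_mult)
    then show "\<mu> \<in> range d" by blast
  qed
  show "range d \<subseteq> eigenvalues (diag_mat d)"
  proof
    fix \<mu> assume "\<mu> \<in> range d"
    then obtain i where "\<mu> = d i" by blast
    then have "diag_mat d *v axis i 1 = \<mu> *s axis i 1" "axis i (1 :: complex) \<noteq> 0"
      by (simp_all add: diag_mat_axis axis_eq_0_iff)
    then show "\<mu> \<in> eigenvalues (diag_mat d)" unfolding eigenvalues_def by blast
  qed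
qed

lemma eigenspace_diag: "eigenspace (diag_mat d) \<mu> = {v. \<forall>i. i \<notin> {i. d i = \<mu>} \<longrightarrow> v $ i = 0}"
  by (auto simp: eigenspace_def diag_mat_mult vec_eq_iff)

lemma integral_weights:
  fixes w :: "'n::finite \<Rightarrow> complex"
  assumes "\<And>i j. w i - w j \<in> \<int>" "\<And>i. w i \<in> \<real>"
  obtains l :: real and t :: "'n \<Rightarrow> nat" where "\<And>i. w i = of_real l - of_nat (t i)" "\<exists>i. t i = 0"
proof -
  define r where "r i = Re (w i)" for i
  have w: "w i = of_real (r i)" for i using assms(2) by (simp add: r_def)
  define l where "l = Max (range r)"
  have "l \<in> range r" unfolding l_def by (intro Max_in) auto
  then obtain i0 where i0: "l = r i0" by blast
  have ge: "r i \<le> l" for i unfolding l_def by (intro Max_ge) auto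
  have "\<exists>k. l - r i = real k" for i
  proof -
    obtain z where "w i0 - w i = of_int z" using assms(1)[of i0 i] by (auto elim: Ints_cases)
    then have "complex_of_real (l - r i) = complex_of_real (of_int z)" by (simp add: w i0)
    then have z: "l - r i = of_int z" by (rule of_real_eq_iff[THEN iffD1])
    then have "0 \<le> z" using ge[of i] by linarith
    then have "l - r i = real (nat z)" using z by simp
    then show ?thesis by blast
  qed
  then obtain t where t: "\<And>i. l - r i = real (t i)" by metis
  have "w i = of_real l - of_nat (t i)" for i
    using arg_cong[OF t[of i], of complex_of_real] by (simp add: w algebra_simps)
  moreover have "t i0 = 0" using t[of i0] i0 by simp
  ultimately show ?thesis using that by blast
qed

lemma image_of_line:
  fixes Y :: "complex ^ 'n ^ 'n"
  assumes "Y *v axis k 1 = c *s axis k' 1" "c \<noteq> 0"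
  shows "(\<lambda>v. Y *v v) ` range (\<lambda>a. a *s axis k 1) = range (\<lambda>a. a *s axis k' 1)"
proof -
  have "(\<lambda>v. Y *v v) ` range (\<lambda>a. a *s axis k 1) = range (\<lambda>a. (a * c) *s axis k' (1 :: complex))"
    unfolding image_image by (simp add: vector_scalar_commute assms(1) vector_smult_assoc)
  also have "\<dots> = range (\<lambda>a. a *s axis k' 1)"
  proof
    show "range (\<lambda>a. a *s axis k' 1) \<subseteq> range (\<lambda>a. (a * c) *s axis k' (1 :: complex))"
    proof
      fix v assume "v \<in> range (\<lambda>a. a *s axis k' (1 :: complex))"
      then obtain a where "v = a *s axis k' 1" by blast
      then have "v = (a / c * c) *s axis k' 1" using assms(2) by simp
      then show "v \<in> range (\<lambda>a. (a * c) *s axis k' (1 :: complex))" by blast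
    qed
  qed blast
  finally show ?thesis .
qed

context irreducible_weight_bundle
begin

definition arrows1 :: "'n rel" where "arrows1 = {(j, i). \<rho> y1 $ i $ j \<noteq> 0}"
definition arrows2 :: "'n rel" where "arrows2 = {(j, i). \<rho> y2 $ i $ j \<noteq> 0}"

lemma arrows_connected: "(a, b) \<in> (arrows1 \<union> arrows1\<inverse> \<union> arrows2 \<union> arrows2\<inverse>)\<^sup>*" (is "_ \<in> ?R\<^sup>*")
proof -
  define I where "I = {b. (a, b) \<in> ?R\<^sup>*}"
  have "I = {} \<or> I = UNIV"
  proof (rule no_splitting)
    fix i j
    assume "\<rho> y1 $ i $ j \<noteq> 0 \<or> \<rho> y2 $ i $ j \<noteq> 0"
    then have "(j, i) \<in> ?R" "(i, j) \<in> ?R" by (auto simp: arrows1_def arrows2_def)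
    then show "i \<in> I \<longleftrightarrow> j \<in> I" unfolding I_def by (blast intro: rtrancl_into_rtrancl)
  qed
  moreover have "a \<in> I" by (simp add: I_def)
  ultimately show ?thesis by (auto simp: I_def)
qed

text \<open>A composition of two arrows is a nonzero entry of the product of the two operators: no cancellation
  can occur, as there is at most one nonzero entry in each column.\<close>

lemma arrows_commute: "arrows1 O arrows2 = arrows2 O arrows1"
proof -
  have prod: "(\<exists>l. A $ k $ l \<noteq> 0 \<and> B $ l $ j \<noteq> 0) \<longleftrightarrow> (A ** B) $ k $ j \<noteq> 0"
    if B: "\<And>l l'. B $ l $ j \<noteq> 0 \<Longrightarrow> B $ l' $ j \<noteq> 0 \<Longrightarrow> l = l'" for A B :: "complex ^ 'n ^ 'n" and k j
  proof (cases "\<exists>l. B $ l $ j \<noteq> 0")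
    case True
    then obtain l where l: "B $ l $ j \<noteq> 0" by blast
    then have z: "B $ l' $ j = 0" if "l' \<noteq> l" for l' using B that by blast
    have "(A ** B) $ k $ j = (\<Sum>i\<in>UNIV. A $ k $ i * B $ i $ j)"
      by (simp add: matrix_matrix_mult_def)
    also have "\<dots> = (\<Sum>i\<in>UNIV. if i = l then A $ k $ l * B $ l $ j else 0)"
      by (intro sum.cong) (auto simp: z)
    finally have "(A ** B) $ k $ j = A $ k $ l * B $ l $ j" by simp
    with l z show ?thesis by (metis mult_eq_0_iff)
  next
    case False
    then show ?thesis by (simp add: matrix_matrix_mult_def)
  qed
  have i1: "\<rho> y1 $ l $ j \<noteq> 0 \<Longrightarrow> \<rho> y1 $ l' $ j \<noteq> 0 \<Longrightarrow> l = l'" for l l' j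
    by (metis y_grading(1) weight_eqD)
  have i2: "\<rho> y2 $ l $ j \<noteq> 0 \<Longrightarrow> \<rho> y2 $ l' $ j \<noteq> 0 \<Longrightarrow> l = l'" for l l' j
    by (metis y_grading(2) weight_eqD)
  have "(j, k) \<in> arrows1 O arrows2 \<longleftrightarrow> (\<rho> y2 ** \<rho> y1) $ k $ j \<noteq> 0" for j k
    using prod[of "\<rho> y1" j "\<rho> y2" k, OF i1[where j = j]] unfolding arrows1_def arrows2_def by blast
  moreover have "(j, k) \<in> arrows2 O arrows1 \<longleftrightarrow> (\<rho> y1 ** \<rho> y2) $ k $ j \<noteq> 0" for j k
    using prod[of "\<rho> y2" j "\<rho> y1" k, OF i2[where j = j]] unfolding arrows1_def arrows2_def by blast
  ultimately show ?thesis unfolding YY by (intro subset_antisym subrelI) simp_all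
qed


lemma weight_differences: "w1 b - w1 a \<in> \<int>" "w2 b - w2 a \<in> \<int>"
proof -
  have "w1 b - w1 a \<in> \<int> \<and> w2 b - w2 a \<in> \<int>"
    using arrows_connected[of a b]
  proof (induction rule: rtrancl_induct)
    case (step b c)
    then have "(w1 c - w1 b \<in> \<int>) \<and> (w2 c - w2 b \<in> \<int>)"
      by (auto simp: arrows1_def arrows2_def dest!: y_grading)
    with step.IH have "(w1 c - w1 b) + (w1 b - w1 a) \<in> \<int> \<and> (w2 c - w2 b) + (w2 b - w2 a) \<in> \<int>"
      by (intro conjI Ints_add) auto
    then show ?case by simp
  qed simp
  then show "w1 b - w1 a \<in> \<int>" "w2 b - w2 a \<in> \<int>" by auto
qed

lemma joint_eigenspace_\<rho>:
  "joint_eigenspace \<rho> \<mu>1 \<mu>2 = {v. \<forall>i. i \<notin> {i. w1 i = \<mu>1 \<and> w2 i = \<mu>2} \<longrightarrow> v $ i = 0}"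
  unfolding joint_eigenspace_def weights eigenspace_diag by blast

lemma multiplicity_free_\<rho>: "multiplicity_free \<rho>"
  unfolding multiplicity_free_def
proof (intro allI impI)
  fix \<mu>1 \<mu>2
  let ?A = "{i. w1 i = \<mu>1 \<and> w2 i = \<mu>2}"
  assume "joint_eigenspace \<rho> \<mu>1 \<mu>2 \<noteq> {0}"
  moreover have "joint_eigenspace \<rho> \<mu>1 \<mu>2 = {0}" if "?A = {}"
    unfolding joint_eigenspace_\<rho> that by (auto simp: vec_eq_iff)
  ultimately obtain i where i: "i \<in> ?A" by blast
  have "?A = {i}"
  proof
    show "?A \<subseteq> {i}"
    proof
      fix a assume "a \<in> ?A"
      then have "a = i" using i by (intro weight_eqD) simp_all
      then show "a \<in> {i}" by simp
    qed
  qed (use i in simp)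
  then show "vec.dim (joint_eigenspace \<rho> \<mu>1 \<mu>2) = 1"
    unfolding joint_eigenspace_\<rho> dim_substandard_cart by simp
qed

text \<open>The positions of the weights relative to the largest eigenvalues satisfy the hypotheses of
  \<open>commuting_arrows\<close>; the arrows between neighbouring positions describe \<open>\<rho> (y\<^sub>1)\<close> and \<open>\<rho> (y\<^sub>2)\<close>.\<close>

theorem staircase_structure:
  "\<exists>(l1::real) (l2::real) (s::nat) (m :: nat \<Rightarrow> nat) (j :: nat \<Rightarrow> nat).
      largest_eigenvalue (\<rho> h1) l1 \<and> largest_eigenvalue (\<rho> h2) l2 \<and>
      eigenvalues (\<rho> h1) = {of_real l1 - of_nat i | i. i \<le> s} \<and>
      (\<forall>i\<le>s. vec.dim (eigenspace (\<rho> h1) (of_real l1 - of_nat i)) = m i + 1) \<and>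
      (\<forall>i i'. i \<le> i' \<and> i' \<le> s \<longrightarrow> j i' \<le> j i \<and> j i' + m i' \<le> j i + m i) \<and>
      (let V = weight_space \<rho> l1 l2 (staircase s m j) in
         \<forall>\<theta>\<in>staircase s m j. V \<theta> \<noteq> {0} \<and>
           (\<lambda>v. \<rho> y1 *v v) ` V \<theta> = V (\<theta> + (1, 0)) \<and>
           (\<lambda>v. \<rho> y2 *v v) ` V \<theta> = V (\<theta> + (0, 1)))"
proof -
  obtain l1 t1 where t1: "\<And>i. w1 i = of_real l1 - of_nat (t1 i)" "\<exists>i. t1 i = 0"
    using integral_weights[of w1] weight_differences(1) weights_real(1) by metis
  obtain l2 t2 where t2: "\<And>i. w2 i = of_real l2 - of_nat (t2 i)" "\<exists>i. t2 i = 0"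
    using integral_weights[of w2] weight_differences(2) weights_real(2) by metis
  define t where "t i = (t1 i, t2 i)" for i
  have largest: "largest_eigenvalue (diag_mat w) l"
    if w: "\<And>i. w i = complex_of_real l - of_nat (t i)" and z: "\<exists>i. t i = 0" for w l and t :: "'n \<Rightarrow> nat"
  proof -
    obtain i where "t i = 0" using z by blast
    then have "complex_of_real l = w i" by (simp add: w)
    then show ?thesis unfolding largest_eigenvalue_def eigenvalues_diag by (auto simp: w)
  qed
  have step1: "t i = t k + (1, 0)" if "w1 i = w1 k - 1" "w2 i = w2 k" for i k
  proof -
    have "(of_nat (t1 i) :: complex) = of_nat (t1 k + 1)" "(of_nat (t2 i) :: complex) = of_nat (t2 k)"
      using that by (simp_all add: t1(1) t2(1) algebra_simps)
    then show ?thesis by (simp only: of_nat_eq_iff) (simp add: t_def)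
  qed
  have step2: "t i = t k + (0, 1)" if "w1 i = w1 k" "w2 i = w2 k - 1" for i k
  proof -
    have "(of_nat (t1 i) :: complex) = of_nat (t1 k)" "(of_nat (t2 i) :: complex) = of_nat (t2 k + 1)"
      using that by (simp_all add: t1(1) t2(1) algebra_simps)
    then show ?thesis by (simp only: of_nat_eq_iff) (simp add: t_def)
  qed
  have t_eq: "i = k" if "t i = t k" for i k
    by (rule weight_eqD) (use that in \<open>simp_all add: t1(1) t2(1) t_def\<close>)
  interpret commuting_arrows arrows1 arrows2 t
  proof
    show "t b = t a + (1, 0)" if "(a, b) \<in> arrows1" for a b
      using that step1 y_grading(1) unfolding arrows1_def by blast
    show "t b = t a + (0, 1)" if "(a, b) \<in> arrows2" for a b
      using that step2 y_grading(2) unfolding arrows2_def by blast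
    show "inj t" using t_eq by (rule injI)
  qed (rule arrows_commute arrows_connected)+
  obtain k0 where "t1 k0 = 0" using t1(2) by blast
  then have "t k0 = (0, t2 k0)" by (simp add: t_def)
  then have "(0, t2 k0) \<in> range t" by (rule range_eqI[OF sym])
  from range_is_staircase[OF finite this] obtain s m j where st: "range t = staircase s m j"
    and card: "\<forall>i\<le>s. card {a. fst (t a) = i} = m i + 1"
    and mono: "\<forall>i i'. i \<le> i' \<and> i' \<le> s \<longrightarrow> j i' \<le> j i \<and> j i' + m i' \<le> j i + m i"
    by (elim exE conjE)
  have w1_iff: "w1 a = of_real l1 - of_nat i \<longleftrightarrow> fst (t a) = i" for a i
    by (simp add: t1(1) t_def)
  have w2_iff: "w2 a = of_real l2 - of_nat i \<longleftrightarrow> snd (t a) = i" for a i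
    by (simp add: t2(1) t_def)
  have ev: "eigenvalues (\<rho> h1) = {of_real l1 - of_nat i | i. i \<le> s}"
  proof -
    have "(\<exists>a. t1 a = i) \<longleftrightarrow> i \<le> s" for i
    proof -
      have "(\<exists>a. t1 a = i) \<longleftrightarrow> (\<exists>q. (i, q) \<in> range t)"
      proof
        assume "\<exists>a. t1 a = i"
        then obtain a where "t1 a = i" by blast
        then have "t a = (i, t2 a)" by (simp add: t_def)
        then show "\<exists>q. (i, q) \<in> range t" by (intro exI[of _ "t2 a"] range_eqI[OF sym])
      next
        assume "\<exists>q. (i, q) \<in> range t"
        then obtain q a where "(i, q) = t a" by blast
        then have "t1 a = i" by (simp add: t_def)
        then show "\<exists>a. t1 a = i" by blast
      qed
      also have "\<dots> \<longleftrightarrow> i \<le> s"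
      proof
        assume "i \<le> s"
        then have "(i, j i + 0) \<in> staircase s m j" unfolding staircase_def by blast
        then show "\<exists>q. (i, q) \<in> range t" unfolding st by (rule exI)
      next
        assume "\<exists>q. (i, q) \<in> range t"
        then show "i \<le> s" unfolding st staircase_def by blast
      qed
      finally show ?thesis .
    qed
    note le_s = this
    have "w1 = (\<lambda>a. of_real l1 - of_nat (t1 a))" by (rule ext) (rule t1(1))
    then have "range w1 = {of_real l1 - of_nat i | i. \<exists>a. t1 a = i}" by (simp only:) blast
    then show ?thesis unfolding weights eigenvalues_diag by (simp only: le_s)
  qed
  have dims: "vec.dim (eigenspace (\<rho> h1) (of_real l1 - of_nat i)) = m i + 1" if "i \<le> s" for i
    unfolding weights eigenspace_diag dim_substandard_cart w1_iff using card that by blast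
  have spaces: "weight_space \<rho> l1 l2 (staircase s m j) \<theta> \<noteq> {0} \<and>
       (\<lambda>v. \<rho> y1 *v v) ` weight_space \<rho> l1 l2 (staircase s m j) \<theta>
         = weight_space \<rho> l1 l2 (staircase s m j) (\<theta> + (1, 0)) \<and>
       (\<lambda>v. \<rho> y2 *v v) ` weight_space \<rho> l1 l2 (staircase s m j) \<theta>
         = weight_space \<rho> l1 l2 (staircase s m j) (\<theta> + (0, 1))"
    if \<theta>: "\<theta> \<in> staircase s m j" for \<theta>
  proof -
    let ?V = "weight_space \<rho> l1 l2 (staircase s m j)"
    have V: "?V (t k) = range (\<lambda>a. a *s axis k 1)" for k
    proof -
      have "{a. fst (t a) = fst (t k) \<and> snd (t a) = snd (t k)} = {k}"
        by (auto simp: prod_eq_iff[symmetric])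
      then have "?V (t k) = {v. \<forall>i. i \<notin> {k} \<longrightarrow> v $ i = 0}"
        unfolding weight_space_def st[symmetric] joint_eigenspace_\<rho> w1_iff w2_iff by simp
      also have "\<dots> = range (\<lambda>a. a *s axis k 1)"
      proof
        show "{v. \<forall>i. i \<notin> {k} \<longrightarrow> v $ i = 0} \<subseteq> range (\<lambda>a. a *s axis k (1 :: complex))"
        proof
          fix v :: "complex ^ 'n" assume "v \<in> {v. \<forall>i. i \<notin> {k} \<longrightarrow> v $ i = 0}"
          then have "v = v $ k *s axis k 1" by (auto simp: vec_eq_iff axis_def)
          then show "v \<in> range (\<lambda>a. a *s axis k 1)" by blast
        qed
      qed (auto simp: axis_def)
      finally show ?thesis .
    qed
    obtain k where k: "\<theta> = t k" using \<theta> unfolding st[symmetric] by blast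
    have image: "(\<lambda>v. \<rho> Y *v v) ` ?V (t k) = ?V (t k + e)"
      if Y: "Y = y1 \<or> Y = y2" and out: "\<And>i. \<rho> Y $ i $ k \<noteq> 0 \<Longrightarrow> t i = t k + e"
        and into: "\<And>i. t i = t k + e \<Longrightarrow> \<rho> Y $ i $ k \<noteq> 0" for Y e
    proof (cases "t k + e \<in> range t")
      case True
      then obtain i where i: "t i = t k + e" by (metis rangeE)
      show ?thesis
        unfolding i[symmetric] V by (rule image_of_line[OF y_axis[OF Y into[OF i]] into[OF i]])
    next
      case False
      then have "\<rho> Y $ i $ k = 0" for i using out[of i] by (metis rangeI)
      then have "\<rho> Y *v axis k 1 = 0"
        by (simp add: matrix_vector_mult_def vec_eq_iff axis_def if_distrib cong: if_cong)
      then have "(\<lambda>v. \<rho> Y *v v) ` range (\<lambda>a. a *s axis k 1) = {0}"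
        unfolding image_image vector_scalar_commute by simp
      moreover have "?V (t k + e) = {0}"
        unfolding weight_space_def st[symmetric] by (rule if_not_P[OF False])
      ultimately show ?thesis unfolding V by (simp only:)
    qed
    have "axis k 1 \<in> ?V (t k)" unfolding V by (rule range_eqI[of _ _ 1]) simp
    moreover have "axis k (1 :: complex) \<noteq> 0" by (simp add: axis_eq_0_iff)
    ultimately have "?V (t k) \<noteq> {0}" by (metis singletonD)
    moreover have "(\<lambda>v. \<rho> y1 *v v) ` ?V (t k) = ?V (t k + (1, 0))"
    proof (rule image)
      show "t i = t k + (1, 0)" if "\<rho> y1 $ i $ k \<noteq> 0" for i
        using step1 y_grading(1)[OF that] by blast
      show "\<rho> y1 $ i $ k \<noteq> 0" if "t i = t k + (1, 0)" for i
        using adjacent_U[OF that] unfolding arrows1_def by blast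
    qed (rule disjI1, rule refl)
    moreover have "(\<lambda>v. \<rho> y2 *v v) ` ?V (t k) = ?V (t k + (0, 1))"
    proof (rule image)
      show "t i = t k + (0, 1)" if "\<rho> y2 $ i $ k \<noteq> 0" for i
        using step2 y_grading(2)[OF that] by blast
      show "\<rho> y2 $ i $ k \<noteq> 0" if "t i = t k + (0, 1)" for i
        using adjacent_V[OF that] unfolding arrows2_def by blast
    qed (rule disjI2, rule refl)
    ultimately show ?thesis unfolding k by (intro conjI)
  qed
  have "largest_eigenvalue (\<rho> h1) l1" "largest_eigenvalue (\<rho> h2) l2"
    unfolding weights by (rule largest[OF t1], rule largest[OF t2])
  moreover have "\<forall>i\<le>s. vec.dim (eigenspace (\<rho> h1) (of_real l1 - of_nat i)) = m i + 1"
    by (intro allI impI dims)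
  moreover have "let V = weight_space \<rho> l1 l2 (staircase s m j) in
         \<forall>\<theta>\<in>staircase s m j. V \<theta> \<noteq> {0} \<and>
           (\<lambda>v. \<rho> y1 *v v) ` V \<theta> = V (\<theta> + (1, 0)) \<and>
           (\<lambda>v. \<rho> y2 *v v) ` V \<theta> = V (\<theta> + (0, 1))"
    unfolding Let_def by (intro ballI spaces)
  ultimately show ?thesis using ev mono by (intro exI conjI)
qed

end

section \<open>Simultaneous diagonalization\<close>

lemma invertible_inverse:
  fixes P :: "complex ^ 'n ^ 'n"
  assumes "invertible P"
  shows "P ** matrix_inv P = mat 1" "matrix_inv P ** P = mat 1"
proof -
  obtain A where "P ** A = mat 1 \<and> A ** P = mat 1" using assms by (auto simp: invertible_def)
  then have "P ** matrix_inv P = mat 1 \<and> matrix_inv P ** P = mat 1"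
    unfolding matrix_inv_def by (rule someI)
  then show "P ** matrix_inv P = mat 1" "matrix_inv P ** P = mat 1" by auto
qed

lemma diagonalizable_diag_mat: "diagonalizable (diag_mat d)"
proof -
  have "invertible (mat 1 :: complex ^ 'a ^ 'a)" unfolding invertible_def by (intro exI[of _ "mat 1"]) simp
  moreover from invertible_inverse(1)[OF this]
  have "matrix_inv (mat 1) = (mat 1 :: complex ^ 'a ^ 'a)" by simp
  ultimately show ?thesis
    unfolding diagonalizable_def by (intro exI[of _ "mat 1"]) (simp add: diag_mat_def)
qed

text \<open>The projections to the eigenspaces. In an eigenbasis, a matrix that commutes with \<open>A\<close> has
  nonzero entries only between equal eigenvalues, so it commutes with the projections.\<close>

lemma eigenprojections:
  fixes A :: "complex ^ 'n ^ 'n"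
  assumes "diagonalizable A"
  obtains Q F where "finite F" "\<And>v. (\<Sum>\<mu>\<in>F. Q \<mu> *v v) = v"
    "\<And>\<mu> v. A *v (Q \<mu> *v v) = \<mu> *s (Q \<mu> *v v)" "\<And>C \<mu>. C ** A = A ** C \<Longrightarrow> C ** Q \<mu> = Q \<mu> ** C"
proof -
  obtain P :: "complex ^ 'n ^ 'n" where P: "invertible P"
    "\<And>i j. i \<noteq> j \<Longrightarrow> (matrix_inv P ** A ** P) $ i $ j = 0"
    using assms unfolding diagonalizable_def by blast
  define R where "R = matrix_inv P"
  note PR = invertible_inverse[OF P(1), folded R_def]
  define d where "d i = (R ** A ** P) $ i $ i" for i
  have RAP: "R ** A ** P = diag_mat d"
    using P(2) by (auto simp: diag_mat_def vec_eq_iff d_def R_def)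
  define I where "I \<mu> = diag_mat (\<lambda>i. if d i = \<mu> then 1 else 0)" for \<mu>
  define Q where "Q \<mu> = P ** I \<mu> ** R" for \<mu>
  have AP: "A ** P = P ** diag_mat d"
    unfolding RAP[symmetric] by (simp add: matrix_mul_assoc PR)
  have AQ: "A ** Q \<mu> = mat_scale \<mu> (Q \<mu>)" for \<mu>
  proof -
    have "diag_mat d ** I \<mu> = mat_scale \<mu> (I \<mu>)" 
      unfolding diag_mat_mult(1) by (auto simp: I_def mat_scale_def diag_mat_def vec_eq_iff)
    moreover have "A ** Q \<mu> = P ** (diag_mat d ** I \<mu>) ** R" unfolding Q_def by (simp add: matrix_mul_assoc AP)
    ultimately show ?thesis by (simp add: Q_def mat_scale_mult)
  qed
  have sum: "(\<Sum>\<mu>\<in>range d. Q \<mu> *v v) = v" for v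
  proof -
    define u where "u = R *v v"
    have "(\<Sum>\<mu>\<in>range d. I \<mu> *v u) = u"
      by (simp add: vec_eq_iff I_def diag_mat_mult if_distrib if_distribR sum.delta cong: if_cong)
    then have "P *v (\<Sum>\<mu>\<in>range d. I \<mu> *v u) = v"
      by (simp add: u_def matrix_vector_mul_assoc PR)
    moreover have "P *v (\<Sum>\<mu>\<in>range d. I \<mu> *v u) = (\<Sum>\<mu>\<in>range d. P *v (I \<mu> *v u))"
      by (rule linear_sum[OF matrix_vector_mul_linear])
    moreover have "Q \<mu> *v v = P *v (I \<mu> *v u)" for \<mu>
      by (simp add: Q_def u_def matrix_vector_mul_assoc matrix_mul_assoc)
    ultimately show ?thesis by (simp only:)
  qed
  have comm: "C ** Q \<mu> = Q \<mu> ** C" if C: "C ** A = A ** C" for C \<mu>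
  proof -
    define C' where "C' = R ** C ** P"
    have "C' ** diag_mat d = R ** C ** (P ** R) ** A ** P" unfolding C'_def RAP[symmetric] by (simp only: matrix_mul_assoc)
    also have "\<dots> = R ** (C ** A) ** P" by (simp add: PR matrix_mul_assoc)
    also have "\<dots> = R ** A ** (P ** R) ** C ** P" unfolding C by (simp add: PR matrix_mul_assoc)
    also have "\<dots> = diag_mat d ** C'" unfolding C'_def RAP[symmetric] by (simp only: matrix_mul_assoc)
    finally have "C' $ i $ j * d j = d i * C' $ i $ j" for i j
      by (simp add: diag_mat_mult vec_eq_iff)
    then have "C' $ i $ j = 0" if "d i \<noteq> d j" for i j using that by (metis mult.commute mult_right_cancel)
    then have "C' ** I \<mu> = I \<mu> ** C'" by (auto simp: I_def diag_mat_mult vec_eq_iff)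
    have "C ** Q \<mu> = (P ** R) ** C ** P ** I \<mu> ** R" by (simp add: PR Q_def matrix_mul_assoc)
    also have "\<dots> = P ** (C' ** I \<mu>) ** R" unfolding C'_def by (simp only: matrix_mul_assoc)
    also have "\<dots> = P ** I \<mu> ** R ** C ** (P ** R)"
      unfolding \<open>C' ** I \<mu> = I \<mu> ** C'\<close> unfolding C'_def by (simp only: matrix_mul_assoc)
    also have "\<dots> = Q \<mu> ** C" by (simp add: PR Q_def matrix_mul_assoc)
    finally show ?thesis .
  qed
  show ?thesis
  proof (rule that[of "range d" Q])
    show "A *v (Q \<mu> *v v) = \<mu> *s (Q \<mu> *v v)" for \<mu> v
      by (simp add: matrix_vector_mul_assoc AQ mat_scale_mult)
  qed (simp_all add: sum comm)
qed

text \<open>If \<open>Q \<mu>\<close> and \<open>Q' \<kappa>\<close> are the eigenprojections of \<open>A\<close> and \<open>B\<close>, the vectors \<open>Q' \<kappa> (Q \<mu> v)\<close> are joint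
  eigenvectors with sum \<open>v\<close>; so the joint eigenvectors contain a basis.\<close>

lemma simultaneous_diagonalization:
  fixes A B :: "complex ^ 'n ^ 'n"
  assumes A: "diagonalizable A" and B: "diagonalizable B" and AB: "A ** B = B ** A"
  obtains P R :: "complex ^ 'n ^ 'n" and d e where
    "P ** R = mat 1" "R ** P = mat 1" "R ** A ** P = diag_mat d" "R ** B ** P = diag_mat e"
proof -
  obtain Q F where Q: "finite F" "\<And>v. (\<Sum>\<mu>\<in>F. Q \<mu> *v v) = v"
    "\<And>\<mu> v. A *v (Q \<mu> *v v) = \<mu> *s (Q \<mu> *v v)"
    using eigenprojections[OF A] by metis
  obtain Q' F' where Q': "finite F'" "\<And>v. (\<Sum>\<mu>\<in>F'. Q' \<mu> *v v) = v"
    "\<And>\<mu> v. B *v (Q' \<mu> *v v) = \<mu> *s (Q' \<mu> *v v)" "\<And>C \<mu>. C ** B = B ** C \<Longrightarrow> C ** Q' \<mu> = Q' \<mu> ** C"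
    using eigenprojections[OF B] by metis
  define J where "J = {v. (\<exists>a. A *v v = a *s v) \<and> (\<exists>b. B *v v = b *s v)}"
  have QJ: "Q' \<kappa> *v (Q \<mu> *v v) \<in> J" for \<kappa> \<mu> v
  proof -
    have "A *v (Q' \<kappa> *v (Q \<mu> *v v)) = Q' \<kappa> *v (A *v (Q \<mu> *v v))"
      unfolding matrix_vector_mul_assoc matrix_mul_assoc Q'(4)[OF AB] ..
    also have "\<dots> = \<mu> *s (Q' \<kappa> *v (Q \<mu> *v v))" unfolding Q(3) vector_scalar_commute ..
    finally show ?thesis unfolding J_def using Q'(3) by blast
  qed
  have span_J: "v \<in> vec.span J" for v
  proof -
    have "Q \<mu> *v v \<in> vec.span J" for \<mu>
      using vec.span_sum[of F' "\<lambda>\<kappa>. Q' \<kappa> *v (Q \<mu> *v v)" J] vec.span_base[OF QJ] unfolding Q'(2) by blast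
    then show ?thesis using vec.span_sum[of F "\<lambda>\<mu>. Q \<mu> *v v" J] unfolding Q(2) by blast
  qed
  obtain S where S: "S \<subseteq> J" "vec.independent S" "J \<subseteq> vec.span S" "card S = vec.dim J"
    by (rule vec.basis_exists)
  have "vec.span S = UNIV"
    using vec.span_mono[OF S(3)] span_J unfolding vec.span_span by blast
  have "vec.span J = UNIV" using span_J by blast
  then have card: "card S = CARD('n)"
    using S(4) vec.dim_span[of J] vec_dim_card by metis
  have fin: "finite S" using S(2) vec.finiteI_independent by blast
  obtain f :: "'n \<Rightarrow> complex ^ 'n" where f: "bij_betw f UNIV S"
    using finite_same_card_bij[OF finite fin] card by auto
  define P :: "complex ^ 'n ^ 'n" where "P = (\<chi> i j. f j $ i)"
  have Pv: "P *v x = (\<Sum>j\<in>UNIV. x $ j *s f j)" for x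
    by (simp add: matrix_mult_sum column_def P_def)
  have "surj ((*v) P)"
  proof -
    have "vec.span S \<subseteq> range ((*v) P)"
    proof (rule vec.span_minimal)
      show "S \<subseteq> range ((*v) P)"
      proof
        fix s assume "s \<in> S"
        then obtain j where "s = f j" using f by (auto simp: bij_betw_def)
        then have "s = P *v axis j 1" by (simp add: P_def vec_eq_iff matrix_vector_mult_def axis_def if_distrib cong: if_cong)
        then show "s \<in> range ((*v) P)" by blast
      qed
      show "vec.subspace (range ((*v) P))"
        using vec.subspace_image[of UNIV P] by (simp add: vec.subspace_UNIV)
    qed
    then show ?thesis using \<open>vec.span S = UNIV\<close> by auto
  qed
  then obtain R where PR: "P ** R = mat 1" using matrix_right_invertible_surjective by blast
  then have RP: "R ** P = mat 1" using matrix_left_right_inverse by blast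
  have diag: "\<exists>d. R ** C ** P = diag_mat d" if C: "\<And>v. v \<in> J \<Longrightarrow> \<exists>c. C *v v = c *s v" for C :: "complex ^ 'n ^ 'n"
  proof -
    have "\<exists>c. C *v f j = c *s f j" for j
    proof (rule C)
      show "f j \<in> J" using S(1) f by (auto simp: bij_betw_def)
    qed
    then obtain d where d: "\<And>j. C *v f j = d j *s f j" by metis
    have "(C ** P) $ i $ j = (P ** diag_mat d) $ i $ j" for i j
    proof -
      have "(C ** P) $ i $ j = (C *v f j) $ i"
        by (simp add: P_def matrix_matrix_mult_def matrix_vector_mult_def)
      also have "\<dots> = (P ** diag_mat d) $ i $ j" unfolding d by (simp add: diag_mat_mult P_def)
      finally show ?thesis .
    qed
    then have "C ** P = P ** diag_mat d" by (simp add: vec_eq_iff)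
    then have "R ** C ** P = diag_mat d" by (simp add: matrix_mul_assoc[symmetric]) (simp add: matrix_mul_assoc RP)
    then show ?thesis by blast
  qed
  obtain d where "R ** A ** P = diag_mat d" using diag[of A] by (auto simp: J_def)
  moreover obtain e where "R ** B ** P = diag_mat e" using diag[of B] by (auto simp: J_def)
  ultimately show ?thesis using that PR RP by blast
qed

section \<open>Changing the basis of the fibre\<close>

lemma from_triv_basis_change:
  fixes P R :: "complex ^ 'n ^ 'n"
  assumes lt: "linear_triv E U \<phi>" and z: "z \<in> U" and PR: "P ** R = mat 1" "R ** P = mat 1"
  shows "from_triv E (\<lambda>e. R *v \<phi> e) z v = from_triv E \<phi> z (P *v v)"
proof -
  note l = linear_triv_simps[OF lt z]
  have inj: "inj_on (\<lambda>e. R *v \<phi> e) (fibre E z)"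
  proof (rule inj_onI)
    fix e e' assume e: "e \<in> fibre E z" "e' \<in> fibre E z" "R *v \<phi> e = R *v \<phi> e'"
    then have "P *v (R *v \<phi> e) = P *v (R *v \<phi> e')" by simp
    then have "\<phi> e = \<phi> e'" by (simp add: matrix_vector_mul_assoc PR)
    then show "e = e'" using l(5) e by (auto dest: inj_onD)
  qed
  have "R *v \<phi> (from_triv E \<phi> z (P *v v)) = v"
    by (simp add: l(2) matrix_vector_mul_assoc PR)
  then show ?thesis
    unfolding from_triv_def[of E "\<lambda>e. R *v \<phi> e"] using inv_into_f_f[OF inj l(1)] by metis
qed

lemma global_holomorphic_triv_basis_change:
  fixes P R :: "complex ^ 'n ^ 'n"
  assumes E: "holomorphic_bundle E" and \<phi>: "global_holomorphic_triv E \<phi>"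
    and PR: "P ** R = mat 1" "R ** P = mat 1"
  shows "global_holomorphic_triv E (\<lambda>e. R *v \<phi> e)"
  unfolding holomorphic_triv_def
proof (intro conjI, goal_cases)
  have lt: "linear_triv E bidisc \<phi>" using \<phi> by (simp add: holomorphic_triv_def)
  note ft = from_triv_basis_change[OF lt _ PR]
  case 1
  have "bij ((*v) R)"
    by (rule o_bij[where g = "(*v) P"]) (auto simp: fun_eq_iff matrix_vector_mul_assoc PR)
  show ?case
    unfolding linear_triv_def
  proof (intro conjI ballI allI)
    fix z assume z: "z \<in> bidisc"
    have "bij_betw \<phi> (fibre E z) UNIV" using lt z unfolding linear_triv_def by blast
    from bij_betw_trans[OF this \<open>bij ((*v) R)\<close>]
    show "bij_betw (\<lambda>e. R *v \<phi> e) (fibre E z) UNIV" by (simp add: o_def)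
    show "R *v \<phi> (badd E u v) = R *v \<phi> u + R *v \<phi> v" if "u \<in> fibre E z" "v \<in> fibre E z" for u v
      using linear_triv_simps(6)[OF lt z that] by (simp add: matrix_vector_right_distrib)
    show "R *v \<phi> (bscale E c u) = c *s (R *v \<phi> u)" if "u \<in> fibre E z" for c u
      using linear_triv_simps(7)[OF lt z that] by (simp add: vector_scalar_commute)
  qed (auto simp: open_Times)
next
  have lt: "linear_triv E bidisc \<phi>" using \<phi> by (simp add: holomorphic_triv_def)
  note ft = from_triv_basis_change[OF lt _ PR]
  case 2
  show ?case
  proof clarify
    fix V \<eta> assume at: "(V, \<eta>) \<in> batlas E"
    then have tr: "holomorphic_transition E bidisc \<phi> V \<eta>" "holomorphic_transition E V \<eta> bidisc \<phi>"
      using \<phi> unfolding holomorphic_triv_def by blast+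
    have "open V" using E at unfolding holomorphic_bundle_def linear_triv_def by blast
    then have op: "open (bidisc \<inter> V)" by (intro open_Int open_Times) auto
    have "holomorphic_transition E bidisc (\<lambda>e. R *v \<phi> e) V \<eta>"
      unfolding holomorphic_transition_def
    proof
      fix v
      show "vec_holomorphic2_on (\<lambda>z. \<eta> (from_triv E (\<lambda>e. R *v \<phi> e) z v)) (bidisc \<inter> V)"
      proof (rule vec_holomorphic2_on_cong[OF op])
        show "vec_holomorphic2_on (\<lambda>z. \<eta> (from_triv E \<phi> z (P *v v))) (bidisc \<inter> V)"
          using tr(1) unfolding holomorphic_transition_def by blast
        fix z assume "z \<in> bidisc \<inter> V"
        then have "z \<in> bidisc" by (rule IntD1)
        from ft[OF this, of v] show "\<eta> (from_triv E \<phi> z (P *v v)) = \<eta> (from_triv E (\<lambda>e. R *v \<phi> e) z v)" by simp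
      qed
    qed
    moreover have "holomorphic_transition E V \<eta> bidisc (\<lambda>e. R *v \<phi> e)"
      using tr(2) unfolding holomorphic_transition_def vec_holomorphic2_on_def matrix_vector_mult_def
      by (auto intro!: holomorphic2_on_sum holomorphic2_on_mult holomorphic2_on_const)
    ultimately show "holomorphic_transition E bidisc (\<lambda>e. R *v \<phi> e) V \<eta> \<and>
        holomorphic_transition E V \<eta> bidisc (\<lambda>e. R *v \<phi> e)" ..
  qed
qed

lemma has_left_inv_derivative_matrix:
  fixes M :: "complex ^ 'n ^ 'n"
  assumes "has_left_inv_derivative F X x w"
  shows "has_left_inv_derivative (\<lambda>y. M *v F y) X x (M *v w)"
proof -
  obtain D where D: "((\<lambda>y. F (x \<otimes>\<^bsub>mob2_cover\<^esub> y)) has_derivative D) (at \<one>\<^bsub>mob2_cover\<^esub>)"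
    "w = D (tangent_coord (su_re (fst X)), tangent_coord (su_re (snd X)))
      + \<i> *s D (tangent_coord (su_im (fst X)), tangent_coord (su_im (snd X)))"
    using assms unfolding has_left_inv_derivative_def by blast
  have "((\<lambda>y. M *v F (x \<otimes>\<^bsub>mob2_cover\<^esub> y)) has_derivative (\<lambda>h. M *v D h)) (at \<one>\<^bsub>mob2_cover\<^esub>)"
    by (rule bounded_linear.has_derivative[OF matrix_vector_mul_bounded_linear D(1)])
  moreover have "M *v w = M *v D (tangent_coord (su_re (fst X)), tangent_coord (su_re (snd X)))
      + \<i> *s (M *v D (tangent_coord (su_im (fst X)), tangent_coord (su_im (snd X))))"
    unfolding D(2) by (simp only: matrix_vector_right_distrib vector_scalar_commute)
  ultimately show ?thesis unfolding has_left_inv_derivative_def by blast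
qed

lemma bb_representation_basis_change:
  fixes P R :: "complex ^ 'n ^ 'n"
  assumes \<sigma>: "bb_representation \<sigma>" and PR: "P ** R = mat 1" "R ** P = mat 1"
    and diag: "R ** \<sigma> h1 ** P = diag_mat d" "R ** \<sigma> h2 ** P = diag_mat e"
  shows "bb_representation (\<lambda>X. R ** \<sigma> X ** P)"
  unfolding bb_representation_def diag
proof (intro conjI ballI allI)
  fix X Y :: "mat22 \<times> mat22" assume X: "X \<in> bb" and Y: "Y \<in> bb"
  have "\<sigma> (X + Y) = \<sigma> X + \<sigma> Y" using \<sigma> X Y unfolding bb_representation_def by blast
  then show "R ** \<sigma> (X + Y) ** P = R ** \<sigma> X ** P + R ** \<sigma> Y ** P"
    by (simp add: matrix_add_rdistrib matrix_add_ldistrib)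
  have mult: "(R ** A ** P) ** (R ** B ** P) = R ** (A ** B) ** P" for A B
  proof -
    have "(R ** A ** P) ** (R ** B ** P) = R ** A ** (P ** R) ** B ** P" by (simp only: matrix_mul_assoc)
    then show ?thesis by (simp add: PR matrix_mul_assoc)
  qed
  have "\<sigma> (lie_bracket X Y) = \<sigma> X ** \<sigma> Y - \<sigma> Y ** \<sigma> X"
    using \<sigma> X Y unfolding bb_representation_def by blast
  then show "R ** \<sigma> (lie_bracket X Y) ** P
      = (R ** \<sigma> X ** P) ** (R ** \<sigma> Y ** P) - (R ** \<sigma> Y ** P) ** (R ** \<sigma> X ** P)"
    unfolding mult by (simp add: matrix_minus_simps)
next
  fix c and X :: "mat22 \<times> mat22" assume X: "X \<in> bb"
  have "\<sigma> (map_prod (mat_scale c) (mat_scale c) X) = mat_scale c (\<sigma> X)"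
    using \<sigma> X unfolding bb_representation_def by blast
  then show "R ** \<sigma> (map_prod (mat_scale c) (mat_scale c) X) ** P = mat_scale c (R ** \<sigma> X ** P)"
    by (simp add: mat_scale_mult)
qed (rule diagonalizable_diag_mat)+

lemma associated_representation_basis_change:
  fixes P R :: "complex ^ 'n ^ 'n"
  assumes \<phi>: "linear_triv E bidisc \<phi>" and assoc: "associated_representation E act \<phi> \<sigma>"
    and PR: "P ** R = mat 1" "R ** P = mat 1"
    and diag: "R ** \<sigma> h1 ** P = diag_mat d" "R ** \<sigma> h2 ** P = diag_mat e"
  shows "associated_representation E act (\<lambda>e. R *v \<phi> e) (\<lambda>X. R ** \<sigma> X ** P)"
proof -
  have z: "(0, 0) \<in> bidisc" by simp
  note ft = from_triv_basis_change[OF \<phi> z PR]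
  have as: "bb_representation \<sigma>"
    "\<And>v. ((\<lambda>t. \<phi> (act ((t, 0), (0, 0)) (from_triv E \<phi> (0, 0) v))) has_vector_derivative \<i> *s (\<sigma> h1 *v v)) (at 0)"
    "\<And>v. ((\<lambda>t. \<phi> (act ((0, 0), (t, 0)) (from_triv E \<phi> (0, 0) v))) has_vector_derivative \<i> *s (\<sigma> h2 *v v)) (at 0)"
    "\<And>s. bundle_section E s \<Longrightarrow> holomorphic_section E s \<longleftrightarrow>
           (\<forall>X\<in>bb. \<forall>x\<in>carrier mob2_cover.
              has_left_inv_derivative (section_lift E act \<phi> s) X x (- (\<sigma> X *v section_lift E act \<phi> s x)))"
    using assoc unfolding associated_representation_def by blast+
  have lift: "section_lift E act (\<lambda>e. R *v \<phi> e) s = (\<lambda>x. R *v section_lift E act \<phi> s x)" for s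
    by (simp add: section_lift_def fun_eq_iff)
  have der: "((\<lambda>t. R *v f t) has_vector_derivative \<i> *s ((R ** M ** P) *v v)) (at 0)"
    if "(f has_vector_derivative \<i> *s (M *v (P *v v))) (at 0)" for f :: "real \<Rightarrow> complex ^ 'n" and M v
    using bounded_linear.has_vector_derivative[OF matrix_vector_mul_bounded_linear that, of R]
    by (simp only: vector_scalar_commute matrix_vector_mul_assoc matrix_mul_assoc)
  have iff: "has_left_inv_derivative (\<lambda>x. R *v F x) X x (- ((R ** \<sigma> X ** P) *v (R *v F x)))
      \<longleftrightarrow> has_left_inv_derivative F X x (- (\<sigma> X *v F x))" (is "?L \<longleftrightarrow> ?R") for F X x
  proof -
    have e: "(R ** \<sigma> X ** P) *v (R *v F x) = R *v (\<sigma> X *v F x)"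
    proof -
      have "R ** \<sigma> X ** P ** R = R ** \<sigma> X" by (simp add: matrix_mul_assoc[symmetric] PR)
      then show ?thesis by (simp only: matrix_vector_mul_assoc)
    qed
    have n: "- (R *v w) = R *v (- w)" for w by (simp add: matrix_vector_mult_def vec_eq_iff sum_negf)
    show ?thesis
    proof
      assume ?L
      from has_left_inv_derivative_matrix[OF this, of P] show ?R
        unfolding e n by (simp add: matrix_vector_mul_assoc[of P] PR)
    next
      assume ?R
      from has_left_inv_derivative_matrix[OF this, of R] show ?L unfolding e n .
    qed
  qed
  show ?thesis
    unfolding associated_representation_def ft lift iff
  proof (intro conjI allI impI)
    show "bb_representation (\<lambda>X. R ** \<sigma> X ** P)" by (rule bb_representation_basis_change[OF as(1) PR diag])
  qed (rule der[OF as(2)] der[OF as(3)] as(4), assumption?)+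
qed

text \<open>The number of indices with a given pair of diagonal entries is the dimension of the joint
  eigenspace.\<close>

lemma multiplicity_free_weights_distinct:
  fixes P R :: "complex ^ 'n ^ 'n"
  assumes mf: "multiplicity_free \<sigma>" and PR: "P ** R = mat 1" "R ** P = mat 1"
    and diag: "R ** \<sigma> h1 ** P = diag_mat d" "R ** \<sigma> h2 ** P = diag_mat e"
  shows "inj (\<lambda>i. (d i, e i))"
proof (rule injI)
  fix i k assume ik: "(d i, e i) = (d k, e k)"
  let ?A = "{j. d j = d i \<and> e j = e i}"
  define W where "W = {v :: complex ^ 'n. \<forall>j. j \<notin> ?A \<longrightarrow> v $ j = 0}"
  have eig: "\<sigma> X *v (P *v v) = c *s (P *v v) \<longleftrightarrow> (\<forall>j. f j \<noteq> c \<longrightarrow> v $ j = 0)"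
    if X: "R ** \<sigma> X ** P = diag_mat f" for X f c v
  proof -
    have "P ** diag_mat f = (P ** R) ** \<sigma> X ** P" unfolding X[symmetric] by (simp only: matrix_mul_assoc)
    then have "\<sigma> X *v (P *v v) = P *v (diag_mat f *v v)" by (simp add: matrix_vector_mul_assoc PR)
    then have "\<sigma> X *v (P *v v) = c *s (P *v v) \<longleftrightarrow> P *v (diag_mat f *v v) = P *v (c *s v)"
      by (simp add: vector_scalar_commute)
    also have "\<dots> \<longleftrightarrow> diag_mat f *v v = c *s v"
      by (metis PR(2) matrix_vector_mul_assoc matrix_vector_mul_lid)
    also have "\<dots> \<longleftrightarrow> (\<forall>j. f j \<noteq> c \<longrightarrow> v $ j = 0)" by (auto simp: diag_mat_mult vec_eq_iff)
    finally show ?thesis .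
  qed
  have J: "joint_eigenspace \<sigma> (d i) (e i) = (*v) P ` W"
  proof (rule Set.set_eqI)
    fix u
    have u: "u = P *v (R *v u)" by (simp add: matrix_vector_mul_assoc PR)
    have "u \<in> joint_eigenspace \<sigma> (d i) (e i) \<longleftrightarrow> R *v u \<in> W"
    proof -
      have "u \<in> joint_eigenspace \<sigma> (d i) (e i) \<longleftrightarrow>
          P *v (R *v u) \<in> joint_eigenspace \<sigma> (d i) (e i)" unfolding u[symmetric] ..
      also have "\<dots> \<longleftrightarrow> R *v u \<in> W"
        unfolding joint_eigenspace_def eigenspace_def W_def Int_iff mem_Collect_eq
          eig[OF diag(1)] eig[OF diag(2)] by blast
      finally show ?thesis .
    qed
    also have "\<dots> \<longleftrightarrow> u \<in> (*v) P ` W"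
    proof
      assume "u \<in> (*v) P ` W"
      then obtain v where "u = P *v v" "v \<in> W" by blast
      then show "R *v u \<in> W" by (simp add: matrix_vector_mul_assoc PR)
    qed (use u in blast)
    finally show "u \<in> joint_eigenspace \<sigma> (d i) (e i) \<longleftrightarrow> u \<in> (*v) P ` W" .
  qed
  have inj: "inj ((*v) P)"
    by (rule injI) (metis PR(2) matrix_vector_mul_assoc matrix_vector_mul_lid)
  have "vec.dim ((*v) P ` W) = vec.dim W"
    by (rule vec.dim_image_eq) (use inj in \<open>auto intro: inj_on_subset\<close>)
  also have "\<dots> = card ?A" unfolding W_def by (rule dim_substandard_cart)
  finally have dim: "vec.dim (joint_eigenspace \<sigma> (d i) (e i)) = card ?A" unfolding J .
  have "axis i 1 \<in> W" by (auto simp: W_def axis_def)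
  then have "P *v axis i 1 \<in> joint_eigenspace \<sigma> (d i) (e i)" unfolding J by blast
  moreover have "P *v axis i 1 \<noteq> 0"
    using inj by (metis axis_eq_0_iff injD matrix_vector_mult_0_right zero_neq_one)
  ultimately have "joint_eigenspace \<sigma> (d i) (e i) \<noteq> {0}" by blast
  then have "card ?A = 1" using mf dim unfolding multiplicity_free_def by metis
  then obtain a where a: "?A = {a}" by (rule card_1_singletonE)
  have "i \<in> ?A" "k \<in> ?A" using ik by simp_all
  then show "i = k" unfolding a by simp
qed

theorem theorem5p5:
  fixes E :: "('e, 'n::finite) hbundle"
    and act :: "mob2 \<Rightarrow> 'e \<Rightarrow> 'e"
    and \<phi> :: "'e \<Rightarrow> complex ^ 'n"
    and \<sigma> :: "mat22 \<times> mat22 \<Rightarrow> complex ^ 'n ^ 'n"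
  assumes "hermitian_holomorphic_bundle E"
    and "irreducible_bundle E"
    and "homogeneous_bundle E"
    and "isometric_action E act"
    and "global_holomorphic_triv E \<phi>"
    and "associated_representation E act \<phi> \<sigma>"
    and "multiplicity_free \<sigma>"
  shows "\<exists>\<psi> (\<rho> :: mat22 \<times> mat22 \<Rightarrow> complex ^ 'n ^ 'n) (l1::real) (l2::real)
            (s::nat) (m :: nat \<Rightarrow> nat) (j :: nat \<Rightarrow> nat).
      global_holomorphic_triv E \<psi> \<and>
      (\<forall>x\<in>carrier mob2_cover. \<forall>z\<in>bidisc.
         let g1 = mob_of (fst x); g2 = mob_of (snd x); z1 = fst z; z2 = snd z in
         cocycle E act \<psi> x z =
           mat_exp (mat_scale (deriv (deriv g1) z1 / (2 * deriv g1 z1)) (\<rho> y1)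
                  + mat_scale (deriv (deriv g2) z2 / (2 * deriv g2 z2)) (\<rho> y2))
           ** mat_exp (mat_scale (- log_mob_deriv (fst x) z1) (\<rho> h1)
                     + mat_scale (- log_mob_deriv (snd x) z2) (\<rho> h2))) \<and>
      bb_representation \<rho> \<and> multiplicity_free \<rho> \<and> indecomposable \<rho> \<and>
      largest_eigenvalue (\<rho> h1) l1 \<and> largest_eigenvalue (\<rho> h2) l2 \<and>
      eigenvalues (\<rho> h1) = {of_real l1 - of_nat i | i. i \<le> s} \<and>
      (\<forall>i\<le>s. vec.dim (eigenspace (\<rho> h1) (of_real l1 - of_nat i)) = m i + 1) \<and>
      (\<forall>i i'. i \<le> i' \<and> i' \<le> s \<longrightarrow> j i' \<le> j i \<and> j i' + m i' \<le> j i + m i) \<and>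
      (let V = weight_space \<rho> l1 l2 (staircase s m j) in
         \<forall>\<theta>\<in>staircase s m j. V \<theta> \<noteq> {0} \<and>
           (\<lambda>v. \<rho> y1 *v v) ` V \<theta> = V (\<theta> + (1, 0)) \<and>
           (\<lambda>v. \<rho> y2 *v v) ` V \<theta> = V (\<theta> + (0, 1)))"
proof -
  have rep: "bb_representation \<sigma>" using assms(6) by (simp add: associated_representation_def)
  then have "diagonalizable (\<sigma> h1)" "diagonalizable (\<sigma> h2)" by (simp_all add: bb_representation_def)
  moreover have "\<sigma> h1 ** \<sigma> h2 = \<sigma> h2 ** \<sigma> h1"
    using bb_representation_lowering[OF rep] by (rule lowering_operators.HH)
  ultimately obtain P R :: "complex ^ 'n ^ 'n" and d e where PR: "P ** R = mat 1" "R ** P = mat 1"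
    and diag: "R ** \<sigma> h1 ** P = diag_mat d" "R ** \<sigma> h2 ** P = diag_mat e"
    by (rule simultaneous_diagonalization)
  define \<rho> where "\<rho> = (\<lambda>X. R ** \<sigma> X ** P)"
  define \<phi>' where "\<phi>' = (\<lambda>e. R *v \<phi> e)"
  have hol: "holomorphic_bundle E" using assms(1) by (simp add: hermitian_holomorphic_bundle_def)
  have lt: "linear_triv E bidisc \<phi>" using assms(5) by (simp add: holomorphic_triv_def)
  interpret irreducible_weight_bundle E act \<phi>' \<rho> d e
  proof unfold_locales
    show "global_holomorphic_triv E \<phi>'"
      unfolding \<phi>'_def by (rule global_holomorphic_triv_basis_change[OF hol assms(5) PR])
    show "associated_representation E act \<phi>' \<rho>"
      unfolding \<phi>'_def \<rho>_def by (rule associated_representation_basis_change[OF lt assms(6) PR diag])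
    show "\<rho> h1 = diag_mat d" "\<rho> h2 = diag_mat e" unfolding \<rho>_def by (rule diag)+
    show "inj (\<lambda>i. (d i, e i))" by (rule multiplicity_free_weights_distinct[OF assms(7) PR diag])
  qed (rule assms)+
  have "let g1 = mob_of (fst x); g2 = mob_of (snd x); z1 = fst z; z2 = snd z in
         cocycle E act \<psi> x z =
           mat_exp (mat_scale (deriv (deriv g1) z1 / (2 * deriv g1 z1)) (\<rho> y1)
                  + mat_scale (deriv (deriv g2) z2 / (2 * deriv g2 z2)) (\<rho> y2))
           ** mat_exp (mat_scale (- log_mob_deriv (fst x) z1) (\<rho> h1)
                     + mat_scale (- log_mob_deriv (snd x) z2) (\<rho> h2))"
    if x: "x \<in> carrier mob2_cover" and z: "z \<in> bidisc" for x z
  proof -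
    have c: "cmod (snd (fst x)) < 1" "cmod (snd (snd x)) < 1" "cmod (fst z) < 1" "cmod (snd z) < 1"
      using x z by (auto simp: mob2_cover_simps)
    show ?thesis
      unfolding Let_def deriv_deriv_mob_of[OF c(1,3)] deriv_deriv_mob_of[OF c(2,4)]
        cocycle_\<psi>[OF x z] formula_cocycle_def y_exp_def h_exp_def ..
  qed
  then have "\<forall>x\<in>carrier mob2_cover. \<forall>z\<in>bidisc.
         let g1 = mob_of (fst x); g2 = mob_of (snd x); z1 = fst z; z2 = snd z in
         cocycle E act \<psi> x z =
           mat_exp (mat_scale (deriv (deriv g1) z1 / (2 * deriv g1 z1)) (\<rho> y1)
                  + mat_scale (deriv (deriv g2) z2 / (2 * deriv g2 z2)) (\<rho> y2))
           ** mat_exp (mat_scale (- log_mob_deriv (fst x) z1) (\<rho> h1)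
                     + mat_scale (- log_mob_deriv (snd x) z2) (\<rho> h2))"
    by (intro ballI)
  with staircase_structure show ?thesis
    using \<psi>_triv rep multiplicity_free_\<rho> indecomposable_\<rho>
    by (elim exE conjE) (intro exI conjI)
qed

end
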